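(* Let $\alpha>0$ and let $0<p,q\le\infty$ be such that $2/p-2/q$ is an integer. Then a set $\Lambda\subset\mathbb{C}_0$ is complete interpolating for $\mathcal{F}^p_\alpha$ if and only if it is complete interpolating for $\mathcal{F}^q_\alpha$. In particular, $\Lambda$ is complete interpolating for $\mathcal{F}^\infty_\alpha$ if and only if it is complete interpolating for $\mathcal{F}^2_\alpha$, if and only if it is complete interpolating for $\mathcal{F}^1_\alpha$.
   Context: Notation: $\mathbb{C}_0=\mathbb{C}\setminus\{0\}$, and $2/p=0$ when $p=\infty$. Two-sided small Fock space: for $\alpha>0$ and $0<p\le\infty$, $\mathcal{F}^p_\alpha$ is the space of functions $f$ holomorphic on $\mathbb{C}_0$ with $\|f\|_{\mathcal{F}^p_\alpha}=\big\|f(z)e^{-\alpha\log^2|z|}\big\|_{L^p(\mathbb{C})}<\infty$ (with respect to two-dimensional Lebesgue measure). Complete interpolating: for a set $\Lambda\subset\mathbb{C}_0$ consider the restriction operator $R_\Lambda: f\mapsto\big(f(\lambda)|\lambda|^{2/p}e^{-\alpha\log^2|\lambda|}\big)_{\lambda\in\Lambda}$ on $\mathcal{F}^p_\alpha$. The set $\Lambda$ is complete interpolating for $\mathcal{F}^p_\alpha$ if $R_\Lambda$ is an isomorphism (bounded linear bijection with bounded inverse) between $\mathcal{F}^p_\alpha$ and $\ell^p(\Lambda)$. *)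

theory Defs
  imports "HOL-Complex_Analysis.Complex_Analysis" "HOL-Probability.Essential_Supremum"
begin

abbreviation punctured_plane :: "complex set" where
  "punctured_plane \<equiv> UNIV - {0}"

definition two_over :: "ennreal \<Rightarrow> real" where
  "two_over p = (if p = \<infinity> then 0 else 2 / enn2real p)"

text \<open>The $L^p$ (quasi-)norm with values in $[0,\infty]$, for $0 < p \le \infty$ and measurable \<open>f\<close>.
  Over \<open>count_space A\<close> it is the $\ell^p(A)$ (quasi-)norm.\<close>

definition Lp_norm :: "'a measure \<Rightarrow> ennreal \<Rightarrow> ('a \<Rightarrow> complex) \<Rightarrow> ennreal" where
  "Lp_norm M p f =
     (if p = \<infinity> then esssup M (\<lambda>x. ennreal (norm (f x)))
      else let I = (\<integral>\<^sup>+ x. ennreal (norm (f x) powr enn2real p) \<partial>M)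
           in if I = \<infinity> then \<infinity> else ennreal (enn2real I powr (1 / enn2real p)))"

definition fock_norm :: "real \<Rightarrow> ennreal \<Rightarrow> (complex \<Rightarrow> complex) \<Rightarrow> ennreal" where
  "fock_norm \<alpha> p f =
     Lp_norm lborel p (\<lambda>z. f z * of_real (exp (- \<alpha> * (ln (norm z))\<^sup>2)))"

text \<open>A function on the punctured plane is represented by the total function that extends it
  by \<open>0\<close> at the origin, so that distinct elements of the set below are distinct functions on the
  punctured plane. In the same way a family indexed by \<open>\<Lambda>\<close> is extended by \<open>0\<close> off \<open>\<Lambda>\<close>. The vector
  space operations are pointwise.\<close>

definition fock_space :: "real \<Rightarrow> ennreal \<Rightarrow> (complex \<Rightarrow> complex) set" where
  "fock_space \<alpha> p =
     {f. f holomorphic_on punctured_plane \<and> f 0 = 0 \<and> fock_norm \<alpha> p f < \<infinity>}"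

definition lp_norm :: "complex set \<Rightarrow> ennreal \<Rightarrow> (complex \<Rightarrow> complex) \<Rightarrow> ennreal" where
  "lp_norm \<Lambda> p a = Lp_norm (count_space \<Lambda>) p a"

definition lp_space :: "complex set \<Rightarrow> ennreal \<Rightarrow> (complex \<Rightarrow> complex) set" where
  "lp_space \<Lambda> p = {a. (\<forall>z. z \<notin> \<Lambda> \<longrightarrow> a z = 0) \<and> lp_norm \<Lambda> p a < \<infinity>}"

definition restriction_op ::
  "real \<Rightarrow> ennreal \<Rightarrow> complex set \<Rightarrow> (complex \<Rightarrow> complex) \<Rightarrow> complex \<Rightarrow> complex" where
  "restriction_op \<alpha> p \<Lambda> f =
     (\<lambda>z. if z \<in> \<Lambda>
          then f z * of_real (norm z powr two_over p * exp (- \<alpha> * (ln (norm z))\<^sup>2))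
          else 0)"

definition linear_map_on ::
  "('a \<Rightarrow> complex) set \<Rightarrow> (('a \<Rightarrow> complex) \<Rightarrow> ('b \<Rightarrow> complex)) \<Rightarrow> bool" where
  "linear_map_on V T \<longleftrightarrow>
     (\<forall>f\<in>V. \<forall>g\<in>V. T (\<lambda>x. f x + g x) = (\<lambda>y. T f y + T g y)) \<and>
     (\<forall>c. \<forall>f\<in>V. T (\<lambda>x. c * f x) = (\<lambda>y. c * T f y))"

definition bounded_map_on :: "'v set \<Rightarrow> ('v \<Rightarrow> ennreal) \<Rightarrow> ('w \<Rightarrow> ennreal) \<Rightarrow> ('v \<Rightarrow> 'w) \<Rightarrow> bool" where
  "bounded_map_on V nV nW T \<longleftrightarrow> (\<exists>C::real. \<forall>f\<in>V. nW (T f) \<le> ennreal C * nV f)"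

definition isomorphism_between ::
  "('a \<Rightarrow> complex) set \<Rightarrow> (('a \<Rightarrow> complex) \<Rightarrow> ennreal) \<Rightarrow>
   ('b \<Rightarrow> complex) set \<Rightarrow> (('b \<Rightarrow> complex) \<Rightarrow> ennreal) \<Rightarrow>
   (('a \<Rightarrow> complex) \<Rightarrow> ('b \<Rightarrow> complex)) \<Rightarrow> bool" where
  "isomorphism_between V nV W nW T \<longleftrightarrow>
     linear_map_on V T \<and> bij_betw T V W \<and>
     bounded_map_on V nV nW T \<and> bounded_map_on W nW nV (inv_into V T)"

definition complete_interpolating :: "real \<Rightarrow> ennreal \<Rightarrow> complex set \<Rightarrow> bool" where
  "complete_interpolating \<alpha> p \<Lambda> \<longleftrightarrow>
     isomorphism_between (fock_space \<alpha> p) (fock_norm \<alpha> p) (lp_space \<Lambda> p) (lp_norm \<Lambda> p)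
       (restriction_op \<alpha> p \<Lambda>)"

end

theory Submission
  imports Defs
begin

text \<open>With Haar measure \<open>dm / \<bar>z\<bar>\<^sup>2\<close> on the punctured plane the \<open>p\<close>-norm becomes the \<open>L\<^sup>p\<close> norm of
  \<open>f\<close> times \<open>\<bar>z\<bar>\<^sup>\<beta> exp (- \<alpha> ln\<^sup>2 \<bar>z\<bar>)\<close>, where \<open>\<beta> = 2 / p\<close>, and multiplication by \<open>z\<^sup>n\<close> shifts \<open>\<beta>\<close> by \<open>n\<close>.
  So it suffices to show, for a fixed weight, that complete interpolation does not depend on the
  exponent. Let \<open>k\<^sub>l\<close> be the function that is \<open>0\<close> on \<open>\<Lambda> - {l}\<close> and normalised at \<open>l\<close>. By uniqueness all
  \<open>(z - l) k\<^sub>l\<close> are multiples of one function \<open>F\<close>. Because \<open>\<Lambda>\<close> is separated and relatively dense in the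
  logarithmic scale, the uniform bound on \<open>k\<^sub>l\<close> (for \<open>p < \<infinity>\<close>), or on sums of the moduli of the \<open>k\<^sub>l\<close> (for
  \<open>p = \<infinity>\<close>), says that a monotone function \<open>T\<close> built from \<open>F\<close> is controlled by its own increments; hence
  \<open>T\<close>, and with it \<open>k\<^sub>l\<close>, decays exponentially in \<open>\<bar>ln \<bar>z\<bar> - ln \<bar>l\<bar>\<bar>\<close>. Exponential decay makes the
  interpolation series \<open>\<Sum> a\<^sub>l k\<^sub>l\<close> bounded for every exponent.\<close>

subsection \<open>Weighted bounds\<close>

text \<open>The point that decay alone does not settle is uniqueness for the new exponent: a
  function that vanishes on \<open>\<Lambda>\<close> and is merely bounded against the weight need
  not lie in the \<open>p\<close>-space when \<open>p < \<infinity>\<close>. Removing two zeros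
  \<open>l\<close>, \<open>a\<close> and multiplying by \<open>z\<close> produces decay like
  min(|z|, 1/|z|), which is integrable to every power, so this quotient is a combination of the two
  kernels at \<open>l\<close> and \<open>a\<close>; decay of the kernels then lets \<open>a\<close>
  run to either end of the punctured plane. A second obstacle is that \<open>F\<close> is
  \<open>z - l\<close> times a multiple of the kernel: its modulus compares with the kernel through
  |z| outside \<open>l\<close> and through |l| inside. Hence \<open>F / z\<close> is used on the
  outer side, \<open>F\<close> on the inner side, and one abstract lemma covers both. For finite
  \<open>p\<close> the monotone function is a tail integral of a power of the modulus. A sup bound
  has no such integral, so for \<open>p = \<infinity>\<close> it is replaced by a sum over nodes of
  reciprocal normalising constants. The estimates are arranged so that exponents below 1 need no
  separate treatment.\<close>

definition haar :: "complex measure" where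
  "haar = density lborel (\<lambda>z. ennreal (1 / (norm z)\<^sup>2))"

text \<open>As \<open>0 powr \<beta> = 0\<close>, the weight vanishes at the origin, so a product of
  \<open>norm (f z)\<close> with it does not depend on the arbitrary value \<open>f 0\<close>. The
  power \<open>\<beta>\<close> is a parameter of its own, which allows the exponent to change while
  the weight stays fixed.\<close>

definition wt :: "real \<Rightarrow> real \<Rightarrow> complex \<Rightarrow> real" where
  "wt \<alpha> \<beta> z = norm z powr \<beta> * exp (- \<alpha> * (ln (norm z))\<^sup>2)"

text \<open>For \<open>p = \<infinity>\<close> the bound is imposed everywhere on \<open>A\<close>, not just almost everywhere.\<close>

definition Lbound :: "'a measure \<Rightarrow> 'a set \<Rightarrow> ennreal \<Rightarrow> ('a \<Rightarrow> real) \<Rightarrow> real \<Rightarrow> bool" where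
  "Lbound M A p u K \<longleftrightarrow>
     (if p = \<infinity> then \<forall>x\<in>A. u x \<le> K
      else (\<integral>\<^sup>+ x. ennreal (u x powr enn2real p) \<partial>M) \<le> ennreal (K powr enn2real p))"

abbreviation "Cbound p u K \<equiv> Lbound haar punctured_plane p u K"
abbreviation "Dbound \<Lambda> p u K \<equiv> Lbound (count_space \<Lambda>) \<Lambda> p u K"

abbreviation holo :: "(complex \<Rightarrow> complex) \<Rightarrow> bool" where
  "holo f \<equiv> f holomorphic_on punctured_plane"

abbreviation lg :: "complex \<Rightarrow> real" where
  "lg z \<equiv> ln (norm z)"

abbreviation "Fbound \<alpha> \<beta> p f K \<equiv> Cbound p (\<lambda>z. norm (f z :: complex) * wt \<alpha> \<beta> z) K"
abbreviation "Sbound \<alpha> \<beta> \<Lambda> p f K \<equiv> Dbound \<Lambda> p (\<lambda>z. norm (f z :: complex) * wt \<alpha> \<beta> z) K"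

lemma enn2real_pos: "0 < p \<Longrightarrow> p \<noteq> \<infinity> \<Longrightarrow> 0 < enn2real (p::ennreal)"
  by (simp add: enn2real_positive_iff less_top)

lemma wt_0 [simp]: "wt \<alpha> \<beta> 0 = 0"
  by (simp add: wt_def)

lemma wt_pos: "z \<noteq> 0 \<Longrightarrow> 0 < wt \<alpha> \<beta> z"
  by (simp add: wt_def)

lemma wt_nonneg [simp]: "0 \<le> wt \<alpha> \<beta> z"
  by (simp add: wt_def)

lemma wt_exp: "z \<noteq> 0 \<Longrightarrow> wt \<alpha> \<beta> z = exp (\<beta> * lg z - \<alpha> * (lg z)\<^sup>2)"
  by (simp add: wt_def powr_def exp_diff exp_minus field_simps)

lemma wt_add: "z \<noteq> 0 \<Longrightarrow> wt \<alpha> (\<beta> + s) z = norm z powr s * wt \<alpha> \<beta> z"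
  by (simp add: wt_def powr_add)

lemma sets_haar [simp, measurable_cong]: "sets haar = sets borel"
  by (simp add: haar_def)

lemma space_haar [simp]: "space haar = UNIV"
  by (simp add: haar_def)

lemma nn_integral_haar:
  assumes "f \<in> borel_measurable borel"
  shows "(\<integral>\<^sup>+ z. f z \<partial>haar) = (\<integral>\<^sup>+ z. ennreal (1 / (norm z)\<^sup>2) * f z \<partial>lborel)"
  unfolding haar_def using assms by (subst nn_integral_density) auto

text \<open>The density has the value \<open>1 / 0 = 0\<close> at the origin, which therefore drops
  out of the condition to be checked.\<close>

lemma AE_haar: "AE z in haar. z \<in> punctured_plane"
  unfolding haar_def by (subst AE_density) (auto intro: AE_I2)

lemma AE_count_space_mem: "AE z in count_space A. z \<in> A"
  by (simp add: AE_count_space)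

lemma Lbound_mono:
  assumes "AE x in M. x \<in> A" "\<And>x. x \<in> A \<Longrightarrow> 0 \<le> u x" "\<And>x. x \<in> A \<Longrightarrow> u x \<le> v x"
    and "Lbound M A p v K" "K \<le> K'" "0 \<le> K"
  shows "Lbound M A p u K'"
proof (cases "p = \<infinity>")
  case True
  with assms show ?thesis by (fastforce simp: Lbound_def)
next
  case False
  have "(\<integral>\<^sup>+ x. ennreal (u x powr enn2real p) \<partial>M) \<le> (\<integral>\<^sup>+ x. ennreal (v x powr enn2real p) \<partial>M)"
    by (rule nn_integral_mono_AE, rule AE_mp[OF assms(1)], rule AE_I2)
      (use assms(2,3) in \<open>auto intro!: ennreal_leI powr_mono2\<close>)
  also have "\<dots> \<le> ennreal (K powr enn2real p)"
    using assms(4) False by (simp add: Lbound_def)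
  also have "\<dots> \<le> ennreal (K' powr enn2real p)"
    using assms(5,6) by (auto intro!: ennreal_leI powr_mono2)
  finally show ?thesis using False by (simp add: Lbound_def)
qed

lemma Lbound_scale:
  assumes "AE x in M. x \<in> A" "\<And>x. x \<in> A \<Longrightarrow> 0 \<le> u x" "u \<in> borel_measurable M" "0 \<le> c" "0 \<le> K"
    and "Lbound M A p u K"
  shows "Lbound M A p (\<lambda>x. c * u x) (c * K)"
proof (cases "p = \<infinity>")
  case True
  with assms show ?thesis by (auto simp: Lbound_def intro: mult_left_mono)
next
  case False
  have "(\<integral>\<^sup>+ x. ennreal ((c * u x) powr enn2real p) \<partial>M)
      = (\<integral>\<^sup>+ x. ennreal (c powr enn2real p) * ennreal (u x powr enn2real p) \<partial>M)"
    by (rule nn_integral_cong_AE, rule AE_mp[OF assms(1)], rule AE_I2)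
      (use assms(2,4) in \<open>auto simp: powr_mult ennreal_mult\<close>)
  also have "\<dots> = ennreal (c powr enn2real p) * (\<integral>\<^sup>+ x. ennreal (u x powr enn2real p) \<partial>M)"
    using assms(3) by (intro nn_integral_cmult) auto
  also have "\<dots> \<le> ennreal (c powr enn2real p) * ennreal (K powr enn2real p)"
    using assms(6) False by (intro mult_left_mono) (auto simp: Lbound_def)
  also have "\<dots> = ennreal ((c * K) powr enn2real p)"
    using assms(4,5) by (simp add: powr_mult ennreal_mult)
  finally show ?thesis using False by (simp add: Lbound_def)
qed

lemma Lbound_add:
  assumes "AE x in M. x \<in> A" "\<And>x. x \<in> A \<Longrightarrow> 0 \<le> u x" "\<And>x. x \<in> A \<Longrightarrow> 0 \<le> v x"
    and [measurable]: "u \<in> borel_measurable M" "v \<in> borel_measurable M"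
    and "Lbound M A p u K" "Lbound M A p v K'" "0 < p" "0 \<le> K" "0 \<le> K'"
  shows "\<exists>K\<ge>0. Lbound M A p (\<lambda>x. u x + v x) K"
proof (cases "p = \<infinity>")
  case True
  with assms show ?thesis by (intro exI[of _ "K + K'"]) (auto simp: Lbound_def intro: add_mono)
next
  case False
  define P where "P = enn2real p"
  have P: "0 < P" using enn2real_pos[OF \<open>0 < p\<close> False] by (simp add: P_def)
  \<comment> \<open>Bounding the sum by twice the maximum works for every positive \<open>P\<close>,
    including \<open>P < 1\<close>, where the norm is only a quasi-norm.\<close>
  have pt: "(a + b) powr P \<le> 2 powr P * (a powr P + b powr P)" if "0 \<le> a" "0 \<le> b" for a b :: real
  proof -
    have "(a + b) powr P \<le> (2 * max a b) powr P"
      using that P by (intro powr_mono2) auto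
    also have "\<dots> = 2 powr P * max a b powr P" using that by (simp add: powr_mult)
    also have "\<dots> \<le> 2 powr P * (a powr P + b powr P)"
      by (intro mult_left_mono) (auto simp: max_def)
    finally show ?thesis .
  qed
  define Y where "Y = 2 powr P * (K powr P + K' powr P)"
  have Y: "0 \<le> Y" by (simp add: Y_def)
  have "(\<integral>\<^sup>+ x. ennreal ((u x + v x) powr P) \<partial>M)
      \<le> (\<integral>\<^sup>+ x. ennreal (2 powr P) * (ennreal (u x powr P) + ennreal (v x powr P)) \<partial>M)"
    by (rule nn_integral_mono_AE, rule AE_mp[OF assms(1)], rule AE_I2)
      (use assms(2,3) pt in \<open>auto simp flip: ennreal_plus ennreal_mult intro!: ennreal_leI\<close>)
  also have "\<dots> = ennreal (2 powr P) *
      ((\<integral>\<^sup>+ x. ennreal (u x powr P) \<partial>M) + (\<integral>\<^sup>+ x. ennreal (v x powr P) \<partial>M))"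
    by (subst nn_integral_cmult) (auto simp: nn_integral_add)
  also have "\<dots> \<le> ennreal (2 powr P) * (ennreal (K powr P) + ennreal (K' powr P))"
    using assms(6,7) False by (intro mult_left_mono add_mono) (auto simp: Lbound_def P_def)
  also have "\<dots> = ennreal Y"
    by (simp add: Y_def flip: ennreal_plus ennreal_mult)
  also have "\<dots> = ennreal ((Y powr (1 / P)) powr P)"
    using P Y by (simp add: powr_powr)
  finally show ?thesis
    using False by (intro exI[of _ "Y powr (1/P)"]) (auto simp: Lbound_def P_def)
qed

text \<open>Points have counting measure one, so l^p embeds in l^infinity with constant one. The
  continuous counterpart \<open>Cbound_pointwise\<close> needs holomorphy instead.\<close>

lemma Dbound_pointwise:
  assumes "Dbound \<Lambda> p u K" "0 < p" "0 \<le> K" "x \<in> \<Lambda>" "0 \<le> u x"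
  shows "u x \<le> K"
proof (cases "p = \<infinity>")
  case True
  with assms show ?thesis by (auto simp: Lbound_def)
next
  case False
  define P where "P = enn2real p"
  have P: "0 < P" using enn2real_pos[OF \<open>0 < p\<close> False] by (simp add: P_def)
  have "ennreal (u x powr P) \<le> (\<integral>\<^sup>+ x. ennreal (u x powr P) \<partial>count_space \<Lambda>)"
    using assms(4) by (rule nn_integral_ge_point)
  also have "\<dots> \<le> ennreal (K powr P)" using assms(1) False by (simp add: Lbound_def P_def)
  finally have "u x powr P \<le> K powr P" by simp
  then show ?thesis using P assms(3,5) by (meson not_less powr_less_mono2)
qed

lemma holo_wt_measurable:
  assumes "holo f"
  shows "(\<lambda>z. norm (f z) * wt \<alpha> \<beta> z) \<in> borel_measurable borel"
proof -
  have "continuous_on punctured_plane (\<lambda>z. norm (f z) * wt \<alpha> \<beta> z)"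
    unfolding wt_def using holomorphic_on_imp_continuous_on[OF assms]
    by (intro continuous_intros) auto
  then have "(\<lambda>z. if z \<in> punctured_plane then norm (f z) * wt \<alpha> \<beta> z else 0) \<in> borel_measurable borel"
    by (intro borel_measurable_continuous_on_if) auto
  also have "(\<lambda>z. if z \<in> punctured_plane then norm (f z) * wt \<alpha> \<beta> z else 0) = (\<lambda>z. norm (f z) * wt \<alpha> \<beta> z)"
    by auto
  finally show ?thesis .
qed

subsection \<open>Pointwise estimates for holomorphic functions\<close>

lemma holo_lipschitz:
  assumes "h holomorphic_on cball a \<rho>" "0 < \<rho>" "\<And>z. z \<in> cball a \<rho> \<Longrightarrow> norm (h z) \<le> B"
    and "z \<in> cball a (\<rho>/2)"
  shows "norm (h z - h a) \<le> 2 * B / \<rho> * norm (z - a)"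
proof (rule field_differentiable_bound[where S = "cball a (\<rho>/2)" and f' = "deriv h"])
  show "z \<in> cball a (\<rho>/2)" "a \<in> cball a (\<rho>/2)" "convex (cball a (\<rho>/2))"
    using assms by auto
next
  fix x assume x: "x \<in> cball a (\<rho>/2)"
  have sub: "cball x (\<rho>/2) \<subseteq> cball a \<rho>"
  proof
    fix y assume "y \<in> cball x (\<rho>/2)"
    then show "y \<in> cball a \<rho>"
      using x dist_triangle[of a y x] by (auto simp: dist_commute)
  qed
  have xb: "x \<in> ball a \<rho>" using x assms(2) by auto
  have hb: "h holomorphic_on ball a \<rho>"
    using assms(1) ball_subset_cball holomorphic_on_subset by blast
  then show "(h has_field_derivative deriv h x) (at x within cball a (\<rho>/2))"
    using holomorphic_derivI[OF hb open_ball xb] has_field_derivative_at_within by blast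
  have "norm ((deriv ^^ 1) h x) \<le> fact 1 * B / (\<rho>/2) ^ 1"
  proof (rule Cauchy_inequality)
    show "h holomorphic_on ball x (\<rho>/2)"
      using assms(1) sub ball_subset_cball holomorphic_on_subset by blast
    show "continuous_on (cball x (\<rho>/2)) h"
      using assms(1) sub holomorphic_on_subset holomorphic_on_imp_continuous_on by blast
    show "norm (h y) \<le> B" if "norm (x - y) = \<rho>/2" for y
      using sub that assms(3) by (auto simp: dist_norm subset_iff)
  qed (use assms in auto)
  then show "norm (deriv h x) \<le> 2 * B / \<rho>" by (simp add: field_simps)
qed

lemma lborel_ball_complex:
  assumes "0 \<le> r" shows "emeasure lborel (ball (a::complex) r) = ennreal (pi * r\<^sup>2)"
  using assms by (simp add: emeasure_ball unit_ball_vol_2)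

text \<open>Maximising \<open>\<bar>h v\<bar> (R - \<bar>v - z\<bar>)\<^sup>2\<^sup>/\<^sup>P\<close> gives a point around which \<open>h\<close> is essentially constant on a
  disc of comparable radius; this replaces subharmonicity of \<open>\<bar>h\<bar>\<^sup>P\<close> and treats all \<open>P > 0\<close> alike.\<close>

lemma holo_pointwise:
  fixes P :: real
  assumes P: "0 < P"
  shows "\<exists>C>0. \<forall>h z R. h holomorphic_on cball z R \<longrightarrow> 0 < R \<longrightarrow>
    ennreal (norm (h z) powr P * R\<^sup>2) \<le> ennreal C * (\<integral>\<^sup>+ v. ennreal (norm (h v) powr P) * indicator (ball z R) v \<partial>lborel)"
proof -
  \<comment> \<open>With this exponent the \<open>P\<close>-th power of \<open>u\<close> carries the
    square of the distance to the boundary, which matches the factor \<open>R\<^sup>2\<close> of the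
    claim.\<close>
  define k where "k = 2 / P"
  have k: "0 < k" using P by (simp add: k_def)
  \<comment> \<open>On the disc of radius \<open>d/2\<close> about the maximum point
    \<open>a\<close> the modulus is at most \<open>2 powr k * norm (h a)\<close>. The Lipschitz
    bound then lets \<open>h\<close> vary by at most \<open>4 * 2 powr k * c * norm (h a)\<close> on
    the disc of radius \<open>c * d\<close>, and this choice makes that
    \<open>norm (h a) / 2\<close>.\<close>
  define c where "c = 1 / (8 * 2 powr k)"
  have "1 \<le> 2 powr k" using k by (simp add: ge_one_powr_ge_zero)
  then have c: "0 < c" "c \<le> 1/8" by (auto simp: c_def field_simps)
  define C where "C = 2 powr P / (pi * c\<^sup>2)"
  have C: "0 < C" using c by (simp add: C_def)
  have main: "ennreal (norm (h z) powr P * R\<^sup>2) \<le> ennreal C * (\<integral>\<^sup>+ v. ennreal (norm (h v) powr P) * indicator (ball z R) v \<partial>lborel)"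
    if hol: "h holomorphic_on cball z R" and R: "0 < R" for h z R
  proof (cases "h z = 0")
    case True
    then show ?thesis by simp
  next
    case False
    define u where "u = (\<lambda>v. norm (h v) * (R - dist z v) powr k)"
    have "continuous_on (cball z R) u"
      unfolding u_def using k by (intro continuous_intros holomorphic_on_imp_continuous_on hol continuous_on_powr') auto
    then obtain a where a: "a \<in> cball z R" "\<And>v. v \<in> cball z R \<Longrightarrow> u v \<le> u a"
      using continuous_attains_sup[of "cball z R" u] R by auto
    define d where "d = R - dist z a"
    have "0 < u z" using False R by (simp add: u_def)
    also have "u z \<le> u a" using a R by auto
    finally have ua: "0 < u a" .
    then have ha: "h a \<noteq> 0" and d: "0 < d"
      using a(1) by (auto simp: u_def d_def zero_less_mult_iff less_le)
    have sub: "cball a (d/2) \<subseteq> cball z R"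
    proof
      fix y assume "y \<in> cball a (d/2)"
      then show "y \<in> cball z R"
        using dist_triangle[of z y a] d by (auto simp: d_def)
    qed
    have B: "norm (h v) \<le> 2 powr k * norm (h a)" if v: "v \<in> cball a (d/2)" for v
    proof -
      have "d/2 \<le> R - dist z v"
        using v dist_triangle[of z v a] by (auto simp: d_def field_simps)
      then have "norm (h v) * (d/2) powr k \<le> u v"
        unfolding u_def using d k by (intro mult_left_mono powr_mono2) auto
      also have "\<dots> \<le> u a" using a v sub by auto
      also have "\<dots> = norm (h a) * (2 powr k * (d/2) powr k)"
        using d by (simp add: u_def powr_divide flip: d_def)
      finally show ?thesis using d by (simp add: field_simps)
    qed
    have low: "norm (h a) / 2 \<le> norm (h v)" if v: "v \<in> ball a (c * d)" for v
    proof -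
      have cd: "c * d \<le> d/2/2" using c d by auto
      have "norm (h v - h a) \<le> 2 * (2 powr k * norm (h a)) / (d/2) * norm (v - a)"
      proof (rule holo_lipschitz)
        show "h holomorphic_on cball a (d/2)" using hol sub holomorphic_on_subset by blast
        show "v \<in> cball a (d/2/2)" using v cd by auto
      qed (use d B in auto)
      also have "\<dots> \<le> 2 * (2 powr k * norm (h a)) / (d/2) * (c * d)"
        using v d by (intro mult_left_mono) (auto simp: dist_norm norm_minus_commute)
      also have "\<dots> = norm (h a) / 2"
        using d by (simp add: c_def field_simps)
      finally show ?thesis
        using norm_triangle_ineq2[of "h a" "h v"] by (simp add: norm_minus_commute)
    qed
    have sub2: "ball a (c * d) \<subseteq> ball z R"
    proof
      fix y assume y: "y \<in> ball a (c * d)"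
      have "c * d \<le> d / 2" using c d by auto
      moreover have "dist z a = R - d" by (simp add: d_def)
      ultimately have "dist z y < R"
        using y dist_triangle[of z y a] d unfolding mem_ball by linarith
      then show "y \<in> ball z R" by simp
    qed
    have "norm (h z) powr P * R\<^sup>2 = u z powr P"
      using R P by (simp add: u_def powr_mult powr_powr k_def)
    also have "\<dots> \<le> u a powr P"
      using P \<open>0 < u z\<close> \<open>u z \<le> u a\<close> by (intro powr_mono2) auto
    also have "\<dots> = norm (h a) powr P * d\<^sup>2"
      using d P by (simp add: u_def powr_mult powr_powr k_def d_def)
    also have "\<dots> = C * ((norm (h a) / 2) powr P * (pi * (c * d)\<^sup>2))"
      using c P by (simp add: C_def powr_divide power_mult_distrib)
    finally have "ennreal (norm (h z) powr P * R\<^sup>2) \<le> ennreal (C * ((norm (h a) / 2) powr P * (pi * (c * d)\<^sup>2)))"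
      by (rule ennreal_leI)
    also have "\<dots> = ennreal C * (ennreal ((norm (h a) / 2) powr P) * emeasure lborel (ball a (c * d)))"
      using C c d by (simp add: lborel_ball_complex ennreal_mult')
    also have "\<dots> = ennreal C * (\<integral>\<^sup>+ v. ennreal ((norm (h a) / 2) powr P) * indicator (ball a (c * d)) v \<partial>lborel)"
      by (subst nn_integral_cmult_indicator) auto
    also have "\<dots> \<le> ennreal C * (\<integral>\<^sup>+ v. ennreal (norm (h v) powr P) * indicator (ball z R) v \<partial>lborel)"
      using sub2 low P by (intro mult_left_mono nn_integral_mono)
        (auto simp: indicator_def subset_iff intro!: ennreal_leI powr_mono2)
    finally show ?thesis .
  qed
  show ?thesis using C main by blast
qed

subsection \<open>Local behaviour of the weight\<close>

lemma ln_norm_close: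
  fixes z v :: complex
  assumes "z \<noteq> 0" "norm (v - z) \<le> norm z / 2"
  shows "v \<noteq> 0" "\<bar>lg v - lg z\<bar> < 1"
proof -
  have 1: "norm z / 2 \<le> norm v"
    using norm_triangle_ineq2[of z v] assms by (simp add: norm_minus_commute)
  have 2: "norm v \<le> 3/2 * norm z"
    using norm_triangle_ineq2[of v z] assms by simp
  show nz: "v \<noteq> 0" using 1 assms(1) by auto
  have e2: "2 < exp (1::real)" using exp_lower_Taylor_quadratic[of "1::real"] by simp
  have "norm v < exp 1 * norm z" 
  proof -
    have "0 < norm z" "2 * norm z < exp 1 * norm z" using assms(1) e2 by auto
    then show ?thesis using 2 by linarith
  qed
  then have "lg v < ln (exp 1 * norm z)" using nz assms(1) by (subst ln_less_cancel_iff) auto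
  then have a: "lg v < 1 + lg z" using assms(1) by (simp add: ln_mult)
  have "norm z < exp 1 * norm v" 
  proof -
    have "2 * norm v < exp 1 * norm v" using nz e2 by simp
    then show ?thesis using 1 by linarith
  qed
  then have "lg z < ln (exp 1 * norm v)" using nz assms(1) by (subst ln_less_cancel_iff) auto
  then have "lg z < 1 + lg v" using nz by (simp add: ln_mult)
  with a show "\<bar>lg v - lg z\<bar> < 1" by linarith
qed

text \<open>The logarithm of the weight has unbounded slope \<open>- 2 \<alpha> ln \<bar>z\<bar>\<close>; rounding the slope to an integer
  \<open>m\<close>, the weight is comparable near \<open>z\<close> to the modulus of the zero-free function \<open>v\<^sup>m\<close>.\<close>

lemma wt_local:
  assumes "0 < \<alpha>"
  shows "\<exists>K\<ge>1. \<forall>z. z \<noteq> 0 \<longrightarrow> (\<exists>u. holo u \<and> u z = 1 \<and>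
    (\<forall>v. v \<noteq> 0 \<longrightarrow> u v \<noteq> 0) \<and>
    (\<forall>v. norm (v - z) \<le> norm z / 2 \<longrightarrow>
       wt \<alpha> \<beta> v \<le> K * (wt \<alpha> \<beta> z * norm (u v)) \<and> wt \<alpha> \<beta> z * norm (u v) \<le> K * wt \<alpha> \<beta> v))"
proof -
  define K where "K = exp (1 + \<alpha> + \<bar>\<beta>\<bar>)"
  have "1 \<le> K" using assms by (simp add: K_def)
  moreover have "\<exists>u. holo u \<and> u z = 1 \<and>
    (\<forall>v. v \<noteq> 0 \<longrightarrow> u v \<noteq> 0) \<and>
    (\<forall>v. norm (v - z) \<le> norm z / 2 \<longrightarrow>
       wt \<alpha> \<beta> v \<le> K * (wt \<alpha> \<beta> z * norm (u v)) \<and> wt \<alpha> \<beta> z * norm (u v) \<le> K * wt \<alpha> \<beta> v)"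
    if z: "z \<noteq> 0" for z
  proof -
    define t where "t = lg z"
    define m where "m = round (- 2 * \<alpha> * t)"
    define u where "u = (\<lambda>v. (v / z) powi m)"
    have m: "\<bar>- 2 * \<alpha> * t - of_int m\<bar> \<le> 1"
      using of_int_round_abs_le[of "- 2 * \<alpha> * t"] unfolding m_def by linarith
    have "wt \<alpha> \<beta> v \<le> K * (wt \<alpha> \<beta> z * norm (u v)) \<and> wt \<alpha> \<beta> z * norm (u v) \<le> K * wt \<alpha> \<beta> v"
      if close: "norm (v - z) \<le> norm z / 2" for v
    proof -
      note nz = ln_norm_close(1)[OF z close]
      define d where "d = lg v - t"
      have d: "\<bar>d\<bar> \<le> 1" using ln_norm_close(2)[OF z close] by (simp add: d_def t_def)
      have "norm (u v) = (norm (v / z)) powr of_int m"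
        using z nz by (simp add: u_def norm_power_int powr_real_of_int' norm_divide)
      also have "\<dots> = exp (of_int m * d)"
        using z nz by (simp add: powr_def norm_divide ln_div d_def t_def)
      finally have u: "norm (u v) = exp (of_int m * d)" .
      \<comment> \<open>This is the logarithm of the quotient of the weight at \<open>v\<close> by
        its model. The integer power cancels the slope at \<open>z\<close> up to a rounding error of
        size at most 1; the quadratic term and the \<open>\<beta>\<close> term stay bounded because
        \<open>d\<close> does.\<close>
      define D where "D = (- 2 * \<alpha> * t - of_int m) * d - \<alpha> * d\<^sup>2 + \<beta> * d"
      have "\<bar>(- 2 * \<alpha> * t - of_int m) * d\<bar> \<le> 1 * 1"
        unfolding abs_mult using m d by (intro mult_mono) auto
      moreover have "\<bar>\<alpha> * d\<^sup>2\<bar> \<le> \<alpha> * 1"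
        unfolding abs_mult using assms d abs_square_le_1[of d] by (intro mult_mono) auto
      moreover have "\<bar>\<beta> * d\<bar> \<le> \<bar>\<beta>\<bar> * 1"
        unfolding abs_mult using d by (intro mult_mono) auto
      ultimately have D: "\<bar>D\<bar> \<le> 1 + \<alpha> + \<bar>\<beta>\<bar>" unfolding D_def by linarith
      have l: "lg v = t + d" by (simp add: d_def)
      have w: "wt \<alpha> \<beta> v = exp D * (wt \<alpha> \<beta> z * norm (u v))"
        unfolding u wt_exp[OF z] wt_exp[OF nz] l D_def t_def[symmetric] exp_add[symmetric]
        by (simp add: algebra_simps power2_eq_square)
      have 1: "exp D \<le> K" using D by (simp add: K_def)
      have 2: "1 \<le> K * exp D" using D by (simp add: K_def flip: exp_add)
      have pos: "0 \<le> wt \<alpha> \<beta> z * norm (u v)" by simp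
      show ?thesis
        using mult_right_mono[OF 1 pos] mult_right_mono[OF 2 pos] by (simp add: w mult.assoc)
    qed
    moreover have "holo u"
      unfolding u_def using z by (intro holomorphic_intros) auto
    ultimately show ?thesis using z by (intro exI[of _ u]) (auto simp: u_def)
  qed
  ultimately show ?thesis by blast
qed

lemma ball_norm_comparable:
  fixes z :: complex
  assumes "z \<noteq> 0" "\<rho> \<le> 1/2" "v \<in> ball z (\<rho> * norm z)"
  shows "norm (v - z) \<le> norm z / 2" "1 / (norm z)\<^sup>2 \<le> 4 * (1 / (norm v)\<^sup>2)" "1 / (norm v)\<^sup>2 \<le> 4 * (1 / (norm z)\<^sup>2)"
proof -
  have "\<rho> * norm z \<le> norm z / 2"
    using mult_right_mono[OF assms(2), of "norm z"] by simp
  then show 0: "norm (v - z) \<le> norm z / 2" using assms(3) by (auto simp: dist_norm norm_minus_commute)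
  have 1: "norm z \<le> 2 * norm v"
    using norm_triangle_ineq2[of z v] 0 by (simp add: norm_minus_commute)
  have 2: "norm v \<le> 2 * norm z"
    using norm_triangle_ineq2[of v z] 0 norm_ge_zero[of z] by linarith
  have nz: "v \<noteq> 0" using 1 assms(1) by auto
  have "(norm z)\<^sup>2 \<le> (2 * norm v)\<^sup>2" "(norm v)\<^sup>2 \<le> (2 * norm z)\<^sup>2"
    by (rule power_mono[OF 1 norm_ge_zero], rule power_mono[OF 2 norm_ge_zero])
  then show "1 / (norm z)\<^sup>2 \<le> 4 * (1 / (norm v)\<^sup>2)" "1 / (norm v)\<^sup>2 \<le> 4 * (1 / (norm z)\<^sup>2)"
    using nz assms(1) by (auto simp: field_simps power2_eq_square)
qed

abbreviation "Wint \<alpha> \<beta> P f B \<equiv>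
  \<integral>\<^sup>+ v. ennreal ((norm (f v :: complex) * wt \<alpha> \<beta> v) powr P) * indicator B v \<partial>haar"

text \<open>Multiplying \<open>f\<close> by the zero-free function of \<open>wt_local\<close> makes
  the weight the modulus of a holomorphic factor, so the unweighted estimate applies to the product.
  The squared radius is comparable with the squared modulus of \<open>z\<close> and turns Lebesgue
  measure into Haar measure. The relative radius is left free because the nodes will need disjoint
  balls.\<close>

lemma weighted_pointwise:
  fixes P \<rho> :: real
  assumes "0 < \<alpha>" and P: "0 < P" and \<rho>: "0 < \<rho>" "\<rho> \<le> 1/4"
  shows "\<exists>C>0. \<forall>f z. holo f \<longrightarrow> z \<noteq> 0 \<longrightarrow>
    ennreal ((norm (f z) * wt \<alpha> \<beta> z) powr P) \<le>
      ennreal C * Wint \<alpha> \<beta> P f (ball z (\<rho> * norm z))"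
proof -
  obtain C where C: "0 < C" and pw: "\<And>h z R. h holomorphic_on cball z R \<Longrightarrow> 0 < R \<Longrightarrow>
    ennreal (norm (h z) powr P * R\<^sup>2) \<le> ennreal C * (\<integral>\<^sup>+ v. ennreal (norm (h v) powr P) * indicator (ball z R) v \<partial>lborel)"
    using holo_pointwise[OF P] by blast
  obtain K where K: "1 \<le> K" and loc: "\<And>z. z \<noteq> 0 \<Longrightarrow> \<exists>u. holo u \<and> u z = 1 \<and>
    (\<forall>v. v \<noteq> 0 \<longrightarrow> u v \<noteq> 0) \<and>
    (\<forall>v. norm (v - z) \<le> norm z / 2 \<longrightarrow>
       wt \<alpha> \<beta> v \<le> K * (wt \<alpha> \<beta> z * norm (u v)) \<and> wt \<alpha> \<beta> z * norm (u v) \<le> K * wt \<alpha> \<beta> v)"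
    using wt_local[OF assms(1), of \<beta>] by blast
  define D where "D = C * K powr P * 4 / \<rho>\<^sup>2"
  have D: "0 < D" using C K \<rho> by (simp add: D_def)
  have main: "ennreal ((norm (f z) * wt \<alpha> \<beta> z) powr P) \<le>
      ennreal D * Wint \<alpha> \<beta> P f (ball z (\<rho> * norm z))"
    if f: "holo f" and z: "z \<noteq> 0" for f z
  proof -
    obtain u where u: "holo u" "u z = 1"
      and uw: "\<And>v. norm (v - z) \<le> norm z / 2 \<Longrightarrow> wt \<alpha> \<beta> z * norm (u v) \<le> K * wt \<alpha> \<beta> v"
      using loc[OF z] by blast
    define R where "R = \<rho> * norm z"
    have R: "0 < R" using \<rho> z by (simp add: R_def)
    \<comment> \<open>Freezes the weight at \<open>z\<close> and absorbs the area factor; since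
      \<open>u z = 1\<close>, multiplying the unweighted left-hand side by \<open>W\<close> gives
      exactly the weighted one.\<close>
    define W where "W = wt \<alpha> \<beta> z powr P / R\<^sup>2"
    have W: "0 \<le> W" by (simp add: W_def)
    define h where "h = (\<lambda>v. f v * u v)"
    have sub: "cball z R \<subseteq> punctured_plane"
    proof
      fix y assume y: "y \<in> cball z R"
      have "\<rho> * norm z < norm z" using \<rho> z by simp
      with y show "y \<in> punctured_plane" by (auto simp: R_def)
    qed
    have hol: "h holomorphic_on cball z R"
      unfolding h_def using f u(1) sub holomorphic_on_subset by (intro holomorphic_intros) blast+
    define g where "g = (\<lambda>v. norm (f v) * wt \<alpha> \<beta> v)"
    have [measurable]: "g \<in> borel_measurable borel"
      unfolding g_def by (rule holo_wt_measurable[OF f])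
    have [measurable]: "ball z R \<in> sets borel" by simp
    have G: "norm (f v) * wt \<alpha> \<beta> v = g v" for v by (simp add: g_def)
    have meas: "(\<lambda>v. ennreal (norm (h v) powr P) * indicator (ball z R) v) \<in> borel_measurable lborel"
    proof -
      have "continuous_on (ball z R) (\<lambda>v. norm (h v))"
        using hol ball_subset_cball holomorphic_on_imp_continuous_on holomorphic_on_subset
        by (intro continuous_intros) blast
      then have [measurable]: "(\<lambda>v. if v \<in> ball z R then norm (h v) else 0) \<in> borel_measurable borel"
        by (intro borel_measurable_continuous_on_if) auto
      have "(\<lambda>v. ennreal ((if v \<in> ball z R then norm (h v) else 0) powr P)) \<in> borel_measurable lborel"
        by measurable
      also have "(\<lambda>v. ennreal ((if v \<in> ball z R then norm (h v) else 0) powr P)) =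
          (\<lambda>v. ennreal (norm (h v) powr P) * indicator (ball z R) v)"
        by (auto simp: indicator_def)
      finally show ?thesis .
    qed
    have pt: "W * norm (h v) powr P \<le> K powr P * 4 / \<rho>\<^sup>2 * (1 / (norm v)\<^sup>2 * (norm (f v) * wt \<alpha> \<beta> v) powr P)"
      if v: "v \<in> ball z R" for v
    proof -
      note * = ball_norm_comparable[OF z _ v[unfolded R_def]]
      have "wt \<alpha> \<beta> z * norm (h v) \<le> K * (norm (f v) * wt \<alpha> \<beta> v)"
        using mult_left_mono[OF uw[OF *(1)], of "norm (f v)"] \<rho> by (simp add: h_def norm_mult algebra_simps)
      then have "(wt \<alpha> \<beta> z * norm (h v)) powr P \<le> (K * (norm (f v) * wt \<alpha> \<beta> v)) powr P"
        using P by (intro powr_mono2) auto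
      then have 1: "wt \<alpha> \<beta> z powr P * norm (h v) powr P \<le> K powr P * (norm (f v) * wt \<alpha> \<beta> v) powr P"
        using K by (simp add: powr_mult)
      have "W * norm (h v) powr P = (1 / \<rho>\<^sup>2) * (1 / (norm z)\<^sup>2) * (wt \<alpha> \<beta> z powr P * norm (h v) powr P)"
        by (simp add: W_def R_def power_mult_distrib)
      also have "\<dots> \<le> (1 / \<rho>\<^sup>2) * (4 * (1 / (norm v)\<^sup>2)) * (K powr P * (norm (f v) * wt \<alpha> \<beta> v) powr P)"
        using * \<rho> 1 by (intro mult_mono[OF mult_mono]) auto
      finally show ?thesis by (simp add: field_simps)
    qed
    have "(norm (f z) * wt \<alpha> \<beta> z) powr P = W * (norm (h z) powr P * R\<^sup>2)"
      using R u(2) by (simp add: W_def h_def powr_mult)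
    then have "ennreal ((norm (f z) * wt \<alpha> \<beta> z) powr P) = ennreal W * ennreal (norm (h z) powr P * R\<^sup>2)"
      using W by (simp add: ennreal_mult')
    also have "\<dots> \<le> ennreal W * (ennreal C * (\<integral>\<^sup>+ v. ennreal (norm (h v) powr P) * indicator (ball z R) v \<partial>lborel))"
      using pw[OF hol R] by (intro mult_left_mono) auto
    also have "\<dots> = ennreal C * (\<integral>\<^sup>+ v. ennreal W * (ennreal (norm (h v) powr P) * indicator (ball z R) v) \<partial>lborel)"
      using meas by (subst nn_integral_cmult) (auto simp: mult_ac)
    also have "\<dots> \<le> ennreal C * (\<integral>\<^sup>+ v. ennreal (K powr P * 4 / \<rho>\<^sup>2) * (ennreal (1 / (norm v)\<^sup>2) *
        (ennreal ((norm (f v) * wt \<alpha> \<beta> v) powr P) * indicator (ball z R) v)) \<partial>lborel)"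
      using pt W by (intro mult_left_mono nn_integral_mono)
        (auto simp: indicator_def simp flip: ennreal_mult' ennreal_mult'' intro!: ennreal_leI)
    also have "\<dots> = ennreal C * (ennreal (K powr P * 4 / \<rho>\<^sup>2) * (\<integral>\<^sup>+ v. ennreal (1 / (norm v)\<^sup>2) *
        (ennreal ((norm (f v) * wt \<alpha> \<beta> v) powr P) * indicator (ball z R) v) \<partial>lborel))"
      unfolding G by (rule arg_cong[where f = "(*) (ennreal C)"], rule nn_integral_cmult) measurable
    also have "\<dots> = ennreal C * (ennreal (K powr P * 4 / \<rho>\<^sup>2) *
        Wint \<alpha> \<beta> P f (ball z R))"
      unfolding G by (subst nn_integral_haar) auto
    also have "\<dots> = ennreal D * Wint \<alpha> \<beta> P f (ball z R)"
      using C by (simp add: D_def ennreal_mult' mult.assoc[symmetric] flip: times_divide_eq_right)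
    finally show ?thesis by (simp add: R_def)
  qed
  show ?thesis using D main by blast
qed

text \<open>Every exponent embeds into the sup case. Zeros are divided out under sup bounds, so this
  is the entrance to all division arguments.\<close>

lemma Cbound_pointwise:
  assumes "0 < \<alpha>" "0 < p"
  shows "\<exists>C>0. \<forall>f K. holo f \<longrightarrow> 0 \<le> K \<longrightarrow>
    Fbound \<alpha> \<beta> p f K \<longrightarrow> (\<forall>z. z \<noteq> 0 \<longrightarrow> norm (f z) * wt \<alpha> \<beta> z \<le> C * K)"
proof (cases "p = \<infinity>")
  case True
  then show ?thesis by (intro exI[of _ 1]) (auto simp: Lbound_def)
next
  case False
  define P where "P = enn2real p"
  have P: "0 < P" using enn2real_pos[OF \<open>0 < p\<close> False] by (simp add: P_def)
  obtain C where C: "0 < C" and pw: "\<And>f z. holo f \<Longrightarrow> z \<noteq> 0 \<Longrightarrow>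
    ennreal ((norm (f z) * wt \<alpha> \<beta> z) powr P) \<le>
      ennreal C * Wint \<alpha> \<beta> P f (ball z (1/4 * norm z))"
    using weighted_pointwise[OF assms(1) P, of "1/4" \<beta>] by auto
  have "norm (f z) * wt \<alpha> \<beta> z \<le> C powr (1/P) * K"
    if f: "holo f" and "0 \<le> K" "Fbound \<alpha> \<beta> p f K" "z \<noteq> 0" for f K z
  proof -
    have "ennreal ((norm (f z) * wt \<alpha> \<beta> z) powr P) \<le>
      ennreal C * Wint \<alpha> \<beta> P f (ball z (1/4 * norm z))"
      by (rule pw[OF f \<open>z \<noteq> 0\<close>])
    also have "\<dots> \<le> ennreal C * (\<integral>\<^sup>+ v. ennreal ((norm (f v) * wt \<alpha> \<beta> v) powr P) \<partial>haar)"
      by (intro mult_left_mono nn_integral_mono) (auto simp: indicator_def)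
    also have "\<dots> \<le> ennreal C * ennreal (K powr P)"
      using that False by (intro mult_left_mono) (auto simp: Lbound_def P_def)
    also have "\<dots> = ennreal ((C powr (1/P) * K) powr P)"
      using C P \<open>0 \<le> K\<close> by (simp add: powr_mult powr_powr ennreal_mult')
    finally have "(norm (f z) * wt \<alpha> \<beta> z) powr P \<le> (C powr (1/P) * K) powr P"
      by simp
    then show ?thesis using P \<open>0 \<le> K\<close>
      by (meson mult_nonneg_nonneg not_less powr_ge_zero powr_less_mono2)
  qed
  then show ?thesis using C by (intro exI[of _ "C powr (1/P)"]) auto
qed

subsection \<open>Exponential kernels and separated sets\<close>

text \<open>By dilation invariance the measure cannot depend on \<open>a\<close>. The constant comes
  from enclosing the annulus in the disc of radius \<open>exp (a + 2)\<close>, of area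
  \<open>pi * exp (2 * a + 4)\<close>, and bounding the density by
  \<open>exp (- 2 * a)\<close>.\<close>

lemma haar_annulus:
  "emeasure haar {z. z \<noteq> 0 \<and> a \<le> lg z \<and> lg z \<le> a + 1} \<le> ennreal (pi * exp 4)"
proof -
  let ?A = "{z::complex. z \<noteq> 0 \<and> a \<le> lg z \<and> lg z \<le> a + 1}"
  have [measurable]: "?A \<in> sets borel" by measurable
  have "emeasure haar ?A = (\<integral>\<^sup>+ z. ennreal (1 / (norm z)\<^sup>2) * indicator ?A z \<partial>lborel)"
    unfolding haar_def by (subst emeasure_density) auto
  also have "\<dots> \<le> (\<integral>\<^sup>+ z. ennreal (exp (- 2 * a)) * indicator (ball (0::complex) (exp (a + 2))) z \<partial>lborel)"
  proof (rule nn_integral_mono)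
    fix z :: complex
    show "ennreal (1 / (norm z)\<^sup>2) * indicator ?A z \<le> ennreal (exp (- 2 * a)) * indicator (ball 0 (exp (a + 2))) z"
    proof (cases "z \<in> ?A")
      case True
      then have z: "z \<noteq> 0" "a \<le> lg z" "lg z \<le> a + 1" by auto
      have e: "norm z = exp (lg z)" using z(1) by simp
      have 1: "exp a \<le> norm z" using z by (subst e) (simp del: exp_ln)
      have 2: "norm z < exp (a + 2)" using z by (subst e) (simp del: exp_ln)
      have "(exp a)\<^sup>2 \<le> (norm z)\<^sup>2" using 1 by (intro power_mono) auto
      then have "1 / (norm z)\<^sup>2 \<le> 1 / (exp a)\<^sup>2" using z by (intro divide_left_mono) auto
      also have "\<dots> = exp (- 2 * a)" by (simp add: exp_minus field_simps flip: exp_double)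
      finally show ?thesis using 2 True by (simp add: ennreal_leI)
    qed simp
  qed
  also have "\<dots> = ennreal (exp (- 2 * a)) * ennreal (pi * (exp (a + 2))\<^sup>2)"
    by (subst nn_integral_cmult_indicator) (auto simp: lborel_ball_complex)
  also have "\<dots> = ennreal (pi * exp 4)"
    by (simp flip: ennreal_mult' exp_double) (simp add: algebra_simps flip: exp_add)
  finally show ?thesis .
qed

text \<open>In polar coordinates Haar measure is Lebesgue measure in \<open>lg z\<close> times the
  angle, which explains uniformity in \<open>s\<close>. It is enough to cover the plane by unit
  annuli at integer distance on both sides of \<open>s\<close> and to sum a geometric
  series.\<close>

lemma haar_exp_integral:
  fixes c :: real
  assumes c: "0 < c"
  shows "\<exists>C>0. \<forall>s. (\<integral>\<^sup>+ z. ennreal (exp (- c * \<bar>lg z - s\<bar>)) \<partial>haar) \<le> ennreal C"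
proof -
  define C where "C = (\<Sum>k. exp (- c) ^ k) * (2 * pi * exp 4)"
  have sm: "summable (\<lambda>k. exp (- c) ^ k)" using c by (intro summable_geometric) auto
  have "0 < (\<Sum>k. exp (- c) ^ k)" using c by (subst suminf_geometric) auto
  then have C: "0 < C" by (simp add: C_def)
  have "(\<integral>\<^sup>+ z. ennreal (exp (- c * \<bar>lg z - s\<bar>)) \<partial>haar) \<le> ennreal C" for s
  proof -
    define B where "B = (\<lambda>(k::nat) a. {z::complex. z \<noteq> 0 \<and> a \<le> lg z \<and> lg z \<le> a + 1})"
    have [measurable]: "B k a \<in> sets borel" for k a unfolding B_def by measurable
    define F where "F = (\<lambda>k z. ennreal (exp (- c) ^ k) * (indicator (B k (s + k)) z + indicator (B k (s - k - 1)) z))"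
    have "(\<integral>\<^sup>+ z. ennreal (exp (- c * \<bar>lg z - s\<bar>)) \<partial>haar) \<le> (\<integral>\<^sup>+ z. (\<Sum>k. F k z) \<partial>haar)"
    proof (rule nn_integral_mono_AE, rule AE_mp[OF AE_haar], rule AE_I2, rule impI)
      fix z :: complex assume z: "z \<in> punctured_plane"
      define d where "d = \<bar>lg z - s\<bar>"
      define k where "k = nat \<lfloor>d\<rfloor>"
      have k: "real k \<le> d" "d \<le> real k + 1" unfolding k_def d_def by linarith+
      have "exp (- c * d) \<le> exp (- c * k)" using c k by simp
      also have "\<dots> = exp (- c) ^ k" by (simp add: exp_of_nat_mult[symmetric] mult.commute)
      finally have "ennreal (exp (- c * d)) \<le> ennreal (exp (- c) ^ k) * 1" by (simp add: ennreal_leI)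
      also have "\<dots> \<le> F k z"
      proof -
        have "z \<in> B k (s + k) \<or> z \<in> B k (s - k - 1)"
          using z k unfolding B_def d_def by auto
        then show ?thesis unfolding F_def by (intro mult_left_mono) (auto simp: indicator_def)
      qed
      also have "\<dots> \<le> (\<Sum>k. F k z)"
        using sum_le_suminf[of "\<lambda>k. F k z" "{k}"] by simp
      finally show "ennreal (exp (- c * \<bar>lg z - s\<bar>)) \<le> (\<Sum>k. F k z)" by (simp add: d_def)
    qed
    also have "\<dots> = (\<Sum>k. \<integral>\<^sup>+ z. F k z \<partial>haar)"
      unfolding F_def by (intro nn_integral_suminf; measurable)
    also have "\<dots> \<le> (\<Sum>k. ennreal (exp (- c) ^ k * (2 * pi * exp 4)))"
    proof (rule suminf_le)
      fix k
      have "(\<integral>\<^sup>+ z. F k z \<partial>haar) = ennreal (exp (- c) ^ k) * (emeasure haar (B k (s + k)) + emeasure haar (B k (s - k - 1)))"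
        unfolding F_def by (simp add: nn_integral_cmult nn_integral_add)
      also have "\<dots> \<le> ennreal (exp (- c) ^ k) * (ennreal (pi * exp 4) + ennreal (pi * exp 4))"
        unfolding B_def by (intro mult_left_mono add_mono haar_annulus) auto
      also have "\<dots> = ennreal (exp (- c) ^ k * (2 * pi * exp 4))"
        by (simp add: mult.assoc flip: ennreal_plus ennreal_mult')
      finally show "(\<integral>\<^sup>+ z. F k z \<partial>haar) \<le> ennreal (exp (- c) ^ k * (2 * pi * exp 4))" .
    qed auto
    also have "\<dots> = ennreal C"
      unfolding C_def using sm by (subst suminf_ennreal2) (auto simp: suminf_mult2 intro: summable_mult2)
    finally show ?thesis .
  qed
  then show ?thesis using C by blast
qed

lemma Cbound_exp:
  assumes "0 < c" "0 < p"
  shows "\<exists>C>0. \<forall>s. Cbound p (\<lambda>z. exp (- c * \<bar>lg z - s\<bar>)) C"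
proof (cases "p = \<infinity>")
  case True
  then show ?thesis using assms by (intro exI[of _ 1]) (auto simp: Lbound_def)
next
  case False
  define P where "P = enn2real p"
  have P: "0 < P" using enn2real_pos[OF \<open>0 < p\<close> False] by (simp add: P_def)
  obtain C where C: "0 < C" "\<And>s. (\<integral>\<^sup>+ z. ennreal (exp (- (c * P) * \<bar>lg z - s\<bar>)) \<partial>haar) \<le> ennreal C"
    using haar_exp_integral[of "c * P"] assms P by auto
  have "Cbound p (\<lambda>z. exp (- c * \<bar>lg z - s\<bar>)) (C powr (1/P))" for s
    using C(2)[of s] C(1) False P by (simp add: Lbound_def powr_powr mult_ac flip: P_def exp_powr_real)
      (simp add: powr_def mult_ac)
  then show ?thesis using C(1) by (intro exI[of _ "C powr (1/P)"]) auto
qed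

section \<open>Logarithmically separated sets\<close>

definition log_separated :: "real \<Rightarrow> complex set \<Rightarrow> bool" where
  "log_separated r \<Lambda> \<longleftrightarrow> (\<forall>l\<in>\<Lambda>. \<forall>\<mu>\<in>\<Lambda>. l \<noteq> \<mu> \<longrightarrow> r * norm l \<le> norm (l - \<mu>))"

locale separated =
  fixes r :: real and \<Lambda> :: "complex set"
  assumes r: "0 < r" "r \<le> 1" and sep: "log_separated r \<Lambda>" and sub: "\<Lambda> \<subseteq> punctured_plane"
begin

text \<open>Adding the separation inequality for the pair and for the swapped pair gives
  \<open>dist l \<mu> \<ge> r/2 * (norm l + norm \<mu>)\<close>, twice what a common point of the
  two balls allows.\<close>

lemma balls_disjoint:
  assumes "l \<in> \<Lambda>" "\<mu> \<in> \<Lambda>" "z \<in> ball l (r/4 * norm l)" "z \<in> ball \<mu> (r/4 * norm \<mu>)"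
  shows "l = \<mu>"
proof (rule ccontr)
  assume "l \<noteq> \<mu>"
  then have "r * norm l \<le> norm (l - \<mu>)" "r * norm \<mu> \<le> norm (\<mu> - l)"
    using sep assms by (auto simp: log_separated_def)
  moreover have "dist l \<mu> < r/4 * norm l + r/4 * norm \<mu>"
    using dist_triangle[of l \<mu> z] assms(3,4) by (simp add: dist_commute)
  moreover have "0 \<le> r * norm l" "0 \<le> r * norm \<mu>" using r by auto
  ultimately show False by (simp add: dist_norm norm_minus_commute)
qed

text \<open>Countability permits the exchange of summation over nodes with integration in
  \<open>packing\<close>, and later the enumeration of the nodes.\<close>

lemma countable: "countable \<Lambda>"
proof -
  have "inj_on (\<lambda>l. ball l (r/4 * norm l)) \<Lambda>"
  proof (rule inj_onI)
    fix l \<mu> assume *: "l \<in> \<Lambda>" "\<mu> \<in> \<Lambda>" "ball l (r/4 * norm l) = ball \<mu> (r/4 * norm \<mu>)"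
    moreover have "l \<in> ball l (r/4 * norm l)" using r sub *(1) by (auto intro!: mult_pos_pos)
    ultimately show "l = \<mu>" using balls_disjoint by metis
  qed
  moreover have "countable ((\<lambda>l. ball l (r/4 * norm l)) ` \<Lambda>)"
  proof (rule countable_disjoint_open_subsets)
    show "pairwise disjnt ((\<lambda>l. ball l (r/4 * norm l)) ` \<Lambda>)"
      unfolding pairwise_image pairwise_def disjnt_iff using balls_disjoint by blast
  qed auto
  ultimately show ?thesis using countable_image_inj_eq by blast
qed

lemma packing:
  assumes [measurable]: "F \<in> borel_measurable borel"
  shows "(\<integral>\<^sup>+ l. (\<integral>\<^sup>+ z. F z * indicator (ball l (r/4 * norm l)) z \<partial>haar) \<partial>count_space \<Lambda>) \<le> (\<integral>\<^sup>+ z. F z \<partial>haar)"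
proof -
  have [measurable]: "ball a s \<in> sets borel" for a :: complex and s by simp
  have "(\<integral>\<^sup>+ l. (\<integral>\<^sup>+ z. F z * indicator (ball l (r/4 * norm l)) z \<partial>haar) \<partial>count_space \<Lambda>) =
     (\<integral>\<^sup>+ z. (\<integral>\<^sup>+ l. F z * indicator (ball l (r/4 * norm l)) z \<partial>count_space \<Lambda>) \<partial>haar)"
    by (rule nn_integral_count_space_nn_integral[OF countable, symmetric]) measurable
  also have "\<dots> \<le> (\<integral>\<^sup>+ z. F z \<partial>haar)"
  proof (rule nn_integral_mono)
    fix z
    show "(\<integral>\<^sup>+ l. F z * indicator (ball l (r/4 * norm l)) z \<partial>count_space \<Lambda>) \<le> F z"
    proof (cases "\<exists>\<mu>\<in>\<Lambda>. z \<in> ball \<mu> (r/4 * norm \<mu>)")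
      case True
      then obtain \<mu> where \<mu>: "\<mu> \<in> \<Lambda>" "z \<in> ball \<mu> (r/4 * norm \<mu>)" by blast
      have "(\<integral>\<^sup>+ l. F z * indicator (ball l (r/4 * norm l)) z \<partial>count_space \<Lambda>) =
         (\<integral>\<^sup>+ l. F z * indicator {\<mu>} l \<partial>count_space \<Lambda>)"
        using \<mu> balls_disjoint by (intro nn_integral_cong) (auto simp: indicator_def)
      also have "\<dots> \<le> F z"
        using \<mu> by (subst nn_integral_cmult_indicator) auto
      finally show ?thesis .
    next
      case False
      then have "(\<integral>\<^sup>+ l. F z * indicator (ball l (r/4 * norm l)) z \<partial>count_space \<Lambda>) = (\<integral>\<^sup>+ l. 0 \<partial>count_space \<Lambda>)"
        by (intro nn_integral_cong) (auto simp: indicator_def)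
      then show ?thesis by simp
    qed
  qed
  finally show ?thesis .
qed

text \<open>Each sample is dominated by a local integral over its own ball, and the balls are
  disjoint. Since only separation enters, this settles one of the three requirements on the new
  exponent.\<close>

lemma restriction_bounded:
  assumes "0 < \<alpha>" "0 < p"
  shows "\<exists>C>0. \<forall>f K. holo f \<longrightarrow> 0 \<le> K \<longrightarrow>
    Fbound \<alpha> \<beta> p f K \<longrightarrow> Sbound \<alpha> \<beta> \<Lambda> p f (C * K)"
proof (cases "p = \<infinity>")
  case True
  then show ?thesis using sub by (intro exI[of _ 1]) (auto simp: Lbound_def)
next
  case False
  define P where "P = enn2real p"
  have P: "0 < P" using enn2real_pos[OF \<open>0 < p\<close> False] by (simp add: P_def)
  obtain C where C: "0 < C" and pw: "\<And>f z. holo f \<Longrightarrow> z \<noteq> 0 \<Longrightarrow>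
    ennreal ((norm (f z) * wt \<alpha> \<beta> z) powr P) \<le>
      ennreal C * Wint \<alpha> \<beta> P f (ball z (r/4 * norm z))"
    using weighted_pointwise[OF assms(1) P, of "r/4" \<beta>] r by auto
  have "Sbound \<alpha> \<beta> \<Lambda> p f (C powr (1/P) * K)"
    if f: "holo f" and K: "0 \<le> K" "Fbound \<alpha> \<beta> p f K" for f K
  proof -
    have [measurable]: "(\<lambda>z. norm (f z) * wt \<alpha> \<beta> z) \<in> borel_measurable borel"
      by (rule holo_wt_measurable[OF f])
    have "(\<integral>\<^sup>+ l. ennreal ((norm (f l) * wt \<alpha> \<beta> l) powr P) \<partial>count_space \<Lambda>) \<le>
      (\<integral>\<^sup>+ l. ennreal C * Wint \<alpha> \<beta> P f (ball l (r/4 * norm l)) \<partial>count_space \<Lambda>)"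
      using sub by (intro nn_integral_mono pw[OF f]) auto
    also have "\<dots> = ennreal C * (\<integral>\<^sup>+ l. Wint \<alpha> \<beta> P f (ball l (r/4 * norm l)) \<partial>count_space \<Lambda>)"
      by (rule nn_integral_cmult) simp
    also have "\<dots> \<le> ennreal C * (\<integral>\<^sup>+ v. ennreal ((norm (f v) * wt \<alpha> \<beta> v) powr P) \<partial>haar)"
      by (intro mult_left_mono packing) auto
    also have "\<dots> \<le> ennreal C * ennreal (K powr P)"
      using K(2) False by (intro mult_left_mono) (auto simp: Lbound_def P_def)
    also have "\<dots> = ennreal ((C powr (1/P) * K) powr P)"
      using C P K by (simp add: powr_mult powr_powr ennreal_mult')
    finally show ?thesis using False by (simp add: Lbound_def P_def)
  qed
  then show ?thesis using C by (intro exI[of _ "C powr (1/P)"]) auto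
qed

text \<open>On the ball around a node the exponential changes by a factor of at most
  \<open>exp c\<close>, and the Haar measure of that ball is bounded below. So the sum is at most a
  multiple of the integral.\<close>

lemma exp_sum:
  fixes c :: real
  assumes c: "0 < c"
  shows "\<exists>C>0. \<forall>s. (\<integral>\<^sup>+ l. ennreal (exp (- c * \<bar>lg l - s\<bar>)) \<partial>count_space \<Lambda>) \<le> ennreal C"
proof -
  obtain C where C: "0 < C" "\<And>s. (\<integral>\<^sup>+ z. ennreal (exp (- c * \<bar>lg z - s\<bar>)) \<partial>haar) \<le> ennreal C"
    using haar_exp_integral[OF c] by blast
  have [measurable]: "ball a s \<in> sets borel" for a :: complex and s by simp
  define \<rho> where "\<rho> = r/4"
  have \<rho>: "0 < \<rho>" "\<rho> \<le> 1/2" using r by (auto simp: \<rho>_def)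
  \<comment> \<open>\<open>exp c\<close> pays for moving from the node to a point of its ball, 4 for
    comparing the densities there, and \<open>pi * \<rho>\<^sup>2\<close> is the area of the ball
    relative to the squared modulus of the node.\<close>
  define D where "D = exp c * 4 / (pi * \<rho>\<^sup>2)"
  have D: "0 < D" using \<rho> by (simp add: D_def)
  have pt: "ennreal (exp (- c * \<bar>lg l - s\<bar>)) \<le>
     ennreal D * (\<integral>\<^sup>+ z. ennreal (exp (- c * \<bar>lg z - s\<bar>)) * indicator (ball l (r/4 * norm l)) z \<partial>haar)"
    if "l \<in> \<Lambda>" for s l
  proof -
    have nz: "l \<noteq> 0" using that sub by auto
    define E where "E = exp (- c * \<bar>lg l - s\<bar>)"
    have 1: "1 / (4 * (norm l)\<^sup>2) * (exp (- c) * E) \<le> 1 / (norm z)\<^sup>2 * exp (- c * \<bar>lg z - s\<bar>)"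
      if "z \<in> ball l (\<rho> * norm l)" for z
    proof (rule mult_mono)
      note * = ball_norm_comparable[OF nz \<rho>(2) that]
      show "1 / (4 * (norm l)\<^sup>2) \<le> 1 / (norm z)\<^sup>2" using *(2) by simp
      have "\<bar>lg z - s\<bar> \<le> 1 + \<bar>lg l - s\<bar>"
        using ln_norm_close(2)[OF nz *(1)] by linarith
      then have "c * \<bar>lg z - s\<bar> \<le> c * (1 + \<bar>lg l - s\<bar>)" using c by (intro mult_left_mono) auto
      then show "exp (- c) * E \<le> exp (- c * \<bar>lg z - s\<bar>)"
        by (simp add: E_def algebra_simps flip: exp_add)
    qed (auto simp: E_def)
    have "ennreal E = ennreal (D * (1 / (4 * (norm l)\<^sup>2) * (exp (- c) * E) * (pi * (\<rho> * norm l)\<^sup>2)))"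
      using nz \<rho> by (simp add: D_def exp_minus power_mult_distrib field_simps)
    also have "\<dots> = ennreal D * (ennreal (1 / (4 * (norm l)\<^sup>2) * (exp (- c) * E)) * emeasure lborel (ball l (\<rho> * norm l)))"
      using D \<rho> by (subst lborel_ball_complex) (auto simp: E_def simp flip: ennreal_mult')
    also have "\<dots> = ennreal D * (\<integral>\<^sup>+ z. ennreal (1 / (4 * (norm l)\<^sup>2) * (exp (- c) * E)) * indicator (ball l (\<rho> * norm l)) z \<partial>lborel)"
      by (subst nn_integral_cmult_indicator) auto
    also have "\<dots> \<le> ennreal D * (\<integral>\<^sup>+ z. ennreal (1 / (norm z)\<^sup>2) * (ennreal (exp (- c * \<bar>lg z - s\<bar>)) * indicator (ball l (\<rho> * norm l)) z) \<partial>lborel)"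
      using 1 by (intro mult_left_mono nn_integral_mono)
        (auto simp: indicator_def simp flip: ennreal_mult' intro!: ennreal_leI)
    also have "\<dots> = ennreal D * (\<integral>\<^sup>+ z. ennreal (exp (- c * \<bar>lg z - s\<bar>)) * indicator (ball l (\<rho> * norm l)) z \<partial>haar)"
      by (rule arg_cong[where f = "(*) (ennreal D)"], rule nn_integral_haar[symmetric]) measurable
    finally show ?thesis by (simp add: E_def \<rho>_def)
  qed
  have "(\<integral>\<^sup>+ l. ennreal (exp (- c * \<bar>lg l - s\<bar>)) \<partial>count_space \<Lambda>) \<le> ennreal (D * C)" for s
  proof -
    have "(\<integral>\<^sup>+ l. ennreal (exp (- c * \<bar>lg l - s\<bar>)) \<partial>count_space \<Lambda>) \<le>
      (\<integral>\<^sup>+ l. ennreal D * (\<integral>\<^sup>+ z. ennreal (exp (- c * \<bar>lg z - s\<bar>)) * indicator (ball l (r/4 * norm l)) z \<partial>haar) \<partial>count_space \<Lambda>)"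
      using pt by (intro nn_integral_mono) auto
    also have "\<dots> = ennreal D * (\<integral>\<^sup>+ l. (\<integral>\<^sup>+ z. ennreal (exp (- c * \<bar>lg z - s\<bar>)) * indicator (ball l (r/4 * norm l)) z \<partial>haar) \<partial>count_space \<Lambda>)"
      by (rule nn_integral_cmult) simp
    also have "\<dots> \<le> ennreal D * ennreal C"
      by (intro mult_left_mono order_trans[OF packing C(2)]) auto
    finally show ?thesis using D C by (simp add: ennreal_mult')
  qed
  then show ?thesis using C(1) D by (intro exI[of _ "D * C"]) auto
qed

lemma Dbound_exp:
  assumes "0 < c" "0 < p"
  shows "\<exists>C>0. \<forall>s. Dbound \<Lambda> p (\<lambda>z. exp (- c * \<bar>lg z - s\<bar>)) C"
proof (cases "p = \<infinity>")
  case True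
  then show ?thesis using assms by (intro exI[of _ 1]) (auto simp: Lbound_def)
next
  case False
  define P where "P = enn2real p"
  have P: "0 < P" using enn2real_pos[OF \<open>0 < p\<close> False] by (simp add: P_def)
  obtain C where C: "0 < C" "\<And>s. (\<integral>\<^sup>+ z. ennreal (exp (- (c * P) * \<bar>lg z - s\<bar>)) \<partial>count_space \<Lambda>) \<le> ennreal C"
    using exp_sum[of "c * P"] assms P by auto
  have "Dbound \<Lambda> p (\<lambda>z. exp (- c * \<bar>lg z - s\<bar>)) (C powr (1/P))" for s
    using C(2)[of s] C(1) False P by (simp add: Lbound_def powr_powr flip: P_def)
      (simp add: powr_def mult_ac)
  then show ?thesis using C(1) by (intro exI[of _ "C powr (1/P)"]) auto
qed

end

subsection \<open>Exponential decay from jump conditions\<close>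

lemma iterate_decay:
  fixes T :: "real \<Rightarrow> real"
  assumes "mono T" "\<And>t. 0 \<le> T t" "0 < L" "0 < \<theta>" "\<theta> < 1" and step: "\<And>t. T (t - L) \<le> \<theta> * T t"
  shows "\<exists>C>0. \<exists>eps>0. \<forall>s t. s \<le> t \<longrightarrow> T s \<le> C * exp (- eps * (t - s)) * T t"
proof -
  define eps where "eps = - ln \<theta> / L"
  have eps: "0 < eps" using assms by (auto simp: eps_def field_simps)
  have it: "T (t - real n * L) \<le> \<theta> ^ n * T t" for n t
  proof (induction n)
    case (Suc n)
    have "T (t - real (Suc n) * L) = T ((t - real n * L) - L)" by (simp add: algebra_simps)
    also have "\<dots> \<le> \<theta> * T (t - real n * L)" by (rule step)
    also have "\<dots> \<le> \<theta> * (\<theta> ^ n * T t)" using Suc assms(4) by (intro mult_left_mono) auto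
    finally show ?case by (simp add: mult.assoc)
  qed simp
  \<comment> \<open>Rounding \<open>(t - s) / L\<close> down to an integer loses at most one factor
    \<open>\<theta>\<close>, which the constant \<open>1 / \<theta>\<close> restores.\<close>
  have "T s \<le> 1 / \<theta> * exp (- eps * (t - s)) * T t" if "s \<le> t" for s t
  proof -
    define n where "n = nat \<lfloor>(t - s) / L\<rfloor>"
    have "0 \<le> (t - s) / L" using that assms(3) by simp
    then have n: "real n \<le> (t - s) / L" "(t - s) / L - 1 \<le> real n" unfolding n_def by linarith+
    have "s \<le> t - real n * L" using n(1) assms(3) by (simp add: field_simps)
    then have "T s \<le> T (t - real n * L)" using assms(1) by (simp add: mono_def)
    also have "\<dots> \<le> \<theta> ^ n * T t" by (rule it)
    also have "\<dots> \<le> (1 / \<theta> * exp (- eps * (t - s))) * T t"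
    proof (rule mult_right_mono)
      have "\<theta> ^ n = exp (ln \<theta> * real n)" using assms(4) by (simp add: exp_of_nat2_mult)
      also have "\<dots> \<le> exp (ln \<theta> * ((t - s) / L - 1))"
        using n(2) assms(4,5) by (auto intro!: mult_left_mono_neg)
      also have "\<dots> = 1 / \<theta> * exp (- eps * (t - s))"
        using assms(3,4) by (simp add: eps_def algebra_simps exp_diff)
      finally show "\<theta> ^ n \<le> 1 / \<theta> * exp (- eps * (t - s))" .
    qed (rule assms)
    finally show ?thesis .
  qed
  then show ?thesis using eps assms(4) by (intro exI[of _ "1/\<theta>"] conjI exI[of _ eps]) auto
qed

text \<open>Hole filling: adding \<open>C * T (s - 1)\<close> to both sides of the jump inequality
  turns it into a contraction with ratio \<open>C / (C + 1)\<close> across an interval of length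
  two, and such intervals occur near every point.\<close>

lemma jump_decay:
  fixes T :: "real \<Rightarrow> real"
  assumes "mono T" "\<And>t. 0 \<le> T t" "0 < L" "0 < C"
    and jump: "\<And>t. \<exists>s. \<bar>s - t\<bar> \<le> L \<and> T (s - 1) \<le> C * (T (s + 1) - T (s - 1))"
  shows "\<exists>C>0. \<exists>eps>0. \<forall>s t. s \<le> t \<longrightarrow> T s \<le> C * exp (- eps * (t - s)) * T t"
proof (rule iterate_decay[OF assms(1,2)])
  fix t
  \<comment> \<open>Aiming at \<open>t - L - 1\<close> keeps the interval from \<open>s - 1\<close>
    to \<open>s + 1\<close> inside the one from \<open>t - (2 * L + 2)\<close> to
    \<open>t\<close>.\<close>
  obtain s where s: "\<bar>s - (t - L - 1)\<bar> \<le> L" "T (s - 1) \<le> C * (T (s + 1) - T (s - 1))"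
    using jump by blast
  have "T (t - (2 * L + 2)) \<le> T (s - 1)" using s(1) by (intro monoD[OF assms(1)]) linarith
  also have "\<dots> \<le> C / (C + 1) * T (s + 1)" using s(2) assms(4) by (simp add: field_simps)
  also have "\<dots> \<le> C / (C + 1) * T t"
    using s(1) assms(4) by (intro mult_left_mono monoD[OF assms(1)]) auto
  finally show "T (t - (2 * L + 2)) \<le> C / (C + 1) * T t" .
qed (use assms in auto)

text \<open>In the application \<open>X\<close> is the weighted modulus of a function vanishing on
  \<open>\<Lambda>\<close>, \<open>x l\<close> the constant making \<open>X z / x l\<close>
  comparable with the kernel at \<open>l\<close>, and \<open>\<tau>\<close> is the logarithmic
  modulus or its negative. The mass of the \<open>P\<close>-th power of \<open>X\<close> beyond
  \<open>l\<close> is controlled by \<open>x l powr P\<close>, hence by the mass in the unit strip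
  around \<open>l\<close>: tail integrals are controlled by their increments. Density of the nodes
  provides such a strip near every level.\<close>

lemma decay_finite:
  fixes X \<tau> x :: "complex \<Rightarrow> real" and P :: real
  assumes P: "0 < P" and C: "0 < C" and L: "0 < L"
    and [measurable]: "X \<in> borel_measurable M" "\<tau> \<in> borel_measurable M"
    and X0: "\<And>z. z \<in> A \<Longrightarrow> 0 \<le> X z"
    and x0: "\<And>l. l \<in> \<Lambda> \<Longrightarrow> 0 < x l"
    and tail: "\<And>l. l \<in> \<Lambda> \<Longrightarrow> (\<integral>\<^sup>+ z. ennreal (X z powr P) * indicator {z. \<tau> l \<le> \<tau> z} z \<partial>M) \<le> ennreal (C * x l powr P)"
    and jump: "\<And>l. l \<in> \<Lambda> \<Longrightarrow> ennreal (x l powr P) \<le> ennreal C * (\<integral>\<^sup>+ z. ennreal (X z powr P) * indicator {z. \<bar>\<tau> z - \<tau> l\<bar> < 1} z \<partial>M)"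
    and loc: "\<And>z. z \<in> A \<Longrightarrow> ennreal (X z powr P) \<le> ennreal C * (\<integral>\<^sup>+ v. ennreal (X v powr P) * indicator {v. \<bar>\<tau> v - \<tau> z\<bar> < 1} v \<partial>M)"
    and dense: "\<And>t. \<exists>l\<in>\<Lambda>. \<bar>\<tau> l - t\<bar> \<le> L"
  shows "\<exists>C>0. \<exists>eps>0. \<forall>l\<in>\<Lambda>. \<forall>z\<in>A. \<tau> l + 1 \<le> \<tau> z \<longrightarrow> X z \<le> C * exp (- eps * (\<tau> z - \<tau> l)) * x l"
proof -
  \<comment> \<open>The reflected argument makes the tail integral increase with \<open>t\<close>,
    as \<open>jump_decay\<close> expects.\<close>
  define I where "I = (\<lambda>t. \<integral>\<^sup>+ z. ennreal (X z powr P) * indicator {z. - t \<le> \<tau> z} z \<partial>M)"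
  have tailI: "I (- \<tau> l) \<le> ennreal (C * x l powr P)" if "l \<in> \<Lambda>" for l
    using tail[OF that] by (simp add: I_def)
  have Imono: "I s \<le> I t" if "s \<le> t" for s t
    unfolding I_def using that by (intro nn_integral_mono) (auto simp: indicator_def)
  have fin: "I t < \<infinity>" for t
  proof -
    obtain l where l: "l \<in> \<Lambda>" "\<bar>\<tau> l - (- t - L)\<bar> \<le> L" using dense by blast
    have "I t \<le> I (- \<tau> l)" using l by (intro Imono) linarith
    also have "\<dots> < \<infinity>" using tailI[OF l(1)] by (simp add: le_less_trans)
    finally show ?thesis .
  qed
  define T where "T = (\<lambda>t. enn2real (I t))"
  have IT: "I t = ennreal (T t)" for t using fin[of t] by (simp add: T_def)
  have T0: "0 \<le> T t" for t by (simp add: T_def)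
  have Tm: "mono T" unfolding mono_def T_def using Imono fin by (auto intro!: enn2real_mono)
  \<comment> \<open>The open strip of half-width 1 about level \<open>t\<close> and the closed tail
    from \<open>t + 1\<close> are disjoint, and both lie in the tail from
    \<open>t - 1\<close>.\<close>
  have diff: "(\<integral>\<^sup>+ v. ennreal (X v powr P) * indicator {v. \<bar>\<tau> v - t\<bar> < 1} v \<partial>M) \<le> ennreal (T (- t + 1) - T (- t - 1))" for t
  proof -
    have "(\<integral>\<^sup>+ v. ennreal (X v powr P) * indicator {v. \<bar>\<tau> v - t\<bar> < 1} v \<partial>M) + I (- t - 1) =
      (\<integral>\<^sup>+ v. ennreal (X v powr P) * indicator {v. \<bar>\<tau> v - t\<bar> < 1} v + ennreal (X v powr P) * indicator {z. - (- t - 1) \<le> \<tau> z} v \<partial>M)"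
      unfolding I_def by (subst nn_integral_add) auto
    also have "\<dots> \<le> I (- t + 1)"
      unfolding I_def by (intro nn_integral_mono) (auto simp: indicator_def)
    finally have *: "(\<integral>\<^sup>+ v. ennreal (X v powr P) * indicator {v. \<bar>\<tau> v - t\<bar> < 1} v \<partial>M) + ennreal (T (- t - 1)) \<le> ennreal (T (- t + 1))"
      by (simp add: IT)
    then show ?thesis
      using T0 by (simp add: ennreal_minus[symmetric] ennreal_le_minus_iff add.commute)
  qed
  have J: "T (- \<tau> l - 1) \<le> C\<^sup>2 * (T (- \<tau> l + 1) - T (- \<tau> l - 1))" if l: "l \<in> \<Lambda>" for l
  proof -
    have d0: "0 \<le> T (- \<tau> l + 1) - T (- \<tau> l - 1)" using Tm by (auto simp: mono_def)
    have "ennreal (T (- \<tau> l - 1)) \<le> I (- \<tau> l)" unfolding IT[symmetric] by (intro Imono) auto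
    also have "\<dots> \<le> ennreal C * ennreal (x l powr P)" using tailI[OF l] C by (simp add: ennreal_mult')
    also have "\<dots> \<le> ennreal C * (ennreal C * ennreal (T (- \<tau> l + 1) - T (- \<tau> l - 1)))"
      by (intro mult_left_mono order_trans[OF jump[OF l]] diff) auto
    also have "\<dots> = ennreal (C\<^sup>2 * (T (- \<tau> l + 1) - T (- \<tau> l - 1)))"
      using C d0 by (simp add: power2_eq_square ennreal_mult' mult.assoc)
    finally show ?thesis using C d0 by (simp add: ennreal_le_iff)
  qed
  have "\<exists>C>0. \<exists>eps>0. \<forall>s t. s \<le> t \<longrightarrow> T s \<le> C * exp (- eps * (t - s)) * T t"
  proof (rule jump_decay[OF Tm T0 L])
    fix t
    obtain l where l: "l \<in> \<Lambda>" "\<bar>\<tau> l - (- t)\<bar> \<le> L" using dense by blast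
    then show "\<exists>s. \<bar>s - t\<bar> \<le> L \<and> T (s - 1) \<le> C\<^sup>2 * (T (s + 1) - T (s - 1))"
      using J[OF l(1)] by (intro exI[of _ "- \<tau> l"]) auto
  qed (use C in auto)
  then obtain D eps where D: "0 < D" "0 < eps" "\<And>s t. s \<le> t \<Longrightarrow> T s \<le> D * exp (- eps * (t - s)) * T t" by blast
  define E where "E = C * D * exp eps * C"
  have E: "0 < E" using C D by (simp add: E_def)
  have "X z \<le> E powr (1/P) * exp (- (eps/P) * (\<tau> z - \<tau> l)) * x l"
    if l: "l \<in> \<Lambda>" and z: "z \<in> A" "\<tau> l + 1 \<le> \<tau> z" for l z
  proof -
    have "ennreal (X z powr P) \<le> ennreal C * ennreal (T (- \<tau> z + 1) - T (- \<tau> z - 1))"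
      by (intro order_trans[OF loc[OF z(1)]] mult_left_mono diff) auto
    also have "\<dots> \<le> ennreal C * ennreal (T (- \<tau> z + 1))"
      using T0[of "- \<tau> z - 1"] by (intro mult_left_mono ennreal_leI) auto
    also have "\<dots> = ennreal (C * T (- \<tau> z + 1))" using C by (simp add: ennreal_mult')
    finally have "X z powr P \<le> C * T (- \<tau> z + 1)" using C T0 by (simp add: ennreal_le_iff)
    also have "\<dots> \<le> C * (D * exp (- eps * (- \<tau> l - (- \<tau> z + 1))) * T (- \<tau> l))"
      using C z by (intro mult_left_mono D(3)) auto
    also have "\<dots> \<le> C * (D * exp (- eps * (- \<tau> l - (- \<tau> z + 1))) * (C * x l powr P))"
    proof -
      have "ennreal (T (- \<tau> l)) \<le> ennreal (C * x l powr P)" using tailI[OF l] by (simp add: IT)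
      then have "T (- \<tau> l) \<le> C * x l powr P" using C by (simp add: ennreal_le_iff)
      then show ?thesis using C D by (intro mult_left_mono) auto
    qed
    also have "\<dots> = E * exp (- eps * (\<tau> z - \<tau> l)) * x l powr P"
      by (simp add: E_def algebra_simps exp_diff exp_add exp_minus)
    also have "\<dots> = (E powr (1/P) * exp (- (eps/P) * (\<tau> z - \<tau> l)) * x l) powr P"
    proof -
      have "exp (- (eps/P) * (\<tau> z - \<tau> l)) powr P = exp (- eps * (\<tau> z - \<tau> l))"
        using P by (simp add: powr_def)
      then show ?thesis using E P x0[OF l] by (simp add: powr_mult powr_powr)
    qed
    finally have "X z powr P \<le> (E powr (1/P) * exp (- (eps/P) * (\<tau> z - \<tau> l)) * x l) powr P" .
    then show ?thesis
      using P E x0[OF l] by (smt (verit) mult_nonneg_nonneg exp_ge_zero powr_ge_zero powr_less_mono2)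
  qed
  then show ?thesis using E D(2) P by (intro exI[of _ "E powr (1/P)"] conjI exI[of _ "eps/P"]) auto
qed

text \<open>The dual of the integral version. The bound on sums gives
  \<open>X z * T t \<le> C\<close> whenever \<open>t \<le> \<tau> z\<close>, where \<open>T\<close>
  sums \<open>1 / x l\<close> over the nodes up to level \<open>t\<close>. A node contributes the
  increment \<open>1 / x l\<close>, and its peak condition makes this at least a multiple of
  \<open>1 / X z\<close> at a nearby point \<open>z\<close>, hence of \<open>T\<close> just below
  the node.\<close>

lemma decay_sup:
  fixes X \<tau> x :: "complex \<Rightarrow> real"
  assumes C: "0 < C" and L: "0 < L"
    and X0: "\<And>z. z \<in> A \<Longrightarrow> 0 \<le> X z"
    and x0: "\<And>l. l \<in> \<Lambda> \<Longrightarrow> 0 < x l"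
    and sums: "\<And>F z. finite F \<Longrightarrow> F \<subseteq> \<Lambda> \<Longrightarrow> z \<in> A \<Longrightarrow> (\<And>l. l \<in> F \<Longrightarrow> \<tau> l \<le> \<tau> z) \<Longrightarrow> (\<Sum>l\<in>F. X z / x l) \<le> C"
    and jump: "\<And>l. l \<in> \<Lambda> \<Longrightarrow> \<exists>z\<in>A. \<bar>\<tau> z - \<tau> l\<bar> < 1 \<and> x l \<le> C * X z"
    and dense: "\<And>t. \<exists>l\<in>\<Lambda>. \<bar>\<tau> l - t\<bar> \<le> L"
  shows "\<exists>C>0. \<exists>eps>0. \<forall>l\<in>\<Lambda>. \<forall>z\<in>A. \<tau> l + 1 \<le> \<tau> z \<longrightarrow> X z \<le> C * exp (- eps * (\<tau> z - \<tau> l)) * x l"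
proof -
  define S where "S = (\<lambda>t. {l\<in>\<Lambda>. \<tau> l \<le> t})"
  define T where "T = (\<lambda>t. infsum (\<lambda>l. 1 / x l) (S t))"
  have bnd: "(\<Sum>l\<in>F. 1 / x l) \<le> C / X z" if "finite F" "F \<subseteq> S t" "z \<in> A" "t \<le> \<tau> z" "0 < X z" for F z t
  proof -
    have "(\<Sum>l\<in>F. X z / x l) \<le> C" using that by (intro sums) (auto simp: S_def)
    also have "(\<Sum>l\<in>F. X z / x l) = X z * (\<Sum>l\<in>F. 1 / x l)" by (simp add: sum_distrib_left)
    finally show ?thesis using that by (simp add: field_simps)
  qed
  have jump': "\<exists>z\<in>A. \<bar>\<tau> z - \<tau> l\<bar> < 1 \<and> x l \<le> C * X z \<and> 0 < X z" if l: "l \<in> \<Lambda>" for l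
  proof -
    obtain z where z: "z \<in> A" "\<bar>\<tau> z - \<tau> l\<bar> < 1" "x l \<le> C * X z" using jump[OF l] by blast
    have "0 < C * X z" using z(3) x0[OF l] by linarith
    with C z show ?thesis by (auto simp: zero_less_mult_iff)
  qed
  have summ: "(\<lambda>l. 1 / x l) summable_on S t" for t
  proof -
    \<comment> \<open>The target \<open>t + L + 1\<close> places the node at level
      \<open>t + 1\<close> or higher, so the point attached to it by the peak condition lies beyond
      \<open>t\<close>, where it bounds all partial sums.\<close>
    obtain l where l: "l \<in> \<Lambda>" "\<bar>\<tau> l - (t + L + 1)\<bar> \<le> L" using dense by blast
    obtain z where z: "z \<in> A" "\<bar>\<tau> z - \<tau> l\<bar> < 1" "0 < X z" using jump'[OF l(1)] by blast
    have "t \<le> \<tau> z" using l z by linarith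
    then have "\<And>F. finite F \<and> F \<subseteq> S t \<Longrightarrow> (\<Sum>l\<in>F. 1 / x l) \<le> C / X z" using bnd z by blast
    then show ?thesis
      by (intro nonneg_bdd_above_summable_on) (auto simp: S_def x0 less_imp_le bdd_above_def intro!: exI[of _ "C / X z"])
  qed
  have Tle: "T t \<le> C / X z" if "z \<in> A" "t \<le> \<tau> z" "0 < X z" for z t
    unfolding T_def using that by (intro infsum_le_finite_sums summ bnd) auto
  have T0: "0 \<le> T t" for t unfolding T_def by (rule infsum_nonneg) (auto simp: S_def x0 less_imp_le)
  have Tm: "mono T"
    unfolding mono_def T_def by (auto simp: S_def x0 less_imp_le intro!: infsum_mono_neutral summ[unfolded S_def])
  have Tge: "1 / x l \<le> T (\<tau> l)" if l: "l \<in> \<Lambda>" for l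
  proof -
    have "(\<Sum>\<mu>\<in>{l}. 1 / x \<mu>) \<le> T (\<tau> l)"
      unfolding T_def using l by (intro finite_sum_le_infsum summ) (auto simp: S_def x0 less_imp_le)
    then show ?thesis by simp
  qed
  have Tjump: "1 / x l \<le> T (\<tau> l + 1) - T (\<tau> l - 1)" if l: "l \<in> \<Lambda>" for l
  proof -
    have "T (\<tau> l - 1) + 1 / x l = infsum (\<lambda>l. 1 / x l) (S (\<tau> l - 1) \<union> {l})"
      unfolding T_def using summ by (subst infsum_Un_disjoint) (auto simp: S_def)
    also have "\<dots> \<le> T (\<tau> l + 1)"
      unfolding T_def
    proof (rule infsum_mono_neutral)
      show "(\<lambda>l. 1 / x l) summable_on S (\<tau> l - 1) \<union> {l}"
        using summ by (intro summable_on_Un_disjoint) (auto simp: S_def)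
    qed (use l summ in \<open>auto simp: S_def x0 less_imp_le\<close>)
    finally show ?thesis by linarith
  qed
  have J: "T (\<tau> l - 1) \<le> C\<^sup>2 * (T (\<tau> l + 1) - T (\<tau> l - 1))" if l: "l \<in> \<Lambda>" for l
  proof -
    obtain z where z: "z \<in> A" "\<bar>\<tau> z - \<tau> l\<bar> < 1" "0 < X z" "x l \<le> C * X z" using jump'[OF l(1)] by blast
    have "T (\<tau> l - 1) \<le> C / X z" using z by (intro Tle) auto
    also have "\<dots> \<le> C\<^sup>2 * (1 / x l)"
      using z x0[OF l] C by (simp add: field_simps power2_eq_square mult_left_mono)
    also have "\<dots> \<le> C\<^sup>2 * (T (\<tau> l + 1) - T (\<tau> l - 1))" by (intro mult_left_mono Tjump l) auto
    finally show ?thesis .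
  qed
  have "\<exists>C>0. \<exists>eps>0. \<forall>s t. s \<le> t \<longrightarrow> T s \<le> C * exp (- eps * (t - s)) * T t"
  proof (rule jump_decay[OF Tm T0 L])
    fix t
    obtain l where l: "l \<in> \<Lambda>" "\<bar>\<tau> l - t\<bar> \<le> L" using dense by blast
    then show "\<exists>s. \<bar>s - t\<bar> \<le> L \<and> T (s - 1) \<le> C\<^sup>2 * (T (s + 1) - T (s - 1))"
      using J[OF l(1)] by (intro exI[of _ "\<tau> l"]) auto
  qed (use C in auto)
  then obtain D eps where D: "0 < D" "0 < eps" "\<And>s t. s \<le> t \<Longrightarrow> T s \<le> D * exp (- eps * (t - s)) * T t" by blast
  have "X z \<le> (C * D) * exp (- eps * (\<tau> z - \<tau> l)) * x l"
    if l: "l \<in> \<Lambda>" and z: "z \<in> A" "\<tau> l + 1 \<le> \<tau> z" for l z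
  proof (cases "X z = 0")
    case True
    then show ?thesis using C D x0[OF l] by simp
  next
    case False
    then have Xz: "0 < X z" using X0[OF z(1)] by simp
    have "1 / x l \<le> D * exp (- eps * (\<tau> z - \<tau> l)) * T (\<tau> z)"
      using Tge[OF l] D(3)[of "\<tau> l" "\<tau> z"] z by linarith
    also have "\<dots> \<le> D * exp (- eps * (\<tau> z - \<tau> l)) * (C / X z)"
      using D z Xz by (intro mult_left_mono Tle) auto
    finally show ?thesis using Xz x0[OF l] by (simp add: field_simps)
  qed
  then show ?thesis using C D by (intro exI[of _ "C * D"] conjI exI[of _ eps]) auto
qed

subsection \<open>Division by a linear factor\<close>

lemma holo_divide_zero:
  assumes "holo f" "f a = 0"
  obtains h where "holo h" "\<And>z. f z = (z - a) * h z"
proof -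
  define h where "h = (\<lambda>z. if z = a then deriv f a else (f z - f a) / (z - a))"
  have "holo h"
    unfolding h_def by (rule pole_lemma_open) (use assms in auto)
  moreover have "f z = (z - a) * h z" for z using assms(2) by (simp add: h_def)
  ultimately show ?thesis using that by blast
qed

lemma holo_zero_at:
  assumes "holo f" "a \<noteq> 0" "\<And>z. z \<noteq> 0 \<Longrightarrow> z \<noteq> a \<Longrightarrow> f z = 0"
  shows "f a = 0"
proof -
  have "open punctured_plane" by auto
  then have "isCont f a"
    using holomorphic_on_imp_continuous_on[OF assms(1)] assms(2) continuous_on_eq_continuous_at[of punctured_plane f] by auto
  then have "f \<midarrow>a\<rightarrow> f a" by (simp add: isCont_def)
  moreover have "f \<midarrow>a\<rightarrow> 0"
  proof (rule Lim_transform_eventually[OF tendsto_const])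
    have "\<forall>\<^sub>F z in at a. z \<noteq> 0"
      using assms(2) by (auto simp: eventually_at intro!: exI[of _ "norm a"])
    then show "\<forall>\<^sub>F z in at a. 0 = f z"
      using eventually_neq_at_within[of a a UNIV]
      by eventually_elim (use assms(3) in auto)
  qed
  ultimately show ?thesis using LIM_unique by blast
qed

text \<open>A maximum principle for the weighted modulus, up to a constant: it holds exactly for
  \<open>f\<close> times the holomorphic model of the weight, and the model is exchanged for the
  weight once at each end.\<close>

lemma sup_on_circle:
  assumes "0 < \<alpha>"
  shows "\<exists>K\<ge>1. \<forall>f a. holo f \<longrightarrow> a \<noteq> 0 \<longrightarrow>
     (\<forall>z\<in>cball a (norm a / 8). \<exists>v\<in>sphere a (norm a / 8).
        norm (f z) * wt \<alpha> \<beta> z \<le> K * (norm (f v) * wt \<alpha> \<beta> v))"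
proof -
  obtain K where K: "1 \<le> K" and loc: "\<And>z. z \<noteq> 0 \<Longrightarrow> \<exists>u. holo u \<and> u z = 1 \<and>
    (\<forall>v. v \<noteq> 0 \<longrightarrow> u v \<noteq> 0) \<and>
    (\<forall>v. norm (v - z) \<le> norm z / 2 \<longrightarrow>
       wt \<alpha> \<beta> v \<le> K * (wt \<alpha> \<beta> z * norm (u v)) \<and> wt \<alpha> \<beta> z * norm (u v) \<le> K * wt \<alpha> \<beta> v)"
    using wt_local[OF assms(1), of \<beta>] by blast
  have "\<exists>v\<in>sphere a (norm a / 8). norm (f z) * wt \<alpha> \<beta> z \<le> (K * K) * (norm (f v) * wt \<alpha> \<beta> v)"
    if f: "holo f" and a: "a \<noteq> 0" and z: "z \<in> cball a (norm a / 8)" for f a z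
  proof -
    obtain u where u: "holo u"
      and uw: "\<And>v. norm (v - a) \<le> norm a / 2 \<Longrightarrow> wt \<alpha> \<beta> v \<le> K * (wt \<alpha> \<beta> a * norm (u v))"
        "\<And>v. norm (v - a) \<le> norm a / 2 \<Longrightarrow> wt \<alpha> \<beta> a * norm (u v) \<le> K * wt \<alpha> \<beta> v"
      using loc[OF a] by blast
    define h where "h = (\<lambda>v. f v * u v)"
    have sub: "cball a (norm a / 8) \<subseteq> punctured_plane" using a by auto
    have hol: "h holomorphic_on cball a (norm a / 8)"
      unfolding h_def using f u(1) sub holomorphic_on_subset by (intro holomorphic_intros) blast+
    have cont: "continuous_on (sphere a (norm a / 8)) (\<lambda>v. norm (h v))"
      by (intro continuous_on_norm holomorphic_on_imp_continuous_on holomorphic_on_subset[OF hol] sphere_cball)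
    have "sphere a (norm a / 8) \<noteq> {}" by simp
    then obtain b where b: "b \<in> sphere a (norm a / 8)" "\<And>v. v \<in> sphere a (norm a / 8) \<Longrightarrow> norm (h v) \<le> norm (h b)"
      using continuous_attains_sup[OF compact_sphere _ cont] by blast
    have "norm (h z) \<le> norm (h b)"
    proof (rule maximum_modulus_frontier[where S = "cball a (norm a / 8)" and f = h])
      show "h holomorphic_on interior (cball a (norm a / 8))"
        using hol holomorphic_on_subset interior_subset by blast
      show "continuous_on (closure (cball a (norm a / 8))) h"
        using hol holomorphic_on_imp_continuous_on by simp
    qed (use a z b in \<open>auto simp: frontier_cball\<close>)
    then have 1: "norm (f z) * norm (u z) \<le> norm (f b) * norm (u b)" by (simp add: h_def norm_mult)
    have za: "norm (z - a) \<le> norm a / 2" and ba: "norm (b - a) \<le> norm a / 2"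
      using z b(1) norm_ge_zero[of a]
      unfolding mem_cball mem_sphere dist_norm norm_minus_commute[of a] by linarith+
    have "norm (f z) * wt \<alpha> \<beta> z \<le> norm (f z) * (K * (wt \<alpha> \<beta> a * norm (u z)))"
      by (intro mult_left_mono uw(1) za) auto
    also have "\<dots> = K * wt \<alpha> \<beta> a * (norm (f z) * norm (u z))" by simp
    also have "\<dots> \<le> K * wt \<alpha> \<beta> a * (norm (f b) * norm (u b))" using 1 K by (intro mult_left_mono) auto
    also have "\<dots> = K * norm (f b) * (wt \<alpha> \<beta> a * norm (u b))" by simp
    also have "\<dots> \<le> K * norm (f b) * (K * wt \<alpha> \<beta> b)" using K by (intro mult_left_mono uw(2) ba) auto
    finally show ?thesis using b(1) by (intro bexI[of _ b]) (auto simp: mult_ac)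
  qed
  moreover have "1 \<le> K * K" using K mult_mono[of 1 K 1 K] by simp
  ultimately show ?thesis by blast
qed

text \<open>Away from \<open>a\<close> the factor \<open>norm (z - a)\<close> is itself comparable
  with \<open>norm z + norm a\<close>; on a small disc about \<open>a\<close> the quotient is
  compared with its values on the boundary circle.\<close>

lemma division_bound:
  assumes "0 < \<alpha>"
  shows "\<exists>C>0. \<forall>h a K. holo h \<longrightarrow> a \<noteq> 0 \<longrightarrow>
    (\<forall>z. z \<noteq> 0 \<longrightarrow> norm ((z - a) * h z) * wt \<alpha> \<beta> z \<le> K) \<longrightarrow>
    (\<forall>z. z \<noteq> 0 \<longrightarrow> norm (h z) * wt \<alpha> \<beta> z \<le> C * K / (norm z + norm a))"
proof -
  obtain K0 where K0: "1 \<le> K0" and circ: "\<And>f a z. holo f \<Longrightarrow> a \<noteq> 0 \<Longrightarrow>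
     z \<in> cball a (norm a / 8) \<Longrightarrow> \<exists>v\<in>sphere a (norm a / 8).
        norm (f z) * wt \<alpha> \<beta> z \<le> K0 * (norm (f v) * wt \<alpha> \<beta> v)"
    using sup_on_circle[OF assms, of \<beta>] by blast
  \<comment> \<open>24 serves both cases: on the disc the circle is at distance
    \<open>norm a / 8\<close> from \<open>a\<close> and
    \<open>norm z + norm a \<le> 3 * norm a\<close>; off the disc
    \<open>norm z + norm a \<le> 24 * norm (z - a)\<close>.\<close>
  have "norm (h z) * wt \<alpha> \<beta> z \<le> (24 * K0) * K / (norm z + norm a)"
    if h: "holo h" and a: "a \<noteq> 0" and z: "z \<noteq> 0"
      and K: "\<And>z. z \<noteq> 0 \<Longrightarrow> norm ((z - a) * h z) * wt \<alpha> \<beta> z \<le> K" for h a K z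
  proof -
    have Kp: "0 \<le> K" using order_trans[OF _ K[OF z]] by simp
    have pos: "0 < norm z + norm a" using z by (simp add: add_pos_nonneg)
    have away: "norm (h z) * wt \<alpha> \<beta> z \<le> K / norm (z - a)" if "z \<noteq> 0" "z \<noteq> a" for z
    proof -
      have "norm (h z) * wt \<alpha> \<beta> z * norm (z - a) \<le> K"
        using K[OF that(1)] unfolding norm_mult by (simp only: mult_ac)
      then show ?thesis using that(2) by (simp add: pos_le_divide_eq)
    qed
    show ?thesis
    proof (cases "z \<in> cball a (norm a / 8)")
      case True
      obtain b where b: "b \<in> sphere a (norm a / 8)" "norm (h z) * wt \<alpha> \<beta> z \<le> K0 * (norm (h b) * wt \<alpha> \<beta> b)"
        using circ[OF h a True] by blast
      have nb: "norm (b - a) = norm a / 8" using b(1) by (simp add: dist_norm norm_minus_commute)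
      then have "b \<noteq> 0" "b \<noteq> a" using a by auto
      then have "norm (h b) * wt \<alpha> \<beta> b \<le> K / (norm a / 8)" using away[of b] nb by simp
      then have "norm (h z) * wt \<alpha> \<beta> z \<le> K0 * (K / (norm a / 8))"
        using b(2) K0 mult_left_mono[of "norm (h b) * wt \<alpha> \<beta> b" "K / (norm a / 8)" K0] by linarith
      also have "\<dots> = (24 * K0) * K / (3 * norm a)" by simp
      also have "\<dots> \<le> (24 * K0) * K / (norm z + norm a)"
      proof (rule divide_left_mono)
        show "norm z + norm a \<le> 3 * norm a"
          using True norm_triangle_ineq2[of z a] norm_ge_zero[of a]
          unfolding mem_cball dist_norm norm_minus_commute[of a z] by linarith
      qed (use K0 Kp pos a in auto)
      finally show ?thesis .
    next
      case False
      then have d: "norm a / 8 < norm (z - a)" by (auto simp: dist_norm norm_minus_commute)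
      then have za: "z \<noteq> a" using a by auto
      have "norm (h z) * wt \<alpha> \<beta> z \<le> K / norm (z - a)" by (rule away[OF z za])
      also have "\<dots> = (24 * K) / (24 * norm (z - a))" by simp
      also have "\<dots> \<le> (24 * K) / (norm z + norm a)"
      proof (rule divide_left_mono)
        show "norm z + norm a \<le> 24 * norm (z - a)"
          using d norm_triangle_ineq2[of z a] norm_ge_zero[of "z - a"] by linarith
      qed (use Kp pos za in auto)
      also have "\<dots> \<le> (24 * K0) * K / (norm z + norm a)"
        using K0 Kp pos by (intro divide_right_mono mult_right_mono) auto
      finally show ?thesis .
    qed
  qed
  then show ?thesis using K0 by (intro exI[of _ "24 * K0"]) auto
qed

text \<open>Off a disc about \<open>a\<close> the divisor is bounded below, so the quotient inherits
  integrability. On the disc the pointwise bound is enough, with an exponential in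
  \<open>lg z - lg a\<close> standing in for the indicator of the disc since it is already known to
  be integrable.\<close>

lemma Cbound_divide:
  assumes "0 < \<alpha>" "0 < p" and h: "holo h" and a: "a \<noteq> 0" and K: "0 \<le> K"
    and "Cbound p (\<lambda>z. norm ((z - a) * h z) * wt \<alpha> \<beta> z) K"
  shows "\<exists>K\<ge>0. Fbound \<alpha> \<beta> p h K"
proof -
  obtain C1 where C1: "0 < C1" "\<And>f K. holo f \<Longrightarrow> 0 \<le> K \<Longrightarrow>
    Fbound \<alpha> \<beta> p f K \<Longrightarrow> (\<forall>z. z \<noteq> 0 \<longrightarrow> norm (f z) * wt \<alpha> \<beta> z \<le> C1 * K)"
    using Cbound_pointwise[OF assms(1,2), of \<beta>] by blast
  obtain C2 where C2: "0 < C2" "\<And>h a K. holo h \<Longrightarrow> a \<noteq> 0 \<Longrightarrow>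
    (\<forall>z. z \<noteq> 0 \<longrightarrow> norm ((z - a) * h z) * wt \<alpha> \<beta> z \<le> K) \<Longrightarrow>
    (\<forall>z. z \<noteq> 0 \<longrightarrow> norm (h z) * wt \<alpha> \<beta> z \<le> C2 * K / (norm z + norm a))"
    using division_bound[OF assms(1), of \<beta>] by blast
  have hol: "(\<lambda>z. (z - a) * h z) holomorphic_on punctured_plane"
    using h by (intro holomorphic_intros)
  have "\<forall>z. z \<noteq> 0 \<longrightarrow> norm ((z - a) * h z) * wt \<alpha> \<beta> z \<le> C1 * K"
    by (rule C1(2)[OF hol K assms(6)])
  then have hb: "norm (h z) * wt \<alpha> \<beta> z \<le> C2 * (C1 * K) / (norm z + norm a)" if "z \<noteq> 0" for z
    using C2(2)[OF h a] that by blast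
  obtain C3 where C3: "0 < C3" "Cbound p (\<lambda>z. exp (- 1 * \<bar>lg z - lg a\<bar>)) C3"
    using Cbound_exp[of 1 p] assms(2) by auto
  define D where "D = C2 * (C1 * K) / norm a * exp 1"
  have D: "0 \<le> D" using C1 C2 K by (simp add: D_def)
  define v1 where "v1 = (\<lambda>z. 8 / norm a * (norm ((z - a) * h z) * wt \<alpha> \<beta> z))"
  define v2 where "v2 = (\<lambda>z::complex. D * exp (- 1 * \<bar>lg z - lg a\<bar>))"
  note meas = holo_wt_measurable[OF hol, of \<alpha> \<beta>]
  have b1: "Cbound p v1 (8 / norm a * K)"
    unfolding v1_def using meas K assms(6) by (intro Lbound_scale AE_haar) auto
  have b2: "Cbound p v2 (D * C3)"
    unfolding v2_def using D C3 by (intro Lbound_scale AE_haar) auto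
  have "v1 \<in> borel_measurable haar" "v2 \<in> borel_measurable haar"
    unfolding v1_def v2_def using meas by auto
  then obtain K' where K': "0 \<le> K'" "Cbound p (\<lambda>z. v1 z + v2 z) K'"
    using Lbound_add[OF AE_haar _ _ _ _ b1 b2 assms(2)] D C3 K by (auto simp: v1_def v2_def)
  have "Fbound \<alpha> \<beta> p h K'"
  proof (rule Lbound_mono[OF AE_haar _ _ K'(2) order_refl K'(1)])
    fix z :: complex assume z: "z \<in> punctured_plane"
    have v1: "0 \<le> v1 z" and v2: "0 \<le> v2 z" using D by (auto simp: v1_def v2_def)
    show "norm (h z) * wt \<alpha> \<beta> z \<le> v1 z + v2 z"
    proof (cases "norm (z - a) \<le> norm a / 8")
      case True
      then have "\<bar>lg z - lg a\<bar> < 1" using ln_norm_close(2)[OF a, of z] norm_ge_zero[of a] by linarith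
      then have e: "1 \<le> exp 1 * exp (- 1 * \<bar>lg z - lg a\<bar>)" by (simp flip: exp_add)
      have "norm (h z) * wt \<alpha> \<beta> z \<le> C2 * (C1 * K) / (norm z + norm a)" using hb z by auto
      also have "\<dots> \<le> C2 * (C1 * K) / norm a"
        using C1 C2 K a by (intro divide_left_mono) (auto intro!: mult_pos_pos add_nonneg_pos)
      also have "\<dots> \<le> C2 * (C1 * K) / norm a * (exp 1 * exp (- 1 * \<bar>lg z - lg a\<bar>))"
        using mult_left_mono[OF e, of "C2 * (C1 * K) / norm a"] C1 C2 K by simp
      also have "\<dots> = v2 z" by (simp add: v2_def D_def)
      finally show ?thesis using v1 by linarith
    next
      case False
      have "1 \<le> 8 / norm a * norm (z - a)" using False a by (simp add: field_simps)
      then have "norm (h z) * wt \<alpha> \<beta> z \<le> (8 / norm a * norm (z - a)) * (norm (h z) * wt \<alpha> \<beta> z)"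
        using mult_right_mono[of 1 "8 / norm a * norm (z - a)" "norm (h z) * wt \<alpha> \<beta> z"] by simp
      also have "\<dots> = v1 z" by (simp add: v1_def norm_mult)
      finally show ?thesis using v2 by linarith
    qed
  qed auto
  then show ?thesis using K'(1) by blast
qed

text \<open>The bridge from bounded functions to every exponent: two divisions gain a power of
  \<open>z\<close> at infinity beyond the one spent by the factor \<open>z\<close>, while that
  factor gives decay at the origin. The result is dominated by
  \<open>exp (- \<bar>lg z\<bar>)\<close>.\<close>

lemma Cbound_divide2:
  assumes "0 < \<alpha>" "0 < p" and h: "holo h" and a: "a \<noteq> 0" "b \<noteq> 0"
    and K: "\<And>z. z \<noteq> 0 \<Longrightarrow> norm ((z - a) * ((z - b) * h z)) * wt \<alpha> \<beta> z \<le> K"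
  shows "\<exists>K\<ge>0. Cbound p (\<lambda>z. norm (z * h z) * wt \<alpha> \<beta> z) K"
proof -
  obtain C1 where C1: "0 < C1" "\<And>h a K. holo h \<Longrightarrow> a \<noteq> 0 \<Longrightarrow>
    (\<forall>z. z \<noteq> 0 \<longrightarrow> norm ((z - a) * h z) * wt \<alpha> \<beta> z \<le> K) \<Longrightarrow>
    (\<forall>z. z \<noteq> 0 \<longrightarrow> norm (h z) * wt \<alpha> \<beta> z \<le> C1 * K / (norm z + norm a))" for K
    using division_bound[OF assms(1), of \<beta>] by blast
  \<comment> \<open>The division estimate is used with weight exponent \<open>\<beta> + 1\<close> as
    well: after the first division the extra factor \<open>norm z\<close> is still harmless, and the
    second division then yields decay at infinity.\<close>
  obtain C2 where C2: "0 < C2" "\<And>h a K. holo h \<Longrightarrow> a \<noteq> 0 \<Longrightarrow>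
    (\<forall>z. z \<noteq> 0 \<longrightarrow> norm ((z - a) * h z) * wt \<alpha> (\<beta> + 1) z \<le> K) \<Longrightarrow>
    (\<forall>z. z \<noteq> 0 \<longrightarrow> norm (h z) * wt \<alpha> (\<beta> + 1) z \<le> C2 * K / (norm z + norm a))" for K
    using division_bound[OF assms(1), of "\<beta> + 1"] by blast
  have K0: "0 \<le> K" using order_trans[OF _ K[of 1]] by simp
  have hol: "(\<lambda>z. (z - b) * h z) holomorphic_on punctured_plane"
    using h by (intro holomorphic_intros)
  have 1: "norm ((z - b) * h z) * wt \<alpha> \<beta> z \<le> C1 * K / (norm z + norm a)" if "z \<noteq> 0" for z
    using C1(2)[OF hol a(1)] K that by blast
  have bnd: "C1 * K / (norm z + norm a) \<le> C1 * K / norm a" "C1 * K / (norm z + norm a) * norm z \<le> C1 * K" if "z \<noteq> 0" for z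
  proof -
    have pos: "0 < norm z + norm a" using that by (simp add: add_pos_nonneg)
    show "C1 * K / (norm z + norm a) \<le> C1 * K / norm a"
      using C1 K0 a pos by (intro divide_left_mono) auto
    have "C1 * K / (norm z + norm a) * norm z = C1 * K * (norm z / (norm z + norm a))" by simp
    also have "\<dots> \<le> C1 * K * 1" using pos C1 K0 by (intro mult_left_mono) (auto simp: field_simps)
    finally show "C1 * K / (norm z + norm a) * norm z \<le> C1 * K" by simp
  qed
  have "norm ((z - b) * h z) * wt \<alpha> \<beta> z \<le> C1 * K / norm a" if "z \<noteq> 0" for z
    using order_trans[OF 1 bnd(1)] that by blast
  then have 2: "norm (h z) * wt \<alpha> \<beta> z \<le> C1 * (C1 * K / norm a) / (norm z + norm b)" if "z \<noteq> 0" for z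
    using C1(2)[OF h a(2)] that by blast
  have "norm ((z - b) * h z) * wt \<alpha> (\<beta> + 1) z \<le> C1 * K" if "z \<noteq> 0" for z
  proof -
    have "norm ((z - b) * h z) * wt \<alpha> (\<beta> + 1) z = (norm ((z - b) * h z) * wt \<alpha> \<beta> z) * norm z"
      using that by (simp add: wt_add)
    also have "\<dots> \<le> C1 * K / (norm z + norm a) * norm z" using 1[OF that] by (intro mult_right_mono) auto
    finally show ?thesis using bnd(2)[OF that] by linarith
  qed
  then have 3: "norm (h z) * wt \<alpha> (\<beta> + 1) z \<le> C2 * (C1 * K) / (norm z + norm b)" if "z \<noteq> 0" for z
    using C2(2)[OF h a(2)] that by blast
  define D1 where "D1 = C1 * (C1 * K / norm a)"
  define D2 where "D2 = C2 * (C1 * K)"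
  have D: "0 \<le> D1" "0 \<le> D2" using C1 C2 K0 by (auto simp: D1_def D2_def)
  define D where "D = max (D1 / norm b) D2"
  have D0: "0 \<le> D" using D by (auto simp: D_def le_max_iff_disj)
  have pt: "norm (z * h z) * wt \<alpha> \<beta> z \<le> D * exp (- 1 * \<bar>lg z - 0\<bar>)" if z: "z \<noteq> 0" for z
  proof (cases "norm z \<le> 1")
    case True
    then have e: "exp (- 1 * \<bar>lg z - 0\<bar>) = norm z" using z by simp
    have "norm (z * h z) * wt \<alpha> \<beta> z = norm z * (norm (h z) * wt \<alpha> \<beta> z)" by (simp add: norm_mult)
    also have "\<dots> \<le> norm z * (D1 / (norm z + norm b))" using 2[OF z] by (intro mult_left_mono) (auto simp: D1_def)
    also have "\<dots> \<le> norm z * (D1 / norm b)"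
      using D a z by (intro mult_left_mono divide_left_mono) (auto intro!: mult_pos_pos add_nonneg_pos)
    also have "\<dots> \<le> norm z * D" by (intro mult_left_mono) (auto simp: D_def)
    finally show ?thesis unfolding e by (simp only: mult.commute)
  next
    case False
    then have e: "exp (- 1 * \<bar>lg z - 0\<bar>) = 1 / norm z" using z by (simp add: exp_minus inverse_eq_divide)
    have "norm (z * h z) * wt \<alpha> \<beta> z = norm (h z) * wt \<alpha> (\<beta> + 1) z" using z by (simp add: wt_add norm_mult)
    also have "\<dots> \<le> D2 / (norm z + norm b)" using 3[OF z] by (simp add: D2_def)
    also have "\<dots> \<le> D2 / norm z"
      using D z by (intro divide_left_mono) (auto intro!: mult_pos_pos add_pos_nonneg)
    also have "\<dots> \<le> D / norm z" by (intro divide_right_mono) (auto simp: D_def)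
    finally show ?thesis unfolding e by simp
  qed
  obtain C3 where C3: "0 < C3" "\<And>s. Cbound p (\<lambda>z. exp (- 1 * \<bar>lg z - s\<bar>)) C3"
    using Cbound_exp[OF zero_less_one assms(2)] by blast
  have "Cbound p (\<lambda>z. D * exp (- 1 * \<bar>lg z - 0\<bar>)) (D * C3)"
    by (rule Lbound_scale[OF AE_haar _ _ D0 _ C3(2)]) (use C3(1) in auto)
  then have "Cbound p (\<lambda>z. norm (z * h z) * wt \<alpha> \<beta> z) (D * C3)"
  proof (rule Lbound_mono[OF AE_haar _ _ _ order_refl, rotated 2])
    show "0 \<le> D * C3" using D0 C3(1) by simp
  qed (use pt in simp_all)
  moreover have "0 \<le> D * C3" using D0 C3(1) by simp
  ultimately show ?thesis by blast
qed

subsection \<open>Complete interpolation with an explicit weight exponent\<close>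

text \<open>Bounded restriction, solvability with control, and uniqueness, with
  \<open>\<beta>\<close> uncoupled from \<open>p\<close>. Real bounds \<open>K\<close> replace
  extended norms and inverse maps, and equality is asked only off the origin, so no value of
  \<open>f\<close> at 0 has to be fixed.\<close>

definition weighted_ci :: "real \<Rightarrow> real \<Rightarrow> ennreal \<Rightarrow> complex set \<Rightarrow> real \<Rightarrow> bool" where
  "weighted_ci \<alpha> \<beta> p \<Lambda> C \<longleftrightarrow>
     (\<forall>f K. holo f \<longrightarrow> 0 \<le> K \<longrightarrow> Fbound \<alpha> \<beta> p f K \<longrightarrow>
        Sbound \<alpha> \<beta> \<Lambda> p f (C * K)) \<and>
     (\<forall>a K. 0 \<le> K \<longrightarrow> Sbound \<alpha> \<beta> \<Lambda> p a K \<longrightarrow>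
        (\<exists>f. holo f \<and> (\<forall>z\<in>\<Lambda>. f z = a z) \<and>
           Fbound \<alpha> \<beta> p f (C * K))) \<and>
     (\<forall>f K. holo f \<longrightarrow> 0 \<le> K \<longrightarrow> Fbound \<alpha> \<beta> p f K \<longrightarrow>
        (\<forall>z\<in>\<Lambda>. f z = 0) \<longrightarrow> (\<forall>z. z \<noteq> 0 \<longrightarrow> f z = 0))"

lemma weighted_ci_bounded:
  assumes "weighted_ci \<alpha> \<beta> p \<Lambda> C" "holo f" "0 \<le> K"
    "Fbound \<alpha> \<beta> p f K"
  shows "Sbound \<alpha> \<beta> \<Lambda> p f (C * K)"
  by (rule assms(1)[unfolded weighted_ci_def, THEN conjunct1, rule_format, OF assms(2-4)])

lemma weighted_ci_interpolate:
  assumes "weighted_ci \<alpha> \<beta> p \<Lambda> C" "0 \<le> K" "Sbound \<alpha> \<beta> \<Lambda> p a K"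
  obtains f where "holo f" "\<forall>z\<in>\<Lambda>. f z = a z"
    "Fbound \<alpha> \<beta> p f (C * K)"
  using assms(1)[unfolded weighted_ci_def, THEN conjunct2, THEN conjunct1, rule_format, OF assms(2,3)] that
  by (elim exE conjE)

lemma weighted_ci_unique:
  assumes "weighted_ci \<alpha> \<beta> p \<Lambda> C" "holo f" "0 \<le> K"
    "Fbound \<alpha> \<beta> p f K" "\<And>z. z \<in> \<Lambda> \<Longrightarrow> f z = 0" "z \<noteq> 0"
  shows "f z = 0"
  by (rule assms(1)[unfolded weighted_ci_def, THEN conjunct2, THEN conjunct2, rule_format, OF assms(2-6)])

section \<open>Translation between norms and explicit bounds\<close>

lemma Lp_norm_le_iff:
  assumes "0 < p" "0 \<le> K" "(\<lambda>x. norm (f x)) \<in> borel_measurable M"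
  shows "Lp_norm M p f \<le> ennreal K \<longleftrightarrow>
    (if p = \<infinity> then AE x in M. norm (f x) \<le> K
     else (\<integral>\<^sup>+ x. ennreal (norm (f x) powr enn2real p) \<partial>M) \<le> ennreal (K powr enn2real p))"
proof (cases "p = \<infinity>")
  case True
  have m: "(\<lambda>x. ennreal (norm (f x))) \<in> borel_measurable M" using assms(3) by simp
  have "esssup M (\<lambda>x. ennreal (norm (f x))) \<le> ennreal K \<longleftrightarrow> (AE x in M. ennreal (norm (f x)) \<le> ennreal K)"
  proof
    assume *: "esssup M (\<lambda>x. ennreal (norm (f x))) \<le> ennreal K"
    show "AE x in M. ennreal (norm (f x)) \<le> ennreal K"
      using esssup_AE[of "\<lambda>x. ennreal (norm (f x))" M] by eventually_elim (rule order_trans[OF _ *])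
  next
    assume "AE x in M. ennreal (norm (f x)) \<le> ennreal K"
    then show "esssup M (\<lambda>x. ennreal (norm (f x))) \<le> ennreal K" by (rule esssup_I[OF m])
  qed
  then show ?thesis using True assms(2) by (simp add: Lp_norm_def)
next
  case False
  define P where "P = enn2real p"
  have P: "0 < P" using enn2real_pos[OF assms(1) False] by (simp add: P_def)
  define I where "I = (\<integral>\<^sup>+ x. ennreal (norm (f x) powr P) \<partial>M)"
  have "Lp_norm M p f = (if I = \<infinity> then \<infinity> else ennreal (enn2real I powr (1/P)))"
    using False by (simp add: Lp_norm_def I_def P_def Let_def)
  moreover have "ennreal (enn2real I powr (1/P)) \<le> ennreal K \<longleftrightarrow> I \<le> ennreal (K powr P)" if "I \<noteq> \<infinity>"
  proof -
    define i where "i = enn2real I"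
    have i: "0 \<le> i" "I = ennreal i" using that by (simp_all add: i_def less_top)
    have "i powr (1/P) \<le> K \<longleftrightarrow> (i powr (1/P)) powr P \<le> K powr P"
    proof
      assume "i powr (1/P) \<le> K"
      then show "(i powr (1/P)) powr P \<le> K powr P" using P by (intro powr_mono2) auto
    next
      assume "(i powr (1/P)) powr P \<le> K powr P"
      then show "i powr (1/P) \<le> K" using powr_less_mono2[OF P assms(2), of "i powr (1/P)"] by linarith
    qed
    also have "(i powr (1/P)) powr P = i" using P i by (simp add: powr_powr)
    finally show ?thesis using i assms(2) by simp
  qed
  ultimately show ?thesis using False by (auto simp: I_def P_def top_unique)
qed

lemma lp_norm_le_iff:
  assumes "0 < p" "0 \<le> K"
  shows "lp_norm \<Lambda> p a \<le> ennreal K \<longleftrightarrow> Dbound \<Lambda> p (\<lambda>z. norm (a z)) K"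
  unfolding lp_norm_def using assms by (subst Lp_norm_le_iff) (auto simp: Lbound_def AE_count_space)

lemma Dbound_cong:
  assumes "\<And>z. z \<in> \<Lambda> \<Longrightarrow> u z = v z"
  shows "Dbound \<Lambda> p u K \<longleftrightarrow> Dbound \<Lambda> p v K"
proof -
  have "(\<integral>\<^sup>+ x. ennreal (u x powr enn2real p) \<partial>count_space \<Lambda>) = (\<integral>\<^sup>+ x. ennreal (v x powr enn2real p) \<partial>count_space \<Lambda>)"
    using assms by (intro nn_integral_cong) auto
  then show ?thesis using assms by (simp add: Lbound_def)
qed

lemma Cbound_cong:
  assumes "\<And>z. z \<noteq> 0 \<Longrightarrow> u z = v z"
  shows "Cbound p u K \<longleftrightarrow> Cbound p v K"
proof -
  have "(\<integral>\<^sup>+ x. ennreal (u x powr enn2real p) \<partial>haar) = (\<integral>\<^sup>+ x. ennreal (v x powr enn2real p) \<partial>haar)"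
    by (rule nn_integral_cong_AE, rule AE_mp[OF AE_haar], rule AE_I2) (use assms in auto)
  then show ?thesis using assms by (simp add: Lbound_def)
qed

text \<open>For finite \<open>p\<close> the factor \<open>norm z powr (2/p)\<close> raised to the
  power \<open>p\<close> is the squared modulus, which cancels the Haar density. For
  \<open>p = \<infinity>\<close> an almost everywhere bound is a bound everywhere off the origin,
  because the set where it fails is open and null.\<close>

lemma fock_norm_le_iff:
  assumes "0 < p" "0 \<le> K" and f: "holo f" "f 0 = 0"
  shows "fock_norm \<alpha> p f \<le> ennreal K \<longleftrightarrow> Cbound p (\<lambda>z. norm (f z) * wt \<alpha> (two_over p) z) K"
proof -
  define g where "g = (\<lambda>z. f z * of_real (exp (- \<alpha> * (lg z)\<^sup>2)))"
  have g: "norm (g z) = norm (f z) * wt \<alpha> 0 z" for z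
    using f(2) by (cases "z = 0") (simp_all add: g_def wt_def norm_mult)
  have meas: "(\<lambda>z. norm (g z)) \<in> borel_measurable borel"
    unfolding g by (rule holo_wt_measurable[OF f(1)])
  have cont: "continuous_on punctured_plane (\<lambda>z. norm (g z))"
    unfolding g wt_def using holomorphic_on_imp_continuous_on[OF f(1)]
    by (intro continuous_intros) auto
  have fn: "fock_norm \<alpha> p f = Lp_norm lborel p g" by (simp add: fock_norm_def g_def)
  show ?thesis
  proof (cases "p = \<infinity>")
    case True
    have "(AE z in lborel. norm (g z) \<le> K) \<longleftrightarrow> (\<forall>z\<in>punctured_plane. norm (g z) \<le> K)"
    proof
      assume ae: "AE z in lborel. norm (g z) \<le> K"
      define U where "U = {z\<in>punctured_plane. norm (g z) \<in> {K<..}}"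
      have op: "open U"
        unfolding U_def using continuous_on_open_vimage[THEN iffD1, OF _ cont, rule_format, of "{K<..}"]
        by (auto simp: vimage_def Int_def conj_commute)
      have "AE z in lborel. z \<notin> U" using ae by eventually_elim (auto simp: U_def)
      then have "U \<in> null_sets lborel"
        using op by (subst AE_iff_null_sets) auto
      then have "negligible U"
        by (simp add: negligible_iff_null_sets null_sets_completionI)
      then have "U = {}" using open_not_negligible[OF op] by blast
      then show "\<forall>z\<in>punctured_plane. norm (g z) \<le> K" by (force simp: U_def)
    next
      assume *: "\<forall>z\<in>punctured_plane. norm (g z) \<le> K"
      have "norm (g 0) \<le> K" using f(2) assms(2) by (simp add: g_def)
      with * show "AE z in lborel. norm (g z) \<le> K" by (intro AE_I2) (metis Diff_iff UNIV_I singletonD)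
    qed
    then show ?thesis
      unfolding fn using assms(1,2) meas True by (subst Lp_norm_le_iff) (auto simp: Lbound_def g two_over_def)
  next
    case False
    define P where "P = enn2real p"
    have P: "0 < P" using enn2real_pos[OF assms(1) False] by (simp add: P_def)
    have pt: "ennreal (norm (g z) powr P) = ennreal (1 / (norm z)\<^sup>2) * ennreal ((norm (f z) * wt \<alpha> (two_over p) z) powr P)" for z
    proof (cases "z = 0")
      case True
      then show ?thesis by (simp add: g)
    next
      case z: False
      have "(norm (f z) * wt \<alpha> (two_over p) z) powr P = (norm z powr (2/P)) powr P * (norm (f z) * wt \<alpha> 0 z) powr P"
        using wt_add[OF z, of \<alpha> 0 "2/P"] False
        by (simp add: two_over_def P_def[symmetric] powr_mult mult_ac)
      also have "(norm z powr (2/P)) powr P = (norm z)\<^sup>2"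
        using P z by (simp add: powr_powr)
      finally show ?thesis using z by (simp add: g flip: ennreal_mult')
    qed
    have [measurable]: "(\<lambda>z. norm (f z) * wt \<alpha> (two_over p) z) \<in> borel_measurable borel"
      by (rule holo_wt_measurable[OF f(1)])
    have "(\<integral>\<^sup>+ z. ennreal (norm (g z) powr P) \<partial>lborel) = (\<integral>\<^sup>+ z. ennreal ((norm (f z) * wt \<alpha> (two_over p) z) powr P) \<partial>haar)"
      unfolding pt by (rule nn_integral_haar[symmetric]) measurable
    then show ?thesis
      unfolding fn using assms(1,2) meas False by (subst Lp_norm_le_iff) (auto simp: Lbound_def P_def)
  qed
qed

lemma Cbound_0: "0 < p \<Longrightarrow> Cbound p (\<lambda>z. norm (0::complex) * wt \<alpha> \<beta> z) 0"
  by (simp add: Lbound_def)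

lemma fock_norm_finite:
  assumes "f \<in> fock_space \<alpha> p"
  shows "fock_norm \<alpha> p f = ennreal (enn2real (fock_norm \<alpha> p f))"
  using assms by (simp add: fock_space_def)

lemma fock_spaceI:
  assumes "0 < p" "0 \<le> K" "holo f" "Cbound p (\<lambda>z. norm (f z) * wt \<alpha> (two_over p) z) K"
  shows "(\<lambda>z. if z = 0 then 0 else f z) \<in> fock_space \<alpha> p"
    "fock_norm \<alpha> p (\<lambda>z. if z = 0 then 0 else f z) \<le> ennreal K"
proof -
  let ?f = "\<lambda>z. if z = 0 then 0 else f z"
  have h: "holo ?f"
    using assms(3) by (rule holomorphic_transform) auto
  have "Cbound p (\<lambda>z. norm (?f z) * wt \<alpha> (two_over p) z) K"
    by (rule Cbound_cong[THEN iffD1, OF _ assms(4)]) auto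
  then show *: "fock_norm \<alpha> p ?f \<le> ennreal K"
    using assms h by (subst fock_norm_le_iff) auto
  then show "?f \<in> fock_space \<alpha> p" using h by (auto simp: fock_space_def intro: le_less_trans)
qed

lemma restriction_Dbound:
  assumes "\<Lambda> \<subseteq> punctured_plane"
  shows "Dbound \<Lambda> p (\<lambda>z. norm (restriction_op \<alpha> p \<Lambda> f z)) K \<longleftrightarrow> Dbound \<Lambda> p (\<lambda>z. norm (f z) * wt \<alpha> (two_over p) z) K"
  by (rule Dbound_cong) (simp add: restriction_op_def norm_mult wt_def abs_mult)

lemma restriction_eq_iff:
  assumes "\<Lambda> \<subseteq> punctured_plane"
  shows "restriction_op \<alpha> p \<Lambda> f = restriction_op \<alpha> p \<Lambda> g \<longleftrightarrow> (\<forall>z\<in>\<Lambda>. f z = g z)"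
  using assms by (auto simp: restriction_op_def fun_eq_iff)

lemma complete_interpolating_imp_weighted:
  assumes p: "0 < p" and sub: "\<Lambda> \<subseteq> punctured_plane" and ci: "complete_interpolating \<alpha> p \<Lambda>"
  shows "\<exists>C>0. weighted_ci \<alpha> (two_over p) p \<Lambda> C"
proof -
  define V where "V = fock_space \<alpha> p"
  define W where "W = lp_space \<Lambda> p"
  define R where "R = restriction_op \<alpha> p \<Lambda>"
  let ?w = "wt \<alpha> (two_over p)"
  have bij: "bij_betw R V W" using ci by (simp add: complete_interpolating_def isomorphism_between_def V_def W_def R_def)
  obtain C1 where C1: "\<And>f. f \<in> V \<Longrightarrow> lp_norm \<Lambda> p (R f) \<le> ennreal C1 * fock_norm \<alpha> p f"
    using ci unfolding complete_interpolating_def isomorphism_between_def bounded_map_on_def V_def W_def R_def by blast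
  obtain C2 where C2: "\<And>b. b \<in> W \<Longrightarrow> fock_norm \<alpha> p (inv_into V R b) \<le> ennreal C2 * lp_norm \<Lambda> p b"
    using ci unfolding complete_interpolating_def isomorphism_between_def bounded_map_on_def V_def W_def R_def by blast
  \<comment> \<open>The constants in \<open>bounded_map_on\<close> are arbitrary reals, possibly
    negative; taking the maximum with 1 makes the common constant positive.\<close>
  define C where "C = max 1 (max C1 C2)"
  have C: "0 < C" "C1 \<le> C" "C2 \<le> C" by (auto simp: C_def)
  have le: "ennreal c * x \<le> ennreal (C * K)" if "c \<le> C" "x \<le> ennreal K" for c x K
    using mult_mono[OF ennreal_leI[OF that(1)] that(2)] C(1) by (simp add: ennreal_mult')
  have "weighted_ci \<alpha> (two_over p) p \<Lambda> C"
    unfolding weighted_ci_def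
  proof (intro conjI allI impI)
    fix f K assume f: "holo f" "0 \<le> K" "Cbound p (\<lambda>z. norm (f z) * ?w z) K"
    let ?f = "\<lambda>z. if z = 0 then 0 else f z"
    have *: "?f \<in> V" "fock_norm \<alpha> p ?f \<le> ennreal K" using fock_spaceI[OF p f(2,1,3)] by (auto simp: V_def)
    have "lp_norm \<Lambda> p (R ?f) \<le> ennreal (C * K)"
      by (rule order_trans[OF C1[OF *(1)] le[OF C(2) *(2)]])
    then have "Dbound \<Lambda> p (\<lambda>z. norm (?f z) * ?w z) (C * K)"
      using p C f(2) by (simp only: R_def lp_norm_le_iff restriction_Dbound[OF sub] mult_nonneg_nonneg less_imp_le)
    then show "Dbound \<Lambda> p (\<lambda>z. norm (f z) * ?w z) (C * K)"
      by (rule Dbound_cong[THEN iffD1, rotated]) (use sub in auto)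
  next
    fix a :: "complex \<Rightarrow> complex" and K assume a: "0 \<le> K" "Dbound \<Lambda> p (\<lambda>z. norm (a z) * ?w z) K"
    have n: "lp_norm \<Lambda> p (R a) \<le> ennreal K"
      using a p by (simp only: R_def lp_norm_le_iff restriction_Dbound[OF sub])
    have "R a \<in> W" using le_less_trans[OF n] by (auto simp: W_def lp_space_def R_def restriction_op_def)
    define f where "f = inv_into V R (R a)"
    have fV: "f \<in> V" and Rf: "R f = R a"
      using bij \<open>R a \<in> W\<close> unfolding f_def by (auto simp: bij_betw_def inv_into_into f_inv_into_f)
    have "fock_norm \<alpha> p f \<le> ennreal (C * K)"
      unfolding f_def by (rule order_trans[OF C2[OF \<open>R a \<in> W\<close>] le[OF C(3) n]])
    moreover have h: "holo f" "f 0 = 0" using fV by (auto simp: V_def fock_space_def)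
    ultimately have "Cbound p (\<lambda>z. norm (f z) * ?w z) (C * K)"
      using fock_norm_le_iff[OF p _ h, of "C * K" \<alpha>] C(1) a(1) by simp
    moreover have "\<forall>z\<in>\<Lambda>. f z = a z" using Rf restriction_eq_iff[OF sub] by (simp add: R_def)
    ultimately show "\<exists>f. holo f \<and> (\<forall>z\<in>\<Lambda>. f z = a z) \<and> Cbound p (\<lambda>z. norm (f z) * ?w z) (C * K)"
      using h by blast
  next
    fix f K z assume f: "holo f" "0 \<le> K" "Cbound p (\<lambda>z. norm (f z) * ?w z) K" "\<forall>z\<in>\<Lambda>. f z = 0"
      and z: "z \<noteq> (0::complex)"
    let ?f = "\<lambda>z. if z = 0 then 0 else f z"
    have "?f \<in> V" using fock_spaceI[OF p f(2,1,3)] by (auto simp: V_def)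
    moreover have "(\<lambda>z. if z = 0 then 0 else 0) \<in> V"
      unfolding V_def by (rule fock_spaceI(1)[OF p order_refl]) (use p in \<open>auto intro: Cbound_0[simplified]\<close>)
    moreover have "R ?f = R (\<lambda>z. if z = 0 then 0 else 0)"
      unfolding R_def restriction_eq_iff[OF sub] using f(4) by auto
    ultimately have "?f = (\<lambda>z. if z = 0 then 0 else 0)"
      using bij unfolding bij_betw_def inj_on_def by blast
    then show "f z = 0" using z by (metis (full_types))
  qed
  then show ?thesis using C(1) by blast
qed

lemma weighted_imp_complete_interpolating:
  assumes p: "0 < p" and sub: "\<Lambda> \<subseteq> punctured_plane" and C: "0 < C" and ci: "weighted_ci \<alpha> (two_over p) p \<Lambda> C"
  shows "complete_interpolating \<alpha> p \<Lambda>"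
proof -
  define V where "V = fock_space \<alpha> p"
  define W where "W = lp_space \<Lambda> p"
  define R where "R = restriction_op \<alpha> p \<Lambda>"
  let ?w = "wt \<alpha> (two_over p)"
  have holV: "holo f" "f 0 = 0" if "f \<in> V" for f
    using that by (auto simp: V_def fock_space_def)
  have bV: "Cbound p (\<lambda>z. norm (f z) * ?w z) (enn2real (fock_norm \<alpha> p f))" if "f \<in> V" for f
    using fock_norm_finite[of f \<alpha> p] that fock_norm_le_iff[OF p _ holV[OF that], of "enn2real (fock_norm \<alpha> p f)" \<alpha>]
    by (simp add: V_def)
  have RW: "R f \<in> W" and Rb: "lp_norm \<Lambda> p (R f) \<le> ennreal C * fock_norm \<alpha> p f" if "f \<in> V" for f
  proof -
    let ?K = "enn2real (fock_norm \<alpha> p f)"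
    have "Dbound \<Lambda> p (\<lambda>z. norm (f z) * ?w z) (C * ?K)"
      by (rule weighted_ci_bounded[OF ci holV(1)[OF that] _ bV[OF that]]) simp
    then have n: "lp_norm \<Lambda> p (R f) \<le> ennreal (C * ?K)"
      using p C by (simp add: R_def lp_norm_le_iff restriction_Dbound[OF sub])
    then show "R f \<in> W" using le_less_trans[OF n] by (auto simp: W_def lp_space_def R_def restriction_op_def)
    show "lp_norm \<Lambda> p (R f) \<le> ennreal C * fock_norm \<alpha> p f"
      using n fock_norm_finite[of f \<alpha> p] that C by (simp add: V_def ennreal_mult')
  qed
  have inj: "inj_on R V"
  proof (rule inj_onI)
    fix f g assume fg: "f \<in> V" "g \<in> V" "R f = R g"
    define d where "d = (\<lambda>z. f z - g z)"
    have d: "holo d"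
      unfolding d_def using holV fg by (intro holomorphic_intros)
    obtain K where K: "0 \<le> K" "Cbound p (\<lambda>z. norm (f z) * ?w z + norm (g z) * ?w z) K"
      using Lbound_add[OF AE_haar _ _ _ _ bV[OF fg(1)] bV[OF fg(2)] p] holo_wt_measurable[OF holV(1)[OF fg(1)]]
        holo_wt_measurable[OF holV(1)[OF fg(2)]] by auto
    have dK: "Cbound p (\<lambda>z. norm (d z) * ?w z) K"
    proof (rule Lbound_mono[OF AE_haar _ _ K(2) order_refl K(1)])
      fix z
      show "norm (d z) * ?w z \<le> norm (f z) * ?w z + norm (g z) * ?w z"
        unfolding d_def distrib_right[symmetric] by (intro mult_right_mono norm_triangle_ineq4) auto
    qed auto
    have d0: "d z = 0" if "z \<in> \<Lambda>" for z
      using fg(3) restriction_eq_iff[OF sub, of \<alpha> p f g] that by (simp add: R_def d_def)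
    have "d z = 0" if "z \<noteq> 0" for z
      by (rule weighted_ci_unique[OF ci d K(1) dK d0 that])
    then have "f z = g z" for z
      using holV(2)[OF fg(1)] holV(2)[OF fg(2)] by (cases "z = 0") (auto simp: d_def)
    then show "f = g" by blast
  qed
  have surj: "\<exists>f\<in>V. R f = b \<and> fock_norm \<alpha> p f \<le> ennreal C * lp_norm \<Lambda> p b" if b: "b \<in> W" for b
  proof -
    define K where "K = enn2real (lp_norm \<Lambda> p b)"
    have bK: "lp_norm \<Lambda> p b = ennreal K" using b by (simp add: K_def W_def lp_space_def)
    have K: "0 \<le> K" by (simp add: K_def)
    define a where "a = (\<lambda>z. b z / of_real (?w z))"
    have aw: "a z * of_real (?w z) = b z" if "z \<in> \<Lambda>" for z
    proof -
      have "z \<noteq> 0" using that sub by auto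
      then show ?thesis using wt_pos[of z \<alpha> "two_over p"] by (simp add: a_def)
    qed
    have "Dbound \<Lambda> p (\<lambda>z. norm (b z)) K"
      using lp_norm_le_iff[OF p K, of \<Lambda> b] bK by simp
    then have "Dbound \<Lambda> p (\<lambda>z. norm (a z) * ?w z) K"
    proof (rule Dbound_cong[THEN iffD1, rotated])
      fix z assume z: "z \<in> \<Lambda>"
      show "norm (b z) = norm (a z) * ?w z" unfolding aw[OF z, symmetric] by (simp add: norm_mult)
    qed
    then obtain f where f: "holo f" "\<forall>z\<in>\<Lambda>. f z = a z" "Cbound p (\<lambda>z. norm (f z) * ?w z) (C * K)"
      by (rule weighted_ci_interpolate[OF ci K])
    let ?f = "\<lambda>z. if z = 0 then 0 else f z"
    have *: "?f \<in> V" "fock_norm \<alpha> p ?f \<le> ennreal (C * K)"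
      using fock_spaceI[OF p _ f(1,3)] C K by (auto simp: V_def)
    have "R ?f = b"
    proof
      fix z
      show "R ?f z = b z"
      proof (cases "z \<in> \<Lambda>")
        case True
        then have "z \<noteq> 0" using sub by auto
        then show ?thesis using True f(2) aw[OF True] by (simp add: R_def restriction_op_def wt_def)
      next
        case False
        then show ?thesis using b by (simp add: R_def restriction_op_def W_def lp_space_def)
      qed
    qed
    then show ?thesis using * bK C by (intro bexI[of _ ?f]) (auto simp: ennreal_mult')
  qed
  have "bij_betw R V W"
    unfolding bij_betw_def using inj RW surj by blast
  moreover have "linear_map_on V R"
    unfolding linear_map_on_def R_def restriction_op_def by (auto simp: fun_eq_iff algebra_simps)
  moreover have "bounded_map_on V (fock_norm \<alpha> p) (lp_norm \<Lambda> p) R"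
    unfolding bounded_map_on_def using Rb by blast
  moreover have "bounded_map_on W (lp_norm \<Lambda> p) (fock_norm \<alpha> p) (inv_into V R)"
    unfolding bounded_map_on_def
  proof (intro exI[of _ C] ballI)
    fix b assume "b \<in> W"
    then obtain f where f: "f \<in> V" "R f = b" "fock_norm \<alpha> p f \<le> ennreal C * lp_norm \<Lambda> p b" using surj by blast
    then show "fock_norm \<alpha> p (inv_into V R b) \<le> ennreal C * lp_norm \<Lambda> p b"
      using inv_into_f_f[OF inj f(1)] by simp
  qed
  ultimately show ?thesis
    unfolding complete_interpolating_def isomorphism_between_def V_def W_def R_def by blast
qed

text \<open>The powers \<open>z powi n\<close> are single-valued, holomorphic and zero-free on the
  punctured plane for integers \<open>n\<close>; this is where integrality of
  \<open>2/p - 2/q\<close> enters.\<close>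

lemma weighted_ci_shift:
  assumes sub: "\<Lambda> \<subseteq> punctured_plane" and ci: "weighted_ci \<alpha> \<beta> p \<Lambda> C"
  shows "weighted_ci \<alpha> (\<beta> + of_int n) p \<Lambda> C"
proof -
  define m where "m = (\<lambda>k f z. f z * z powi k :: complex)"
  have hol: "m k f holomorphic_on punctured_plane" if "holo f" for k f
    unfolding m_def using that by (intro holomorphic_intros) auto
  have eq: "norm (f z) * wt \<alpha> (\<beta> + of_int n) z = norm (m n f z) * wt \<alpha> \<beta> z" for f z
    by (cases "z = 0") (auto simp: m_def wt_add norm_mult norm_power_int powr_real_of_int')
  have m1: "f z = m (-n) (m n f) z" "f z = m n (m (-n) f) z" if "z \<noteq> 0" for f z
    using that by (auto simp: m_def power_int_minus)
  show ?thesis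
    unfolding weighted_ci_def eq
  proof (intro conjI allI impI)
    fix f K assume "holo f" "0 \<le> K" "Cbound p (\<lambda>z. norm (m n f z) * wt \<alpha> \<beta> z) K"
    then show "Dbound \<Lambda> p (\<lambda>z. norm (m n f z) * wt \<alpha> \<beta> z) (C * K)"
      by (intro weighted_ci_bounded[OF ci] hol)
  next
    fix a K assume "0 \<le> K" "Dbound \<Lambda> p (\<lambda>z. norm (m n a z) * wt \<alpha> \<beta> z) K"
    then obtain F where F: "holo F" "\<forall>z\<in>\<Lambda>. F z = m n a z"
        "Fbound \<alpha> \<beta> p F (C * K)"
      by (rule weighted_ci_interpolate[OF ci, where a = "m n a"])
    have "m (-n) F z = a z" if "z \<in> \<Lambda>" for z
    proof -
      have "z \<noteq> 0" using that sub by auto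
      then show ?thesis using F(2) that m1(1)[of z a] by (simp add: m_def)
    qed
    moreover have "Cbound p (\<lambda>z. norm (m n (m (-n) F) z) * wt \<alpha> \<beta> z) (C * K)"
      by (rule Cbound_cong[THEN iffD1, OF _ F(3)]) (use m1(2) in auto)
    ultimately show "\<exists>f. holo f \<and> (\<forall>z\<in>\<Lambda>. f z = a z) \<and>
        Cbound p (\<lambda>z. norm (m n f z) * wt \<alpha> \<beta> z) (C * K)"
      using hol[OF F(1), of "-n"] by (intro exI[of _ "m (- n) F"]) simp
  next
    fix f K z assume *: "holo f" "0 \<le> K" "Cbound p (\<lambda>z. norm (m n f z) * wt \<alpha> \<beta> z) K"
      "\<forall>z\<in>\<Lambda>. f z = 0" and z: "z \<noteq> (0::complex)"
    have "m n f z = 0" if "z \<in> \<Lambda>" for z using *(4) that by (simp add: m_def)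
    then have "m n f z = 0" by (rule weighted_ci_unique[OF ci hol[OF *(1)] *(2,3) _ z])
    then show "f z = 0" using z by (simp add: m_def)
  qed
qed

subsection \<open>Interpolation kernels\<close>

locale interpolating =
  fixes \<alpha> \<beta> :: real and p :: ennreal and \<Lambda> :: "complex set" and C :: real
  assumes alpha: "0 < \<alpha>" and p: "0 < p" and sub: "\<Lambda> \<subseteq> punctured_plane" and C: "0 < C"
    and ci: "weighted_ci \<alpha> \<beta> p \<Lambda> C"
begin

abbreviation w :: "complex \<Rightarrow> real" where "w \<equiv> wt \<alpha> \<beta>"

definition inG :: "(complex \<Rightarrow> complex) \<Rightarrow> bool" where
  "inG f \<longleftrightarrow> holo f \<and> (\<exists>K\<ge>0. Fbound \<alpha> \<beta> p f K)"

lemma unique: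
  assumes "inG f" "\<And>z. z \<in> \<Lambda> \<Longrightarrow> f z = 0" "z \<noteq> 0"
  shows "f z = 0"
proof -
  obtain K where "holo f" "0 \<le> K" "Fbound \<alpha> \<beta> p f K"
    using assms(1) by (auto simp: inG_def)
  then show ?thesis by (rule weighted_ci_unique[OF ci _ _ _ assms(2,3)])
qed

lemma inG_lin:
  assumes "inG f" "inG g"
  shows "inG (\<lambda>z. a * f z + b * g z)"
proof -
  obtain K K' where K: "0 \<le> K" "Fbound \<alpha> \<beta> p f K" "0 \<le> K'" "Fbound \<alpha> \<beta> p g K'"
    using assms by (auto simp: inG_def)
  have hf: "holo f" and hg: "holo g"
    using assms by (auto simp: inG_def)
  note mf = holo_wt_measurable[OF hf, of \<alpha> \<beta>] and mg = holo_wt_measurable[OF hg, of \<alpha> \<beta>]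
  have 1: "Cbound p (\<lambda>z. norm a * (norm (f z) * w z)) (norm a * K)"
    by (rule Lbound_scale[OF AE_haar _ _ _ K(1,2)]) (use mf in simp_all)
  have 2: "Cbound p (\<lambda>z. norm b * (norm (g z) * w z)) (norm b * K')"
    by (rule Lbound_scale[OF AE_haar _ _ _ K(3,4)]) (use mg in simp_all)
  obtain K'' where K'': "0 \<le> K''" "Cbound p (\<lambda>z. norm a * (norm (f z) * w z) + norm b * (norm (g z) * w z)) K''"
    using Lbound_add[OF AE_haar _ _ _ _ 1 2 p] mf mg K by auto
  have "Cbound p (\<lambda>z. norm (a * f z + b * g z) * w z) K''"
  proof (rule Lbound_mono[OF AE_haar _ _ K''(2) order_refl K''(1)])
    fix z
    have "norm (a * f z + b * g z) * w z \<le> (norm a * norm (f z) + norm b * norm (g z)) * w z"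
      by (intro mult_right_mono order_trans[OF norm_triangle_ineq]) (auto simp: norm_mult)
    then show "norm (a * f z + b * g z) * w z \<le> norm a * (norm (f z) * w z) + norm b * (norm (g z) * w z)"
      by (simp add: algebra_simps)
  qed auto
  moreover have "(\<lambda>z. a * f z + b * g z) holomorphic_on punctured_plane"
    using hf hg by (intro holomorphic_intros)
  ultimately show ?thesis using K''(1) by (auto simp: inG_def)
qed

lemma inG_0: "inG (\<lambda>z. 0)"
  using Cbound_0[OF p, of \<alpha> \<beta>] by (auto simp: inG_def intro!: exI[of _ 0])

lemma inG_sum:
  assumes "finite F" "\<And>l. l \<in> F \<Longrightarrow> inG (f l)"
  shows "inG (\<lambda>z. \<Sum>l\<in>F. a l * f l z)"
  using assms
proof (induction F)
  case (insert x F)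
  then show ?case using inG_lin[of "f x" "\<lambda>z. \<Sum>l\<in>F. a l * f l z" "a x" 1] by simp
qed (simp add: inG_0)

text \<open>Interpolating the samples of \<open>f\<close> with control produces a function that
  agrees with \<open>f\<close> on \<open>\<Lambda>\<close>, hence off the origin by uniqueness; its
  bound is thus a bound for \<open>f\<close>.\<close>

lemma bounded_below:
  assumes "inG f" "0 \<le> K" "Sbound \<alpha> \<beta> \<Lambda> p f K"
  shows "Fbound \<alpha> \<beta> p f (C * K)"
proof -
  obtain g where g: "holo g" "\<forall>z\<in>\<Lambda>. g z = f z" "Fbound \<alpha> \<beta> p g (C * K)"
    by (rule weighted_ci_interpolate[OF ci assms(2,3)])
  have "inG g" using g C assms(2) by (auto simp: inG_def intro!: exI[of _ "C * K"])
  then have gf: "inG (\<lambda>z. 1 * g z + (- 1) * f z)" using assms(1) by (rule inG_lin)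
  have "1 * g z + (- 1) * f z = 0" if "z \<noteq> 0" for z
    by (rule unique[OF gf _ that]) (use g(2) in simp)
  then show ?thesis by (intro Cbound_cong[THEN iffD1, OF _ g(3)]) auto
qed

text \<open>The value \<open>1 / w l\<close> makes the weighted modulus equal to one at
  \<open>l\<close>. Uniqueness determines the function off the origin, so the choice operator only
  picks a representative.\<close>

definition ker :: "complex \<Rightarrow> complex \<Rightarrow> complex" where
  "ker l = (SOME f. holo f \<and>
      (\<forall>z\<in>\<Lambda>. f z = (if z = l then of_real (1 / w l) else 0)) \<and> Fbound \<alpha> \<beta> p f C)"

lemma ker_props:
  assumes l: "l \<in> \<Lambda>"
  shows "holo (ker l) \<and>
      (\<forall>z\<in>\<Lambda>. ker l z = (if z = l then of_real (1 / w l) else 0)) \<and> Cbound p (\<lambda>z. norm (ker l z) * w z) C"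
proof -
  have wl: "0 < w l" using l sub by (intro wt_pos) auto
  have "Dbound \<Lambda> p (\<lambda>z. if z = l then 1 else 0) 1"
  proof (cases "p = \<infinity>")
    case False
    have "(\<integral>\<^sup>+ z. ennreal ((if z = l then 1 else 0) powr enn2real p) \<partial>count_space \<Lambda>) = (\<integral>\<^sup>+ z. indicator {l} z \<partial>count_space \<Lambda>)"
      by (intro nn_integral_cong) (auto simp: indicator_def)
    also have "\<dots> = 1" using l by (subst nn_integral_indicator) auto
    finally show ?thesis using False by (simp add: Lbound_def)
  qed (simp add: Lbound_def)
  then have "Dbound \<Lambda> p (\<lambda>z. norm (if z = l then of_real (1 / w l) else 0 :: complex) * w z) 1"
    by (rule Dbound_cong[THEN iffD1, rotated]) (use wl in \<open>auto simp: norm_divide\<close>)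
  then obtain f where "holo f"
      "\<forall>z\<in>\<Lambda>. f z = (if z = l then of_real (1 / w l) else 0)" "Fbound \<alpha> \<beta> p f (C * 1)"
    by (rule weighted_ci_interpolate[OF ci zero_le_one])
  then have ex: "\<exists>f. holo f \<and>
      (\<forall>z\<in>\<Lambda>. f z = (if z = l then of_real (1 / w l) else 0)) \<and> Fbound \<alpha> \<beta> p f C"
    by (intro exI[of _ f]) simp
  show ?thesis unfolding ker_def by (rule someI_ex[OF ex])
qed

lemma ker_holo: "l \<in> \<Lambda> \<Longrightarrow> holo (ker l)"
  using ker_props by blast

lemma ker_off: "l \<in> \<Lambda> \<Longrightarrow> m \<in> \<Lambda> \<Longrightarrow> m \<noteq> l \<Longrightarrow> ker l m = 0"
  using ker_props by auto

lemma w_pos: "l \<in> \<Lambda> \<Longrightarrow> 0 < w l"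
  using sub by (intro wt_pos) auto

abbreviation kw :: "complex \<Rightarrow> complex \<Rightarrow> real" where
  "kw l z \<equiv> norm (ker l z) * w z"

lemma ker_diag: "l \<in> \<Lambda> \<Longrightarrow> kw l l = 1" "l \<in> \<Lambda> \<Longrightarrow> ker l l \<noteq> 0"
  using ker_props[of l] w_pos[of l] by (auto simp: norm_divide)

lemma ker_Cbound: "l \<in> \<Lambda> \<Longrightarrow> Cbound p (\<lambda>z. kw l z) C"
  using ker_props by blast

lemma ker_inG: "l \<in> \<Lambda> \<Longrightarrow> inG (ker l)"
  using ker_holo ker_Cbound C by (auto simp: inG_def intro!: exI[of _ C])

section \<open>Size of the kernels and distribution of the nodes\<close>

lemma ker_sup: "\<exists>C0>0. \<forall>l\<in>\<Lambda>. \<forall>z. z \<noteq> 0 \<longrightarrow> kw l z \<le> C0"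
proof -
  obtain C1 where C1: "0 < C1" "\<And>f K. holo f \<Longrightarrow> 0 \<le> K \<Longrightarrow>
    Fbound \<alpha> \<beta> p f K \<Longrightarrow> (\<forall>z. z \<noteq> 0 \<longrightarrow> norm (f z) * w z \<le> C1 * K)"
    using Cbound_pointwise[OF alpha p, of \<beta>] by blast
  then have "\<forall>l\<in>\<Lambda>. \<forall>z. z \<noteq> 0 \<longrightarrow> kw l z \<le> C1 * C"
    using ker_holo ker_Cbound C by (meson less_imp_le)
  moreover have "0 < C1 * C" using C1 C by simp
  ultimately show ?thesis by blast
qed

text \<open>For fixed \<open>z\<close>, coefficients of modulus at most one align the phases of the
  kernels at \<open>z\<close>. The combination has weighted samples bounded by 1, so
  \<open>bounded_below\<close> bounds it at \<open>z\<close>, where it equals the sum of the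
  moduli.\<close>

lemma sum_ker:
  assumes "p = \<infinity>" "finite F" "F \<subseteq> \<Lambda>" "z \<noteq> 0"
  shows "(\<Sum>l\<in>F. kw l z) \<le> C"
proof -
  define \<theta> where "\<theta> = (\<lambda>l. cnj (sgn (ker l z)))"
  have \<theta>: "\<theta> l * ker l z = of_real (norm (ker l z))" "norm (\<theta> l) \<le> 1" for l
  proof -
    have "\<theta> l * ker l z = (ker l z * cnj (ker l z)) / of_real (norm (ker l z))"
      by (simp add: \<theta>_def sgn_eq)
    also have "\<dots> = of_real (norm (ker l z))"
      by (simp add: complex_norm_square[symmetric] power2_eq_square)
    finally show "\<theta> l * ker l z = of_real (norm (ker l z))" .
    show "norm (\<theta> l) \<le> 1" by (simp add: \<theta>_def norm_sgn)
  qed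
  define f where "f = (\<lambda>z. \<Sum>l\<in>F. \<theta> l * ker l z)"
  have fG: "inG f" unfolding f_def using assms ker_inG by (intro inG_sum) auto
  have "norm (f m) * w m \<le> 1" if m: "m \<in> \<Lambda>" for m
  proof -
    have "f m = (\<Sum>l\<in>F. if l = m then \<theta> m * ker m m else 0)"
      unfolding f_def using assms m ker_off by (intro sum.cong) auto
    also have "\<dots> = (if m \<in> F then \<theta> m * ker m m else 0)" using assms by simp
    finally have "norm (f m) \<le> norm (ker m m)"
      using \<theta>(2)[of m] by (auto simp: norm_mult mult_left_le_one_le)
    then have "norm (f m) * w m \<le> kw m m" by (intro mult_right_mono) auto
    then show ?thesis using ker_diag(1)[OF m] by simp
  qed
  then have "Sbound \<alpha> \<beta> \<Lambda> p f 1" using assms(1) by (simp add: Lbound_def)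
  then have "Fbound \<alpha> \<beta> p f (C * 1)" by (intro bounded_below fG) auto
  then have "norm (f z) * w z \<le> C" using assms by (auto simp: Lbound_def)
  moreover have "norm (f z) = (\<Sum>l\<in>F. norm (ker l z))"
  proof -
    have fz: "f z = of_real (\<Sum>l\<in>F. norm (ker l z))" by (simp add: f_def \<theta>)
    have "0 \<le> (\<Sum>l\<in>F. norm (ker l z))" by (intro sum_nonneg) auto
    then show ?thesis by (simp only: fz norm_of_real abs_of_nonneg)
  qed
  ultimately show ?thesis by (simp add: sum_distrib_right)
qed

text \<open>The kernel at \<open>l\<close> vanishes at \<open>m\<close>. Dividing out this zero and
  evaluating at \<open>l\<close>, where the weighted modulus is one, bounds
  \<open>norm l + norm m\<close> by a multiple of \<open>norm (l - m)\<close>.\<close>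

lemma separation: "\<exists>r. separated r \<Lambda>"
proof -
  obtain C0 where C0: "0 < C0" "\<And>l z. l \<in> \<Lambda> \<Longrightarrow> z \<noteq> 0 \<Longrightarrow> kw l z \<le> C0"
    using ker_sup by blast
  obtain C2 where C2: "0 < C2" "\<And>h a K. holo h \<Longrightarrow> a \<noteq> 0 \<Longrightarrow>
    (\<forall>z. z \<noteq> 0 \<longrightarrow> norm ((z - a) * h z) * w z \<le> K) \<Longrightarrow>
    (\<forall>z. z \<noteq> 0 \<longrightarrow> norm (h z) * w z \<le> C2 * K / (norm z + norm a))"
    using division_bound[OF alpha, of \<beta>] by blast
  define r where "r = min 1 (1 / (C2 * C0))"
  have r: "0 < r" "r \<le> 1" "r \<le> 1 / (C2 * C0)" using C2 C0 by (auto simp: r_def)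
  have "r * norm l \<le> norm (l - m)" if lm: "l \<in> \<Lambda>" "m \<in> \<Lambda>" "l \<noteq> m" for l m
  proof -
    have nz: "l \<noteq> 0" "m \<noteq> 0" using lm sub by auto
    have pos: "0 < norm l + norm m" using nz by (simp add: add_pos_nonneg)
    obtain h where h: "holo h" "\<And>z. ker l z = (z - m) * h z"
      using holo_divide_zero[OF ker_holo[OF lm(1)] ker_off[OF lm(1,2)]] lm(3) by metis
    have "\<forall>z. z \<noteq> 0 \<longrightarrow> norm ((z - m) * h z) * w z \<le> C0" using C0(2)[OF lm(1)] h(2) by simp
    then have hl: "norm (h l) * w l \<le> C2 * C0 / (norm l + norm m)" using C2(2)[OF h(1) nz(2)] nz(1) by blast
    have "1 = norm (l - m) * (norm (h l) * w l)"
      using ker_diag(1)[OF lm(1)] unfolding h(2)[of l] norm_mult by simp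
    also have "\<dots> \<le> norm (l - m) * (C2 * C0 / (norm l + norm m))" by (intro mult_left_mono hl) auto
    finally have "norm l + norm m \<le> norm (l - m) * (C2 * C0)" using pos by (simp add: field_simps)
    then have "norm l \<le> norm (l - m) * (C2 * C0)" using norm_ge_zero[of m] by linarith
    then have "1 / (C2 * C0) * norm l \<le> norm (l - m)" using C2 C0 by (simp add: field_simps)
    moreover have "r * norm l \<le> 1 / (C2 * C0) * norm l" by (intro mult_right_mono r) auto
    ultimately show ?thesis by linarith
  qed
  then have "separated r \<Lambda>" using r sub by unfold_locales (auto simp: log_separated_def)
  then show ?thesis by blast
qed

text \<open>Testing the lower bound on the monomials \<open>z\<^sup>n\<close>, whose weighted modulus is a Gaussian in \<open>ln \<bar>z\<bar>\<close>
  centred at \<open>(n + \<beta>) / (2 \<alpha>)\<close>.\<close>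

lemma log_dense: "\<exists>L>0. \<forall>t. \<exists>l\<in>\<Lambda>. \<bar>lg l - t\<bar> \<le> L"
proof -
  obtain r where "separated r \<Lambda>" using separation by blast
  then interpret separated r \<Lambda> .
  obtain C1 where C1: "0 < C1" "\<And>f K. holo f \<Longrightarrow> 0 \<le> K \<Longrightarrow>
    Fbound \<alpha> \<beta> p f K \<Longrightarrow> (\<forall>z. z \<noteq> 0 \<longrightarrow> norm (f z) * w z \<le> C1 * K)"
    using Cbound_pointwise[OF alpha p, of \<beta>] by blast
  obtain C3 where C3: "0 < C3" "\<And>s. Dbound \<Lambda> p (\<lambda>z. exp (- 1 * \<bar>lg z - s\<bar>)) C3"
    using Dbound_exp[OF zero_less_one p] by blast
  obtain C4 where C4: "0 < C4" "\<And>s. Cbound p (\<lambda>z. exp (- 1 * \<bar>lg z - s\<bar>)) C4"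
    using Cbound_exp[OF zero_less_one p] by blast
  define D where "D = exp (1 / \<alpha>)"
  have D: "0 < D" by (simp add: D_def)
  \<comment> \<open>Completing the square gives
    \<open>\<alpha> * x\<^sup>2 \<ge> 2 * \<bar>x\<bar> - 1 / \<alpha>\<close>. Of the two
    exponential factors, one is spent on the gap \<open>L\<close> and the other remains for
    summation over the nodes.\<close>
  have gauss: "exp (- \<alpha> * x\<^sup>2) \<le> D * exp (- \<bar>x\<bar>) * exp (- \<bar>x\<bar>)" for x
  proof -
    have "0 \<le> (\<alpha> * \<bar>x\<bar> - 1)\<^sup>2 / \<alpha>" using alpha by simp
    also have "\<dots> = \<alpha> * x\<^sup>2 - 2 * \<bar>x\<bar> + 1 / \<alpha>" using alpha by (simp add: power2_eq_square field_simps)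
    finally show ?thesis by (simp add: D_def flip: exp_add)
  qed
  \<comment> \<open>The product of all constants met on the way from the samples back to the value
    at the peak. If no node came within \<open>L\<close> of a centre, the peak value 1 would be at
    most \<open>Q * exp (- L)\<close>.\<close>
  define Q where "Q = C1 * (C * (D * C3))"
  have Q: "0 < Q" using C1 C D C3 by (simp add: Q_def)
  define L where "L = \<bar>ln Q\<bar> + 1"
  have QL: "Q * exp (- L) < 1"
  proof -
    have "Q * exp (- L) = exp (ln Q - L)" using Q by (simp add: exp_diff exp_minus field_simps)
    also have "\<dots> < 1" by (simp add: L_def)
    finally show ?thesis .
  qed
  have near: "\<exists>l\<in>\<Lambda>. \<bar>lg l - (of_int n + \<beta>) / (2 * \<alpha>)\<bar> < L" for n :: int
  proof (rule ccontr)
    define \<tau> where "\<tau> = (of_int n + \<beta>) / (2 * \<alpha>)"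
    assume "\<not> (\<exists>l\<in>\<Lambda>. \<bar>lg l - (of_int n + \<beta>) / (2 * \<alpha>)\<bar> < L)"
    then have far: "L \<le> \<bar>lg l - \<tau>\<bar>" if "l \<in> \<Lambda>" for l using that by (force simp: \<tau>_def)
    define f where "f = (\<lambda>z. of_real (exp (- \<alpha> * \<tau>\<^sup>2)) * z powi n :: complex)"
    have hol: "holo f" unfolding f_def by (intro holomorphic_intros) auto
    have fw: "norm (f z) * w z = exp (- \<alpha> * (lg z - \<tau>)\<^sup>2)" if z: "z \<noteq> 0" for z
    proof -
      have "norm (f z) = exp (- \<alpha> * \<tau>\<^sup>2) * exp (of_int n * lg z)"
        using z by (simp add: f_def norm_mult norm_power_int powr_real_of_int'[symmetric] powr_def)
      moreover have "of_int n = 2 * \<alpha> * \<tau> - \<beta>" using alpha by (simp add: \<tau>_def)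
      ultimately show ?thesis
        unfolding wt_exp[OF z] by (simp add: power2_eq_square algebra_simps flip: exp_add)
    qed
    have "Cbound p (\<lambda>z. D * exp (- 1 * \<bar>lg z - \<tau>\<bar>)) (D * C4)"
      by (rule Lbound_scale[OF AE_haar _ _ _ _ C4(2)]) (use C4(1) D in auto)
    then have "Fbound \<alpha> \<beta> p f (D * C4)"
    proof (rule Lbound_mono[OF AE_haar _ _ _ order_refl, rotated 2])
      show "0 \<le> D * C4" using D C4(1) by simp
      fix z :: complex assume "z \<in> punctured_plane"
      then have "norm (f z) * w z \<le> D * exp (- \<bar>lg z - \<tau>\<bar>) * exp (- \<bar>lg z - \<tau>\<bar>)"
        using gauss fw by simp
      also have "\<dots> \<le> D * exp (- \<bar>lg z - \<tau>\<bar>) * 1" using D by (intro mult_left_mono) auto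
      finally show "norm (f z) * w z \<le> D * exp (- 1 * \<bar>lg z - \<tau>\<bar>)" by simp
    qed simp
    then have fG: "inG f" using hol D C4(1) by (auto simp: inG_def intro!: exI[of _ "D * C4"])
    have DL: "0 \<le> D * exp (- L)" using D by simp
    have "Dbound \<Lambda> p (\<lambda>z. (D * exp (- L)) * exp (- 1 * \<bar>lg z - \<tau>\<bar>)) (D * exp (- L) * C3)"
      by (rule Lbound_scale[OF AE_count_space_mem _ _ DL _ C3(2)]) (use C3(1) in auto)
    then have "Sbound \<alpha> \<beta> \<Lambda> p f (D * exp (- L) * C3)"
    proof (rule Lbound_mono[OF AE_count_space_mem _ _ _ order_refl, rotated 2])
      show "0 \<le> D * exp (- L) * C3" using D C3(1) by simp
      fix z :: complex assume z: "z \<in> \<Lambda>"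
      then have nz: "z \<noteq> 0" using sub by auto
      have "norm (f z) * w z \<le> D * exp (- \<bar>lg z - \<tau>\<bar>) * exp (- \<bar>lg z - \<tau>\<bar>)"
        unfolding fw[OF nz] by (rule gauss)
      also have "\<dots> \<le> D * exp (- L) * exp (- \<bar>lg z - \<tau>\<bar>)"
        using D far[OF z] by (intro mult_right_mono mult_left_mono) auto
      finally show "norm (f z) * w z \<le> (D * exp (- L)) * exp (- 1 * \<bar>lg z - \<tau>\<bar>)" by simp
    qed simp
    then have cb: "Fbound \<alpha> \<beta> p f (C * (D * exp (- L) * C3))"
      using D C3(1) by (intro bounded_below fG) auto
    have K0: "0 \<le> C * (D * exp (- L) * C3)" using C D C3(1) by simp
    define z where "z = (of_real (exp \<tau>) :: complex)"
    have z: "z \<noteq> 0" "lg z = \<tau>" by (auto simp: z_def)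
    have "norm (f z) * w z \<le> C1 * (C * (D * exp (- L) * C3))"
      using C1(2)[OF hol K0 cb] z(1) by blast
    also have "\<dots> = Q * exp (- L)" by (simp add: Q_def)
    finally show False using QL fw[OF z(1)] z(2) by simp
  qed
  \<comment> \<open>The centres form a progression of step \<open>1 / (2 * \<alpha>)\<close>, so
    rounding \<open>t\<close> to a centre costs at most one step.\<close>
  have "\<exists>l\<in>\<Lambda>. \<bar>lg l - t\<bar> \<le> L + 1 / (2 * \<alpha>)" for t
  proof -
    define n where "n = \<lfloor>2 * \<alpha> * t - \<beta>\<rfloor>"
    obtain l where l: "l \<in> \<Lambda>" "\<bar>lg l - (of_int n + \<beta>) / (2 * \<alpha>)\<bar> < L" using near by blast
    have "\<bar>(of_int n + \<beta>) - 2 * \<alpha> * t\<bar> \<le> 1" unfolding n_def by linarith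
    then have "\<bar>(of_int n + \<beta>) - 2 * \<alpha> * t\<bar> / (2 * \<alpha>) \<le> 1 / (2 * \<alpha>)" using alpha by (intro divide_right_mono) auto
    moreover have "\<bar>(of_int n + \<beta>) / (2 * \<alpha>) - t\<bar> = \<bar>(of_int n + \<beta>) - 2 * \<alpha> * t\<bar> / (2 * \<alpha>)"
    proof -
      have "(of_int n + \<beta>) / (2 * \<alpha>) - t = ((of_int n + \<beta>) - 2 * \<alpha> * t) / (2 * \<alpha>)"
        using alpha by (simp add: field_simps)
      then show ?thesis using alpha by (simp add: abs_mult)
    qed
    ultimately have "\<bar>lg l - t\<bar> \<le> L + 1 / (2 * \<alpha>)" using l(2) by linarith
    then show ?thesis using l(1) by blast
  qed
  moreover have "0 < L + 1 / (2 * \<alpha>)" using alpha by (simp add: L_def add_pos_pos)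
  ultimately show ?thesis by blast
qed

text \<open>A zero can be moved from \<open>l\<close> to \<open>l0\<close> without leaving the
  space: \<open>(z - l0) / (z - l)\<close> times the kernel at \<open>l0\<close> vanishes on
  \<open>\<Lambda> - {l}\<close>, so by uniqueness it is a multiple of the kernel at
  \<open>l\<close>.\<close>

lemma generating_function:
  "\<exists>F c. holo F \<and>
     (\<forall>l\<in>\<Lambda>. c l \<noteq> 0 \<and> (\<forall>z. z \<noteq> 0 \<longrightarrow> F z = c l * ((z - l) * ker l z)))"
proof -
  obtain l0 where l0: "l0 \<in> \<Lambda>" using log_dense by blast
  then have l0nz: "l0 \<noteq> 0" using sub by auto
  define F where "F = (\<lambda>z. (z - l0) * ker l0 z)"
  have F: "holo F"
    unfolding F_def using ker_holo[OF l0] by (intro holomorphic_intros)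
  have "\<exists>c. c \<noteq> 0 \<and> (\<forall>z. z \<noteq> 0 \<longrightarrow> F z = c * ((z - l) * ker l z))" if l: "l \<in> \<Lambda>" for l
  proof (cases "l = l0")
    case True
    then show ?thesis by (intro exI[of _ 1]) (simp add: F_def)
  next
    case False
    have lnz: "l \<noteq> 0" using l sub by auto
    obtain h where h: "holo h" "\<And>z. ker l0 z = (z - l) * h z"
      using holo_divide_zero[OF ker_holo[OF l0] ker_off[OF l0 l False]] by metis
    have "inG h"
    proof -
      have cb: "Cbound p (\<lambda>z. norm ((z - l) * h z) * w z) C" using ker_Cbound[OF l0] by (simp only: h(2))
      show ?thesis using Cbound_divide[OF alpha p h(1) lnz less_imp_le[OF C] cb] h(1) by (simp add: inG_def)
    qed
    \<comment> \<open>Writing \<open>z - l0\<close> as \<open>(z - l) + (l - l0)\<close> exhibits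
      \<open>(z - l0) * h z\<close> as a combination of two members of the space, although
      multiplication by \<open>z\<close> alone need not preserve it.\<close>
    then have "inG (\<lambda>z. 1 * ker l0 z + (l - l0) * h z)" by (intro inG_lin ker_inG l0)
    moreover define q where "q = (\<lambda>z. (z - l0) * h z)"
    have "(\<lambda>z. 1 * ker l0 z + (l - l0) * h z) = q" by (auto simp: q_def h(2) algebra_simps)
    ultimately have qG: "inG q" by simp
    have q0: "q m = 0" if m: "m \<in> \<Lambda>" "m \<noteq> l" for m
    proof (cases "m = l0")
      case False
      then have "(m - l) * h m = 0" using ker_off[OF l0 m(1)] h(2) by simp
      then show ?thesis using m by (simp add: q_def)
    qed (simp add: q_def)
    define c where "c = q l / ker l l"
    have "inG (\<lambda>z. 1 * q z + (- c) * ker l z)" by (intro inG_lin qG ker_inG l)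
    then have "1 * q z + (- c) * ker l z = 0" if "z \<noteq> 0" for z
    proof (rule unique[OF _ _ that])
      fix m assume m: "m \<in> \<Lambda>"
      show "1 * q m + (- c) * ker l m = 0"
        using q0[OF m] ker_off[OF l m] ker_diag(2)[OF l] by (cases "m = l") (auto simp: c_def)
    qed
    then have qc: "q z = c * ker l z" if "z \<noteq> 0" for z using that by simp
    have "c \<noteq> 0"
    proof
      assume "c = 0"
      then have "h z = 0" if "z \<noteq> 0" "z \<noteq> l0" for z using qc[OF that(1)] that(2) by (simp add: q_def)
      then have "h l0 = 0" by (rule holo_zero_at[OF h(1) l0nz])
      then show False using h(2)[of l0] ker_diag(2)[OF l0] by simp
    qed
    moreover have "F z = c * ((z - l) * ker l z)" if "z \<noteq> 0" for z
    proof -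
      have "F z = (z - l) * q z" by (simp add: F_def h(2) q_def)
      then show ?thesis using qc[OF that] by simp
    qed
    ultimately show ?thesis by blast
  qed
  then show ?thesis using F by metis
qed

subsection \<open>Exponential decay of the kernels\<close>

text \<open>Treats both ends of the plane at once. Here \<open>\<rho>\<close> measures how far
  \<open>G\<close>, normalised by \<open>x l\<close>, is from the kernel at \<open>l\<close>; only
  its upper bound on the side beyond \<open>l\<close>, its lower bound one unit beyond, and its
  lower bound on a small circle around \<open>l\<close> matter. A vector of constants
  \<open>x\<close> is needed because \<open>G\<close> does not depend on the node.\<close>

lemma one_sided_decay:
  fixes \<tau> :: "complex \<Rightarrow> real" and \<rho> :: "complex \<Rightarrow> complex \<Rightarrow> real"
  assumes \<tau>: "\<tau> = (\<lambda>z. lg z) \<or> \<tau> = (\<lambda>z. - lg z)"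
    and G: "holo G"
    and x: "\<And>l. l \<in> \<Lambda> \<Longrightarrow> 0 < x l"
    and rel: "\<And>l z. l \<in> \<Lambda> \<Longrightarrow> z \<noteq> 0 \<Longrightarrow> norm (G z) * w z = kw l z * \<rho> l z * x l"
    and \<rho>2: "\<And>l z. l \<in> \<Lambda> \<Longrightarrow> z \<noteq> 0 \<Longrightarrow> \<tau> l \<le> \<tau> z \<Longrightarrow> \<rho> l z \<le> 2"
    and \<rho>1: "\<And>l z. l \<in> \<Lambda> \<Longrightarrow> z \<noteq> 0 \<Longrightarrow> \<tau> l + 1 \<le> \<tau> z \<Longrightarrow> 1/2 \<le> \<rho> l z"
    and \<rho>9: "\<And>l z. l \<in> \<Lambda> \<Longrightarrow> norm (z - l) = norm l / 8 \<Longrightarrow> 1/9 \<le> \<rho> l z"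
  shows "\<exists>D>0. \<exists>eps>0. \<forall>l\<in>\<Lambda>. \<forall>z. z \<noteq> 0 \<longrightarrow> \<tau> l + 1 \<le> \<tau> z \<longrightarrow> kw l z \<le> D * exp (- eps * (\<tau> z - \<tau> l))"
proof -
  define X where "X = (\<lambda>z. norm (G z) * wt \<alpha> \<beta> z)"
  have X0: "0 \<le> X z" for z by (simp add: X_def)
  have Xm: "X \<in> borel_measurable haar" unfolding X_def using holo_wt_measurable[OF G] by simp
  have \<tau>m: "\<tau> \<in> borel_measurable haar" using \<tau> by auto
  have \<tau>d: "\<bar>\<tau> z - \<tau> l\<bar> = \<bar>lg z - lg l\<bar>" for z l using \<tau> by auto
  obtain L where L: "0 < L" "\<And>t. \<exists>l\<in>\<Lambda>. \<bar>lg l - t\<bar> \<le> L" using log_dense by blast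
  have dense: "\<exists>l\<in>\<Lambda>. \<bar>\<tau> l - t\<bar> \<le> L" for t
    using \<tau>
  proof
    assume "\<tau> = (\<lambda>z. - lg z)"
    then show ?thesis using L(2)[of "- t"] by (auto simp: abs_minus_commute add.commute)
  qed (use L(2) in simp)
  have \<tau>near: "z \<noteq> 0 \<and> \<bar>\<tau> z - \<tau> l\<bar> < 1" if "l \<noteq> 0" "norm (z - l) \<le> norm l / 2" for z l
    using ln_norm_close[OF that] \<tau>d by auto
  obtain K where K: "1 \<le> K" and circ: "\<And>f a z. holo f \<Longrightarrow> a \<noteq> 0 \<Longrightarrow>
     z \<in> cball a (norm a / 8) \<Longrightarrow> \<exists>v\<in>sphere a (norm a / 8). norm (f z) * w z \<le> K * (norm (f v) * w v)"
    using sup_on_circle[OF alpha, of \<beta>] by blast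
  \<comment> \<open>\<open>G\<close> vanishes at \<open>l\<close>, so the normalisation of the
    kernel cannot be read off there. The maximum principle moves it to the circle of radius
    \<open>norm l / 8\<close>, where \<open>\<rho>\<close> is at least 1/9.\<close>
  have peak: "\<exists>v. norm (v - l) = norm l / 8 \<and> x l \<le> 9 * K * X v" if l: "l \<in> \<Lambda>" for l
  proof -
    have lnz: "l \<noteq> 0" using l sub by auto
    obtain v where v: "v \<in> sphere l (norm l / 8)" "kw l l \<le> K * (kw l v)"
      using circ[OF ker_holo[OF l] lnz, of l] by auto
    have d: "norm (v - l) = norm l / 8" using v(1) by (simp add: dist_norm norm_minus_commute)
    have vnz: "v \<noteq> 0" using d lnz by auto
    have 1: "1 \<le> K * (kw l v)" using v(2) ker_diag(1)[OF l] by simp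
    have "x l \<le> x l * (K * (kw l v))" using x[OF l] 1 by simp
    also have "\<dots> = 9 * K * (kw l v * (1/9) * x l)" by simp
    also have "\<dots> \<le> 9 * K * (kw l v * \<rho> l v * x l)"
      using K x[OF l] \<rho>9[OF l d] by (intro mult_left_mono mult_right_mono) auto
    also have "\<dots> = 9 * K * X v" by (simp only: X_def rel[OF l vnz])
    finally show ?thesis using d by blast
  qed
  have "\<exists>D>0. \<exists>eps>0. \<forall>l\<in>\<Lambda>. \<forall>z\<in>punctured_plane. \<tau> l + 1 \<le> \<tau> z \<longrightarrow> X z \<le> D * exp (- eps * (\<tau> z - \<tau> l)) * x l"
  proof (cases "p = \<infinity>")
    case True
    show ?thesis
    proof (rule decay_sup[where C = "max (2 * C) (9 * K)" and L = L])
      fix F z assume F: "finite F" "F \<subseteq> \<Lambda>" "z \<in> punctured_plane" "\<And>l. l \<in> F \<Longrightarrow> \<tau> l \<le> \<tau> z"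
      have "(\<Sum>l\<in>F. X z / x l) \<le> (\<Sum>l\<in>F. 2 * (kw l z))"
      proof (rule sum_mono)
        fix l assume lF: "l \<in> F"
        then have l: "l \<in> \<Lambda>" using F by auto
        have "X z / x l = kw l z * \<rho> l z"
          unfolding X_def using F(3) x[OF l] by (subst rel[OF l]) auto
        also have "\<dots> \<le> kw l z * 2" using \<rho>2[OF l _ F(4)[OF lF]] F(3) by (intro mult_left_mono) auto
        finally show "X z / x l \<le> 2 * (kw l z)" by simp
      qed
      also have "\<dots> \<le> 2 * C" unfolding sum_distrib_left[symmetric] using sum_ker[OF True F(1,2)] F(3) by auto
      finally show "(\<Sum>l\<in>F. X z / x l) \<le> max (2 * C) (9 * K)" by simp
    next
      fix l assume l: "l \<in> \<Lambda>"
      then have lnz: "l \<noteq> 0" using sub by auto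
      obtain v where v: "norm (v - l) = norm l / 8" "x l \<le> 9 * K * X v" using peak[OF l] by blast
      have "norm (v - l) \<le> norm l / 2" using v(1) norm_ge_zero[of l] by linarith
      note n = \<tau>near[OF lnz this]
      have "9 * K * X v \<le> max (2 * C) (9 * K) * X v" using X0 by (intro mult_right_mono) auto
      with v(2) n show "\<exists>z\<in>punctured_plane. \<bar>\<tau> z - \<tau> l\<bar> < 1 \<and> x l \<le> max (2 * C) (9 * K) * X z"
        by (intro bexI[of _ v]) auto
    qed (use K L X0 x dense in auto)
  next
    case False
    define P where "P = enn2real p"
    have P: "0 < P" using enn2real_pos[OF p False] by (simp add: P_def)
    obtain C5 where C5: "0 < C5" "\<And>f z. holo f \<Longrightarrow> z \<noteq> 0 \<Longrightarrow>
      ennreal ((norm (f z) * w z) powr P) \<le>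
        ennreal C5 * Wint \<alpha> \<beta> P f (ball z (1/4 * norm z))"
      using weighted_pointwise[OF alpha P, of "1/4" \<beta>] by auto
    have loc: "ennreal (X z powr P) \<le> ennreal C5 * (\<integral>\<^sup>+ v. ennreal (X v powr P) * indicator B v \<partial>haar)"
      if "z \<noteq> 0" "\<And>v. norm (v - z) \<le> norm z / 4 \<Longrightarrow> v \<in> B" for z B
    proof -
      have "ennreal (X z powr P) \<le> ennreal C5 * (\<integral>\<^sup>+ v. ennreal (X v powr P) * indicator (ball z (1/4 * norm z)) v \<partial>haar)"
        unfolding X_def by (rule C5(2)[OF G that(1)])
      also have "\<dots> \<le> ennreal C5 * (\<integral>\<^sup>+ v. ennreal (X v powr P) * indicator B v \<partial>haar)"
        using that(2) by (intro mult_left_mono nn_integral_mono)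
          (auto simp: indicator_def dist_norm norm_minus_commute less_imp_le)
      finally show ?thesis .
    qed
    \<comment> \<open>One constant for the three hypotheses of \<open>decay_finite\<close>: the
      local mean estimate, the tail bound from the norm of the kernel with
      \<open>\<rho> \<le> 2\<close>, and the peak followed by the local mean estimate.\<close>
    define D where "D = max C5 (max ((2 * C) powr P) ((9 * K) powr P * C5))"
    have D: "0 < D" "C5 \<le> D" "(2 * C) powr P \<le> D" "(9 * K) powr P * C5 \<le> D" using C5 by (auto simp: D_def)
    show ?thesis
    proof (rule decay_finite[OF P D(1) L(1) Xm \<tau>m X0 x _ _ _ dense])
      fix l assume l: "l \<in> \<Lambda>"
      have [measurable]: "(\<lambda>z. kw l z) \<in> borel_measurable borel"
        by (rule holo_wt_measurable[OF ker_holo[OF l]])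
      have "(\<integral>\<^sup>+ z. ennreal (X z powr P) * indicator {z. \<tau> l \<le> \<tau> z} z \<partial>haar)
          \<le> (\<integral>\<^sup>+ z. ennreal ((2 * x l) powr P) * ennreal ((kw l z) powr P) \<partial>haar)"
      proof (rule nn_integral_mono_AE, rule AE_mp[OF AE_haar], rule AE_I2, rule impI)
        fix z :: complex assume z: "z \<in> punctured_plane"
        show "ennreal (X z powr P) * indicator {z. \<tau> l \<le> \<tau> z} z \<le> ennreal ((2 * x l) powr P) * ennreal ((kw l z) powr P)"
        proof (cases "\<tau> l \<le> \<tau> z")
          case True
          have "X z = kw l z * \<rho> l z * x l" using rel[OF l] z by (simp add: X_def)
          also have "\<dots> \<le> kw l z * 2 * x l"
            using \<rho>2[OF l _ True] z x[OF l] by (intro mult_right_mono mult_left_mono) auto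
          finally have "X z powr P \<le> (kw l z * 2 * x l) powr P"
            using P X0 by (intro powr_mono2) auto
          also have "\<dots> = (2 * x l) powr P * (kw l z) powr P"
            using x[OF l] by (simp add: powr_mult)
          finally have "ennreal (X z powr P) \<le> ennreal ((2 * x l) powr P * (kw l z) powr P)"
            by (rule ennreal_leI)
          then show ?thesis using True by (simp add: ennreal_mult')
        qed simp
      qed
      also have "\<dots> = ennreal ((2 * x l) powr P) * (\<integral>\<^sup>+ z. ennreal ((kw l z) powr P) \<partial>haar)"
        by (rule nn_integral_cmult) measurable
      also have "\<dots> \<le> ennreal ((2 * x l) powr P) * ennreal (C powr P)"
        using ker_Cbound[OF l] False by (intro mult_left_mono) (auto simp: Lbound_def P_def)
      also have "\<dots> = ennreal ((2 * C) powr P * x l powr P)"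
        using x[OF l] C by (simp add: powr_mult mult_ac flip: ennreal_mult')
      also have "\<dots> \<le> ennreal (D * x l powr P)" using D(3) by (intro ennreal_leI mult_right_mono) auto
      finally show "(\<integral>\<^sup>+ z. ennreal (X z powr P) * indicator {z. \<tau> l \<le> \<tau> z} z \<partial>haar) \<le> ennreal (D * x l powr P)" .
    next
      fix l assume l: "l \<in> \<Lambda>"
      then have lnz: "l \<noteq> 0" using sub by auto
      obtain v where v: "norm (v - l) = norm l / 8" "x l \<le> 9 * K * X v" using peak[OF l] by blast
      have vnz: "v \<noteq> 0" using v(1) lnz by auto
      let ?I = "\<integral>\<^sup>+ z. ennreal (X z powr P) * indicator {z. \<bar>\<tau> z - \<tau> l\<bar> < 1} z \<partial>haar"
      have "x l powr P \<le> (9 * K * X v) powr P" using P x[OF l] v(2) by (intro powr_mono2) auto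
      also have "\<dots> = (9 * K) powr P * X v powr P" using K X0 by (simp add: powr_mult)
      finally have "ennreal (x l powr P) \<le> ennreal ((9 * K) powr P * X v powr P)" by (rule ennreal_leI)
      also have "\<dots> = ennreal ((9 * K) powr P) * ennreal (X v powr P)" by (simp add: ennreal_mult')
      also have "\<dots> \<le> ennreal ((9 * K) powr P) * (ennreal C5 * ?I)"
      proof (intro mult_left_mono loc[OF vnz])
        fix z assume z: "norm (z - v) \<le> norm v / 4"
        \<comment> \<open>A ball of radius \<open>norm v / 4\<close> about a point of the circle
          stays within \<open>(9/32 + 1/8) * norm l\<close> of \<open>l\<close>, hence within
          \<open>norm l / 2\<close> and in the unit logarithmic strip.\<close>
        have "norm v \<le> 9/8 * norm l" using norm_triangle_ineq2[of v l] v(1) by linarith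
        moreover have "norm (z - l) \<le> norm (z - v) + norm (v - l)"
          using norm_triangle_ineq[of "z - v" "v - l"] by simp
        ultimately have "norm (z - l) \<le> norm l / 2" using z v(1) norm_ge_zero[of l] by linarith
        then show "z \<in> {z. \<bar>\<tau> z - \<tau> l\<bar> < 1}" using \<tau>near[OF lnz] by blast
      qed simp
      also have "\<dots> = ennreal ((9 * K) powr P * C5) * ?I" by (simp add: ennreal_mult' mult.assoc)
      also have "\<dots> \<le> ennreal D * ?I" using D(4) by (intro mult_right_mono ennreal_leI) auto
      finally show "ennreal (x l powr P) \<le> ennreal D * ?I" .
    next
      fix z :: complex assume "z \<in> punctured_plane"
      then have z: "z \<noteq> 0" by simp
      let ?I = "\<integral>\<^sup>+ v. ennreal (X v powr P) * indicator {v. \<bar>\<tau> v - \<tau> z\<bar> < 1} v \<partial>haar"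
      have "ennreal (X z powr P) \<le> ennreal C5 * ?I"
      proof (rule loc[OF z])
        fix v assume "norm (v - z) \<le> norm z / 4"
        then have "norm (v - z) \<le> norm z / 2" using norm_ge_zero[of z] by linarith
        then show "v \<in> {v. \<bar>\<tau> v - \<tau> z\<bar> < 1}" using \<tau>near[OF z] by blast
      qed
      also have "\<dots> \<le> ennreal D * ?I" using D(2) by (intro mult_right_mono ennreal_leI) auto
      finally show "ennreal (X z powr P) \<le> ennreal D * ?I" .
    qed
  qed
  then obtain D eps where D: "0 < D" "0 < eps"
    "\<And>l z. l \<in> \<Lambda> \<Longrightarrow> z \<in> punctured_plane \<Longrightarrow> \<tau> l + 1 \<le> \<tau> z \<Longrightarrow> X z \<le> D * exp (- eps * (\<tau> z - \<tau> l)) * x l" by blast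
  have "kw l z \<le> (2 * D) * exp (- eps * (\<tau> z - \<tau> l))"
    if l: "l \<in> \<Lambda>" and z: "z \<noteq> 0" "\<tau> l + 1 \<le> \<tau> z" for l z
  proof -
    have "kw l z * (1/2) * x l \<le> kw l z * \<rho> l z * x l"
      using \<rho>1[OF l z] x[OF l] by (intro mult_right_mono mult_left_mono) auto
    also have "\<dots> = X z" by (simp only: X_def rel[OF l z(1)])
    also have "\<dots> \<le> D * exp (- eps * (\<tau> z - \<tau> l)) * x l" using z by (intro D(3) l) auto
    finally have "kw l z * (1/2) \<le> D * exp (- eps * (\<tau> z - \<tau> l))"
      using x[OF l] by (rule mult_right_le_imp_le)
    then show ?thesis by simp
  qed
  then show ?thesis using D(1,2) by (intro exI[of _ "2 * D"] conjI exI[of _ eps]) auto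
qed

text \<open>Beyond \<open>l\<close> the factor \<open>norm (z - l)\<close> compares with
  \<open>norm z\<close>, so \<open>F / z\<close> with constants \<open>norm (c l)\<close> is used;
  on the side of the origin it compares with \<open>norm l\<close>, so \<open>F\<close> itself with
  constants \<open>norm (c l) * norm l\<close>.\<close>

lemma ker_decay:
  "\<exists>D>0. \<exists>eps>0. \<forall>l\<in>\<Lambda>. \<forall>z. z \<noteq> 0 \<longrightarrow> kw l z \<le> D * exp (- eps * \<bar>lg l - lg z\<bar>)"
proof -
  obtain F c where F: "holo F" and c: "\<And>l. l \<in> \<Lambda> \<Longrightarrow> c l \<noteq> 0"
    and Fc: "\<And>l z. l \<in> \<Lambda> \<Longrightarrow> z \<noteq> 0 \<Longrightarrow> F z = c l * ((z - l) * ker l z)"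
    using generating_function by blast
  have nz: "l \<noteq> 0" if "l \<in> \<Lambda>" for l using that sub by auto
  have e2: "2 \<le> exp (1::real)" using exp_ge_add_one_self[of 1] by simp
  have half: "2 * norm a \<le> norm b" if "a \<noteq> 0" "b \<noteq> 0" "lg a + 1 \<le> lg b" for a b :: complex
  proof -
    have "exp 1 * norm a = exp (lg a + 1)" using that by (simp add: exp_add)
    also have "\<dots> \<le> exp (lg b)" using that(3) by (simp only: exp_le_cancel_iff)
    also have "\<dots> = norm b" using that by simp
    finally show ?thesis using mult_right_mono[OF e2, of "norm a"] by simp
  qed
  have upper: "\<exists>D>0. \<exists>eps>0. \<forall>l\<in>\<Lambda>. \<forall>z. z \<noteq> 0 \<longrightarrow> lg l + 1 \<le> lg z \<longrightarrow>
      kw l z \<le> D * exp (- eps * (lg z - lg l))"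
  proof (rule one_sided_decay[where G = "\<lambda>z. F z / z" and x = "\<lambda>l. norm (c l)" and \<rho> = "\<lambda>l z. norm (z - l) / norm z"])
    show "(\<lambda>z. F z / z) holomorphic_on punctured_plane" using F by (intro holomorphic_intros) auto
    show "norm (F z / z) * w z = kw l z * (norm (z - l) / norm z) * norm (c l)"
      if "l \<in> \<Lambda>" "z \<noteq> 0" for l z
      using Fc[OF that] by (simp add: norm_mult norm_divide)
    show "norm (z - l) / norm z \<le> 2" if "l \<in> \<Lambda>" "z \<noteq> 0" "lg l \<le> lg z" for l z
      using that nz[OF that(1)] norm_triangle_ineq4[of z l] by (simp add: divide_le_eq)
    show "1/2 \<le> norm (z - l) / norm z" if "l \<in> \<Lambda>" "z \<noteq> 0" "lg l + 1 \<le> lg z" for l z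
      using half[OF nz[OF that(1)] that(2,3)] norm_triangle_ineq2[of z l] that(2) by (simp add: le_divide_eq)
    show "1/9 \<le> norm (z - l) / norm z" if "l \<in> \<Lambda>" "norm (z - l) = norm l / 8" for l z
    proof -
      have "z \<noteq> 0" using that nz by auto
      then show ?thesis using norm_triangle_ineq2[of z l] that(2) by (simp add: le_divide_eq)
    qed
  qed (use c in auto)
  have lower: "\<exists>D>0. \<exists>eps>0. \<forall>l\<in>\<Lambda>. \<forall>z. z \<noteq> 0 \<longrightarrow> - lg l + 1 \<le> - lg z \<longrightarrow>
      kw l z \<le> D * exp (- eps * (- lg z - - lg l))"
  proof (rule one_sided_decay[where G = F and x = "\<lambda>l. norm (c l) * norm l" and \<rho> = "\<lambda>l z. norm (z - l) / norm l"])
    show "norm (F z) * w z = kw l z * (norm (z - l) / norm l) * (norm (c l) * norm l)"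
      if "l \<in> \<Lambda>" "z \<noteq> 0" for l z
      using Fc[OF that] nz[OF that(1)] by (simp add: norm_mult)
    show "norm (z - l) / norm l \<le> 2" if "l \<in> \<Lambda>" "z \<noteq> 0" "- lg l \<le> - lg z" for l z
      using that nz[OF that(1)] norm_triangle_ineq4[of z l] by (simp add: divide_le_eq)
    show "1/2 \<le> norm (z - l) / norm l" if "l \<in> \<Lambda>" "z \<noteq> 0" "- lg l + 1 \<le> - lg z" for l z
      using half[OF that(2) nz[OF that(1)]] that norm_triangle_ineq2[of l z] nz[OF that(1)]
      by (simp add: le_divide_eq norm_minus_commute)
    show "1/9 \<le> norm (z - l) / norm l" if "l \<in> \<Lambda>" "norm (z - l) = norm l / 8" for l z
    proof -
      have "norm l = 8 * norm (z - l)" using that(2) by simp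
      then have "norm l \<le> 9 * norm (z - l)" using norm_ge_zero[of "z - l"] by linarith
      then show ?thesis using nz[OF that(1)] by (simp add: field_simps)
    qed
  qed (use F c nz in auto)
  obtain D1 e1 where D1: "0 < D1" "0 < e1" "\<And>l z. l \<in> \<Lambda> \<Longrightarrow> z \<noteq> 0 \<Longrightarrow> lg l + 1 \<le> lg z \<Longrightarrow>
      kw l z \<le> D1 * exp (- e1 * (lg z - lg l))" using upper by blast
  obtain D2 e2 where D2: "0 < D2" "0 < e2" "\<And>l z. l \<in> \<Lambda> \<Longrightarrow> z \<noteq> 0 \<Longrightarrow> - lg l + 1 \<le> - lg z \<Longrightarrow>
      kw l z \<le> D2 * exp (- e2 * (- lg z - - lg l))" using lower by blast
  obtain C0 where C0: "0 < C0" "\<And>l z. l \<in> \<Lambda> \<Longrightarrow> z \<noteq> 0 \<Longrightarrow> kw l z \<le> C0"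
    using ker_sup by blast
  define e where "e = min e1 e2"
  have e: "0 < e" "e \<le> e1" "e \<le> e2" using D1 D2 by (auto simp: e_def)
  \<comment> \<open>The entry \<open>C0 * exp e\<close> covers the strip of logarithmic distance
    below 1, where neither one-sided estimate speaks and the uniform bound on the kernels is
    used.\<close>
  define D where "D = max D1 (max D2 (C0 * exp e))"
  have D: "0 < D" "D1 \<le> D" "D2 \<le> D" "C0 * exp e \<le> D" using D1(1) by (auto simp: D_def)
  have "kw l z \<le> D * exp (- e * \<bar>lg l - lg z\<bar>)" if l: "l \<in> \<Lambda>" and z: "z \<noteq> 0" for l z
  proof -
    define d where "d = \<bar>lg l - lg z\<bar>"
    have d0: "0 \<le> d" by (simp add: d_def)
    have ex: "D' * exp (- e' * d) \<le> D * exp (- e * d)" if "0 < D'" "D' \<le> D" "e \<le> e'" for D' e'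
      using that d0 mult_right_mono[of e e' d] by (intro mult_mono) auto
    consider "lg l + 1 \<le> lg z" | "- lg l + 1 \<le> - lg z" | "d < 1"
      unfolding d_def by linarith
    then have "kw l z \<le> D * exp (- e * d)"
    proof cases
      case 1
      then have "lg z - lg l = d" by (simp add: d_def)
      then show ?thesis using D1(3)[OF l z 1] ex[OF D1(1) D(2) e(2)] by simp
    next
      case 2
      then have "- lg z - - lg l = d" by (simp add: d_def)
      then show ?thesis using D2(3)[OF l z 2] ex[OF D2(1) D(3) e(3)] by simp
    next
      case 3
      have "C0 * 1 \<le> C0 * (exp e * exp (- e * d))"
        using C0(1) e(1) 3 by (intro mult_left_mono) (auto simp flip: exp_add)
      also have "\<dots> \<le> D * exp (- e * d)" using D(4) by (simp flip: mult.assoc)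
      finally show ?thesis using C0(2)[OF l z] by simp
    qed
    then show ?thesis by (simp add: d_def)
  qed
  then show ?thesis using D(1) e(1) by blast
qed

end

context interpolating
begin

subsection \<open>Transfer to another exponent\<close>

text \<open>For a second node \<open>a\<close> the function
  \<open>z * f z / ((z - l) * (z - a))\<close> lies in the \<open>p\<close>-space and is therefore a
  combination of the kernels at \<open>l\<close> and \<open>a\<close>. Multiplied by
  \<open>z0 - a\<close> at \<open>z0\<close>, the first term depends on \<open>a\<close> only
  through the ratio \<open>(z0 - a) / (l - a)\<close>, and the second disappears in the limit with
  the kernel at \<open>a\<close>.\<close>

lemma unique_bounded_limit:
  fixes m :: "nat \<Rightarrow> complex"
  assumes f: "holo f" and K: "\<And>z. z \<noteq> 0 \<Longrightarrow> norm (f z) * w z \<le> K"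
    and f0: "\<And>z. z \<in> \<Lambda> \<Longrightarrow> f z = 0"
    and l: "l \<in> \<Lambda>" and h: "holo h" "\<And>z. f z = (z - l) * h z"
    and z0: "z0 \<noteq> 0" "z0 \<notin> \<Lambda>"
    and m: "\<And>n. m n \<in> \<Lambda>" "\<And>n. m n \<noteq> l"
    and ratio: "(\<lambda>n. (z0 - m n) / (l - m n)) \<longlonglongrightarrow> \<rho>"
    and small: "(\<lambda>n. norm (ker (m n) z0)) \<longlonglongrightarrow> 0"
  shows "z0 * h z0 = \<rho> * (l * (h l / ker l l) * ker l z0)"
proof -
  obtain C2 where C2: "0 < C2" "\<And>h a K. holo h \<Longrightarrow> a \<noteq> 0 \<Longrightarrow>
    (\<forall>z. z \<noteq> 0 \<longrightarrow> norm ((z - a) * h z) * w z \<le> K) \<Longrightarrow>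
    (\<forall>z. z \<noteq> 0 \<longrightarrow> norm (h z) * w z \<le> C2 * K / (norm z + norm a))"
    using division_bound[OF alpha, of \<beta>] by blast
  have lnz: "l \<noteq> 0" using l sub by auto
  define r where "r = (\<lambda>n. (z0 - m n) / (l - m n))"
  define A where "A = l * (h l / ker l l) * ker l z0"
  have step: "norm (z0 * h z0 - r n * A) \<le> norm (r n) * (C2 * K / 2) * norm (ker (m n) z0)" for n
  proof -
    define a where "a = m n"
    have a: "a \<in> \<Lambda>" "a \<noteq> l" "a \<noteq> 0" using m[of n] sub by (auto simp: a_def)
    have za: "z0 \<noteq> a" using z0 a by auto
    have "(a - l) * h a = 0" using f0[OF a(1)] h(2)[of a] by simp
    then have "h a = 0" using a(2) by simp
    then obtain h2 where h2: "holo h2" "\<And>z. h z = (z - a) * h2 z"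
      using holo_divide_zero[OF h(1)] by metis
    define Q where "Q = (\<lambda>z. z * h2 z)"
    have "inG Q"
    proof -
      have "norm ((z - l) * ((z - a) * h2 z)) * w z \<le> K" if "z \<noteq> 0" for z
        using K[OF that] by (simp only: h(2) h2(2))
      then have "\<exists>K\<ge>0. Cbound p (\<lambda>z. norm (z * h2 z) * w z) K"
        by (intro Cbound_divide2[OF alpha p h2(1) lnz a(3)])
      moreover have "holo Q" unfolding Q_def using h2(1) by (intro holomorphic_intros)
      ultimately show ?thesis by (simp add: inG_def Q_def)
    qed
    have Q0: "Q b = 0" if b: "b \<in> \<Lambda>" "b \<noteq> l" "b \<noteq> a" for b
    proof -
      have "(b - l) * ((b - a) * h2 b) = 0" using f0[OF b(1)] h(2)[of b] h2(2)[of b] by simp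
      then show ?thesis using b by (simp add: Q_def)
    qed
    define el ea where "el = Q l / ker l l" and "ea = Q a / ker a a"
    have "inG (\<lambda>z. 1 * Q z + (- 1) * (el * ker l z + ea * ker a z))"
      by (intro inG_lin \<open>inG Q\<close> ker_inG l a)
    then have "1 * Q z0 + (- 1) * (el * ker l z0 + ea * ker a z0) = 0"
    proof (rule unique[OF _ _ z0(1)])
      fix b assume b: "b \<in> \<Lambda>"
      consider "b = l" | "b = a" | "b \<noteq> l" "b \<noteq> a" by blast
      then show "1 * Q b + (- 1) * (el * ker l b + ea * ker a b) = 0"
      proof cases
        case 1
        then show ?thesis using ker_off[OF a(1) l] a(2) ker_diag(2)[OF l] by (simp add: el_def)
      next
        case 2
        then show ?thesis using ker_off[OF l a(1) a(2)] ker_diag(2)[OF a(1)] by (simp add: ea_def)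
      next
        case 3
        then show ?thesis using Q0[OF b 3] ker_off[OF l b] ker_off[OF a(1) b] by simp
      qed
    qed
    then have eq: "Q z0 = el * ker l z0 + ea * ker a z0" by algebra
    have "z0 * h z0 = (z0 - a) * Q z0" by (simp add: h2(2)[of z0] Q_def)
    also have "\<dots> = (z0 - a) * el * ker l z0 + (z0 - a) * (ea * ker a z0)" unfolding eq by (simp add: algebra_simps)
    also have "(z0 - a) * el * ker l z0 = r n * A"
      using a(2) ker_diag(2)[OF l] by (simp add: r_def A_def el_def Q_def h2(2)[of l] a_def[symmetric])
    finally have "norm (z0 * h z0 - r n * A) = norm (z0 - a) * (norm ea * norm (ker a z0))"
      by (simp add: norm_mult)
    \<comment> \<open>The coefficient at \<open>a\<close> is bounded by dividing only
      \<open>z - a\<close> out of the bounded function \<open>f\<close> and evaluating at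
      \<open>a\<close>; the denominator \<open>norm (a - l)\<close> combines with
      \<open>norm (z0 - a)\<close> into the ratio, which converges.\<close>
    also have "\<dots> \<le> norm (z0 - a) * ((C2 * K / (2 * norm (a - l))) * norm (ker a z0))"
    proof (intro mult_left_mono mult_right_mono)
      have hol: "(\<lambda>z. (z - l) * h2 z) holomorphic_on punctured_plane" using h2(1) by (intro holomorphic_intros)
      have "norm ((z - a) * ((z - l) * h2 z)) * w z \<le> K" if "z \<noteq> 0" for z
        using K[OF that] by (simp only: h(2) h2(2) mult_ac)
      then have "norm ((a - l) * h2 a) * w a \<le> C2 * K / (norm a + norm a)"
        using C2(2)[OF hol a(3), of K] a(3) by blast
      then have 1: "norm (a - l) * norm (h2 a) * w a * (2 * norm a) \<le> C2 * K"
        using a(3) by (simp add: norm_mult pos_le_divide_eq)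
      have kd: "1 / norm (ker a a) = w a" using ker_diag[OF a(1)] by (simp add: field_simps)
      have "norm ea = norm a * norm (h2 a) * (1 / norm (ker a a))" by (simp add: ea_def Q_def norm_mult norm_divide)
      then have "norm ea * (2 * norm (a - l)) = norm (a - l) * norm (h2 a) * w a * (2 * norm a)"
        unfolding kd by simp
      then have "norm ea * (2 * norm (a - l)) \<le> C2 * K" using 1 by (simp only:)
      moreover have "0 < 2 * norm (a - l)" using a(2) by simp
      ultimately show "norm ea \<le> C2 * K / (2 * norm (a - l))" by (simp only: pos_le_divide_eq)
    qed auto
    also have "\<dots> = norm (r n) * (C2 * K / 2) * norm (ker (m n) z0)"
      using a(2) by (simp add: r_def a_def norm_divide norm_minus_commute)
    finally show ?thesis .
  qed
  have "(\<lambda>n. norm (r n) * (C2 * K / 2) * norm (ker (m n) z0)) \<longlonglongrightarrow> norm \<rho> * (C2 * K / 2) * 0"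
    using ratio small unfolding r_def by (intro tendsto_intros)
  then have "(\<lambda>n. norm (r n) * (C2 * K / 2) * norm (ker (m n) z0)) \<longlonglongrightarrow> 0" by simp
  then have "(\<lambda>n. z0 * h z0 - r n * A) \<longlonglongrightarrow> 0"
    by (rule Lim_null_comparison[rotated]) (intro always_eventually allI step)
  moreover have "(\<lambda>n. z0 * h z0 - r n * A) \<longlonglongrightarrow> z0 * h z0 - \<rho> * A"
    using ratio unfolding r_def by (intro tendsto_intros)
  ultimately have "z0 * h z0 - \<rho> * A = 0" using LIMSEQ_unique by blast
  then show ?thesis by (simp add: A_def)
qed

text \<open>Letting the auxiliary point tend to \<open>\<infinity>\<close> and to \<open>0\<close> gives two incompatible formulas for \<open>f / (z - l)\<close>.\<close>

lemma unique_bounded: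
  assumes f: "holo f" and K: "\<And>z. z \<noteq> 0 \<Longrightarrow> norm (f z) * w z \<le> K"
    and f0: "\<And>z. z \<in> \<Lambda> \<Longrightarrow> f z = 0" and z0: "z0 \<noteq> 0"
  shows "f z0 = 0"
proof (cases "z0 \<in> \<Lambda>")
  case False
  obtain L where L: "0 < L" "\<And>t. \<exists>l\<in>\<Lambda>. \<bar>lg l - t\<bar> \<le> L" using log_dense by blast
  obtain l where l: "l \<in> \<Lambda>" using L(2) by blast
  then have lnz: "l \<noteq> 0" using sub by auto
  obtain h where h: "holo h" "\<And>z. f z = (z - l) * h z"
    using holo_divide_zero[OF f f0[OF l]] by metis
  obtain D eps where D: "0 < D" "0 < eps" "\<And>l z. l \<in> \<Lambda> \<Longrightarrow> z \<noteq> 0 \<Longrightarrow>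
      kw l z \<le> D * exp (- eps * \<bar>lg l - lg z\<bar>)"
    using ker_decay by blast
  have wz: "0 < w z0" using z0 by (rule wt_pos)
  have small: "(\<lambda>n. norm (ker (m n) z0)) \<longlonglongrightarrow> 0"
    if m: "\<And>n. m n \<in> \<Lambda>" and far: "filterlim (\<lambda>n. \<bar>lg (m n) - lg z0\<bar>) at_top sequentially" for m
  proof -
    have "(\<lambda>n. exp (- eps * \<bar>lg (m n) - lg z0\<bar>)) \<longlonglongrightarrow> 0"
    proof (rule filterlim_compose[OF exp_at_bot])
      have "filterlim (\<lambda>n. eps * \<bar>lg (m n) - lg z0\<bar>) at_top sequentially"
        by (rule filterlim_tendsto_pos_mult_at_top[OF tendsto_const D(2) far])
      then show "filterlim (\<lambda>n. - eps * \<bar>lg (m n) - lg z0\<bar>) at_bot sequentially"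
        by (simp add: filterlim_uminus_at_bot)
    qed
    then have "(\<lambda>n. D / w z0 * exp (- eps * \<bar>lg (m n) - lg z0\<bar>)) \<longlonglongrightarrow> D / w z0 * 0"
      by (intro tendsto_intros)
    then have "(\<lambda>n. D / w z0 * exp (- eps * \<bar>lg (m n) - lg z0\<bar>)) \<longlonglongrightarrow> 0" by simp
    then show ?thesis
    proof (rule Lim_null_comparison[rotated], intro always_eventually allI)
      fix n
      show "norm (norm (ker (m n) z0)) \<le> D / w z0 * exp (- eps * \<bar>lg (m n) - lg z0\<bar>)"
        using D(3)[OF m[of n] z0] wz by (simp add: field_simps)
    qed
  qed
  \<comment> \<open>The offset exceeds \<open>L + \<bar>lg l\<bar>\<close>, so nodes chosen within
    \<open>L\<close> of the levels \<open>real n + s0\<close> and of their negatives all differ from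
    \<open>l\<close>.\<close>
  define s0 where "s0 = \<bar>lg l\<bar> + L + 1"
  have "\<forall>n. \<exists>a\<in>\<Lambda>. \<bar>lg a - (real n + s0)\<bar> \<le> L" using L(2) by blast
  then obtain u where u: "\<And>n. u n \<in> \<Lambda>" "\<And>n. \<bar>lg (u n) - (real n + s0)\<bar> \<le> L" by metis
  have "\<forall>n. \<exists>a\<in>\<Lambda>. \<bar>lg a - (- (real n + s0))\<bar> \<le> L" using L(2) by blast
  then obtain v where v: "\<And>n. v n \<in> \<Lambda>" "\<And>n. \<bar>lg (v n) - (- (real n + s0))\<bar> \<le> L" by metis
  have unz: "u n \<noteq> 0" "v n \<noteq> 0" for n using u(1)[of n] v(1)[of n] sub by auto
  have ul: "u n \<noteq> l" for n using u(2)[of n] by (auto simp: s0_def)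
  have vl: "v n \<noteq> l" for n using v(2)[of n] by (auto simp: s0_def)
  have top: "filterlim (\<lambda>n. real n + c) at_top sequentially" for c
    using filterlim_tendsto_add_at_top[OF tendsto_const filterlim_real_sequentially, of c] by (simp only: add.commute)
  have nu: "filterlim (\<lambda>n. lg (u n)) at_top sequentially"
  proof (rule filterlim_at_top_mono[OF top[of "s0 - L"]], intro always_eventually allI)
    show "real n + (s0 - L) \<le> lg (u n)" for n using u(2)[of n] by linarith
  qed
  have nv: "filterlim (\<lambda>n. - lg (v n)) at_top sequentially"
  proof (rule filterlim_at_top_mono[OF top[of "s0 - L"]], intro always_eventually allI)
    show "real n + (s0 - L) \<le> - lg (v n)" for n using v(2)[of n] by linarith
  qed
  have su: "(\<lambda>n. norm (ker (u n) z0)) \<longlonglongrightarrow> 0"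
  proof (rule small[OF u(1)], rule filterlim_at_top_mono[OF top[of "s0 - L - lg z0"]], intro always_eventually allI)
    show "real n + (s0 - L - lg z0) \<le> \<bar>lg (u n) - lg z0\<bar>" for n using u(2)[of n] by linarith
  qed
  have sv: "(\<lambda>n. norm (ker (v n) z0)) \<longlonglongrightarrow> 0"
  proof (rule small[OF v(1)], rule filterlim_at_top_mono[OF top[of "s0 - L + lg z0"]], intro always_eventually allI)
    show "real n + (s0 - L + lg z0) \<le> \<bar>lg (v n) - lg z0\<bar>" for n using v(2)[of n] by linarith
  qed
  have v0: "v \<longlonglongrightarrow> 0"
  proof -
    have "(\<lambda>n. exp (lg (v n))) \<longlonglongrightarrow> 0"
      using nv by (intro filterlim_compose[OF exp_at_bot]) (simp add: filterlim_uminus_at_bot)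
    then show ?thesis using unz by (simp add: tendsto_norm_zero_iff)
  qed
  have "(\<lambda>n. (z0 - v n) / (l - v n)) \<longlonglongrightarrow> (z0 - 0) / (l - 0)"
    using v0 lnz by (intro tendsto_intros) auto
  then have lim_v: "(\<lambda>n. (z0 - v n) / (l - v n)) \<longlonglongrightarrow> z0 / l" by simp
  have lim_u: "(\<lambda>n. (z0 - u n) / (l - u n)) \<longlonglongrightarrow> 1"
  proof -
    have "(\<lambda>n. exp (- lg (u n))) \<longlonglongrightarrow> 0"
      using nu by (intro filterlim_compose[OF exp_at_bot]) (simp add: filterlim_uminus_at_bot)
    then have "(\<lambda>n. norm (inverse (u n))) \<longlonglongrightarrow> 0"
      using unz by (simp add: exp_minus norm_inverse)
    then have iu: "(\<lambda>n. inverse (u n)) \<longlonglongrightarrow> 0" by (simp only: tendsto_norm_zero_iff)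
    have "(\<lambda>n. (z0 * inverse (u n) - 1) / (l * inverse (u n) - 1)) \<longlonglongrightarrow> (z0 * 0 - 1) / (l * 0 - 1)"
      using iu by (intro tendsto_intros) auto
    moreover have "(z0 * inverse (u n) - 1) / (l * inverse (u n) - 1) = (z0 - u n) / (l - u n)" for n
    proof -
      have "(z0 - u n) / (l - u n) = ((z0 - u n) * inverse (u n)) / ((l - u n) * inverse (u n))"
        using unz[of n] by simp
      then show ?thesis using unz[of n] by (simp add: left_diff_distrib)
    qed
    ultimately show ?thesis by simp
  qed
  \<comment> \<open>The ratio tends to 1 along nodes going to infinity and to \<open>z0 / l\<close>
    along nodes going to 0. Both limits give the value of \<open>z0 * h z0\<close>, and
    \<open>z0\<close> differs from \<open>l\<close>, so \<open>A = 0\<close>.\<close>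
  define A where "A = l * (h l / ker l l) * ker l z0"
  have 1: "z0 * h z0 = A"
    using unique_bounded_limit[OF f K f0 l h z0 False u(1) ul lim_u su] by (simp add: A_def)
  have 2: "z0 * h z0 = z0 / l * A"
    using unique_bounded_limit[OF f K f0 l h z0 False v(1) vl lim_v sv] by (simp add: A_def)
  have "l * A = l * (z0 / l * A)" by (rule arg_cong[OF trans[OF 1[symmetric] 2]])
  also have "\<dots> = z0 * A" using lnz by simp
  finally have "l * A = z0 * A" .
  then have "A = 0" using False l by auto
  then have "h z0 = 0" using 1 z0 by simp
  then show ?thesis by (simp add: h(2)[of z0])
qed (use f0 in auto)

text \<open>Together with countability this gives a bijection with the natural numbers, so the
  interpolation series becomes an ordinary series.\<close>

lemma infinite_\<Lambda>: "infinite \<Lambda>"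
proof
  assume fin: "finite \<Lambda>"
  obtain L where L: "0 < L" "\<And>t. \<exists>l\<in>\<Lambda>. \<bar>lg l - t\<bar> \<le> L" using log_dense by blast
  define M where "M = Max ((\<lambda>l. lg l) ` \<Lambda>)"
  obtain l where l: "l \<in> \<Lambda>" "\<bar>lg l - (M + L + 1)\<bar> \<le> L" using L(2) by blast
  have "lg l \<le> M" unfolding M_def using fin l(1) by (intro Max_ge) auto
  with l(2) show False by linarith
qed

text \<open>The Lagrange series in the kernels of the old exponent \<open>p\<close> is used for the
  new exponent \<open>q\<close>. Finite \<open>q\<close> data are bounded, so convergence and
  interpolation need to be proved once, for bounded data; only the final norm estimate distinguishes
  the cases.\<close>

lemma synthesis:
  assumes q: "0 < q"
  shows "\<exists>C'>0. \<forall>a K. 0 \<le> K \<longrightarrow> Sbound \<alpha> \<beta> \<Lambda> q a K \<longrightarrow>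
    (\<exists>f. holo f \<and> (\<forall>z\<in>\<Lambda>. f z = a z) \<and> Fbound \<alpha> \<beta> q f (C' * K))"
proof -
  obtain r where "separated r \<Lambda>" using separation by blast
  then interpret separated r \<Lambda> .
  obtain D eps where D: "0 < D" "0 < eps" and decay: "\<And>l z. l \<in> \<Lambda> \<Longrightarrow> z \<noteq> 0 \<Longrightarrow>
      kw l z \<le> D * exp (- eps * \<bar>lg l - lg z\<bar>)"
    using ker_decay by blast
  define e where "e = from_nat_into \<Lambda>"
  have bij: "bij_betw e UNIV \<Lambda>" unfolding e_def using countable infinite_\<Lambda> by (rule bij_betw_from_nat_into)
  then have e: "e n \<in> \<Lambda>" for n by (auto simp: bij_betw_def)
  let ?E = "\<lambda>c s n. exp (- c * \<bar>lg (e n) - s\<bar>)"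
  let ?t = "\<lambda>a z n. norm (a (e n)) * w (e n) * exp (- eps * \<bar>lg (e n) - lg z\<bar>)"
  have sums: "\<exists>S>0. \<forall>s. summable (\<lambda>n. ?E c s n) \<and> (\<Sum>n. ?E c s n) \<le> S"
    if c: "0 < c" for c
  proof -
    obtain S where S: "0 < S" "\<And>s. (\<integral>\<^sup>+ l. ennreal (exp (- c * \<bar>lg l - s\<bar>)) \<partial>count_space \<Lambda>) \<le> ennreal S"
      using exp_sum[OF c] by blast
    have "summable (\<lambda>n. ?E c s n) \<and> (\<Sum>n. ?E c s n) \<le> S" for s
    proof -
      have "(\<Sum>n. ennreal (?E c s n)) = (\<integral>\<^sup>+ n. ennreal (?E c s n) \<partial>count_space UNIV)"
        by (rule nn_integral_count_space_nat[symmetric])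
      also have "\<dots> = (\<integral>\<^sup>+ l. ennreal (exp (- c * \<bar>lg l - s\<bar>)) \<partial>count_space \<Lambda>)"
        by (rule nn_integral_bij_count_space[OF bij])
      also have "\<dots> \<le> ennreal S" by (rule S(2))
      finally have le: "(\<Sum>n. ennreal (?E c s n)) \<le> ennreal S" .
      have sm: "summable (\<lambda>n. ?E c s n)"
        by (rule summable_suminf_not_top) (use le in \<open>auto simp: top_unique\<close>)
      have "ennreal (\<Sum>n. ?E c s n) \<le> ennreal S"
        using le sm by (subst (asm) suminf_ennreal2) auto
      then show ?thesis using sm S(1) by (simp add: ennreal_le_iff)
    qed
    then show ?thesis using S(1) by blast
  qed
  obtain S where S: "0 < S" "\<And>s. summable (\<lambda>n. ?E eps s n)"
    "\<And>s. (\<Sum>n. ?E eps s n) \<le> S" using sums[OF D(2)] by blast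
  have e2: "0 < eps / 2" using D(2) by simp
  obtain S2 where S2: "0 < S2" "\<And>s. summable (\<lambda>n. ?E (eps/2) s n)"
    "\<And>s. (\<Sum>n. ?E (eps/2) s n) \<le> S2" using sums[OF e2] by blast
  \<comment> \<open>Dividing by the diagonal value makes the term with index \<open>n\<close> take
    the value \<open>a (e n)\<close> at its own node and zero at every other node.\<close>
  define G where "G = (\<lambda>a n z. a (e n) / ker (e n) (e n) * ker (e n) z)"
  have Gb: "norm (G a n z) * w z \<le> (norm (a (e n)) * w (e n)) * (D * ?E eps (lg z) n)"
    if "z \<noteq> 0" for a n z
  proof -
    have kd: "1 / norm (ker (e n) (e n)) = w (e n)" using ker_diag[OF e[of n]] by (simp add: field_simps)
    have "norm (G a n z) * w z = norm (a (e n)) * (1 / norm (ker (e n) (e n))) * (kw (e n) z)"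
      by (simp add: G_def norm_mult norm_divide)
    also have "\<dots> \<le> norm (a (e n)) * w (e n) * (D * ?E eps (lg z) n)"
      unfolding kd by (intro mult_left_mono decay e that) auto
    finally show ?thesis .
  qed
  have main: "\<exists>f. holo f \<and> (\<forall>z\<in>\<Lambda>. f z = a z) \<and>
      (\<forall>z. z \<noteq> 0 \<longrightarrow> summable (\<lambda>n. ?t a z n) \<and>
         norm (f z) * w z \<le> D * (\<Sum>n. ?t a z n))"
    if K: "0 \<le> K" and aK_ball: "\<forall>l\<in>\<Lambda>. norm (a l) * w l \<le> K" for a K
  proof -
    note aK = aK_ball[rule_format]
    define f where "f = (\<lambda>z. \<Sum>n. G a n z)"
    have su: "summable (\<lambda>n. norm (a (e n)) * w (e n) * ?E eps s n)" for s
    proof (rule summable_comparison_test')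
      show "summable (\<lambda>n. K * ?E eps s n)" by (intro summable_mult S)
      show "norm (norm (a (e n)) * w (e n) * ?E eps s n) \<le> K * ?E eps s n" for n
        using aK[OF e[of n]] by (simp add: abs_mult mult_right_mono)
    qed
    have "holo f"
    proof (rule holomorphic_uniform_sequence[where f = "\<lambda>N z. \<Sum>n<N. G a n z"])
      show "(\<lambda>z. \<Sum>n<N. G a n z) holomorphic_on punctured_plane" for N
        unfolding G_def by (intro holomorphic_intros ker_holo e)
    next
      fix x :: complex assume "x \<in> punctured_plane"
      then have x: "x \<noteq> 0" by simp
      \<comment> \<open>On this compact neighbourhood the weight is bounded below and
        \<open>lg z\<close> moves by less than 1, so one summable majorant centred at
        \<open>lg x\<close> gives uniform convergence.\<close>
      define X where "X = cball x (norm x / 2)"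
      have X: "z \<noteq> 0 \<and> \<bar>lg z - lg x\<bar> < 1" if "z \<in> X" for z
        using ln_norm_close[OF x, of z] that by (auto simp: X_def dist_norm norm_minus_commute)
      have "continuous_on X (\<lambda>z. 1 / w z)"
        unfolding wt_def using X by (intro continuous_intros) auto
      moreover have "compact X" "X \<noteq> {}" by (auto simp: X_def)
      ultimately obtain b where b: "\<And>z. z \<in> X \<Longrightarrow> 1 / w z \<le> 1 / w b" using continuous_attains_sup[of X "\<lambda>z. 1 / w z"] by blast
      define B where "B = 1 / w b"
      have B: "0 \<le> B" by (simp add: B_def)
      have "uniform_limit X (\<lambda>N z. \<Sum>n<N. G a n z) f sequentially"
        unfolding f_def
      proof (rule Weierstrass_m_test)
        show "summable (\<lambda>n. K * D * exp eps * B * ?E eps (lg x) n)"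
          by (intro summable_mult S)
        fix n z assume z: "z \<in> X"
        have wz: "0 < w z" using X[OF z] by (intro wt_pos) auto
        have "\<bar>lg (e n) - lg x\<bar> \<le> \<bar>lg (e n) - lg z\<bar> + 1" using X[OF z] by linarith
        from mult_left_mono[OF this, of eps] have E: "?E eps (lg z) n \<le> exp eps * ?E eps (lg x) n"
          using D(2) by (simp add: algebra_simps flip: exp_add)
        have "norm (G a n z) * w z \<le> (norm (a (e n)) * w (e n)) * (D * ?E eps (lg z) n)"
          using X[OF z] by (intro Gb) auto
        also have "\<dots> \<le> K * (D * ?E eps (lg z) n)" using D(1) by (intro mult_right_mono aK e) auto
        also have "\<dots> \<le> K * (D * (exp eps * ?E eps (lg x) n))" using K D(1) by (intro mult_left_mono E) auto
        finally have "norm (G a n z) \<le> K * D * exp eps * ?E eps (lg x) n * (1 / w z)" using wz by (simp add: field_simps)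
        also have "\<dots> \<le> K * D * exp eps * ?E eps (lg x) n * B" using K D(1) b[OF z] by (intro mult_left_mono) (auto simp: B_def)
        finally show "norm (G a n z) \<le> K * D * exp eps * B * ?E eps (lg x) n" by (simp only: mult_ac)
      qed
      moreover have "X \<subseteq> punctured_plane" using X by auto
      moreover have "0 < norm x / 2" using x by simp
      ultimately show "\<exists>d>0. cball x d \<subseteq> punctured_plane \<and> uniform_limit (cball x d) (\<lambda>N z. \<Sum>n<N. G a n z) f sequentially"
        unfolding X_def by blast
    qed auto
    moreover have "f z = a z" if z: "z \<in> \<Lambda>" for z
    proof -
      obtain k where k: "z = e k" using z bij by (auto simp: bij_betw_def)
      have "G a n z = 0" if "n \<notin> {k}" for n
      proof -
        have "e n \<noteq> z" using that bij k by (auto simp: bij_betw_def inj_on_def)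
        then show ?thesis using ker_off[OF e[of n] z] by (simp add: G_def)
      qed
      then have "f z = (\<Sum>n\<in>{k}. G a n z)" unfolding f_def by (intro suminf_finite) auto
      then show ?thesis using ker_diag(2)[OF z] by (simp add: G_def k)
    qed
    moreover have "norm (f z) * w z \<le> D * (\<Sum>n. ?t a z n)"
      if z: "z \<noteq> 0" for z
    proof -
      have wz: "0 < w z" using z by (rule wt_pos)
      have Gn: "norm (G a n z) \<le> D / w z * ?t a z n" for n
        using Gb[OF z, of a n] wz by (simp add: field_simps)
      have s2: "summable (\<lambda>n. D / w z * ?t a z n)" by (intro summable_mult su)
      have "norm (f z) \<le> (\<Sum>n. D / w z * ?t a z n)" unfolding f_def by (rule norm_suminf_le[OF Gn s2])
      also have "\<dots> = D / w z * (\<Sum>n. ?t a z n)" by (rule suminf_mult[OF su])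
      finally show ?thesis using wz by (simp add: field_simps)
    qed
    ultimately show ?thesis using su by (intro exI[of _ f]) auto
  qed
  show ?thesis
  proof (cases "q = \<infinity>")
    case True
    have "\<exists>f. holo f \<and> (\<forall>z\<in>\<Lambda>. f z = a z) \<and> Fbound \<alpha> \<beta> q f ((D * S) * K)"
      if K: "0 \<le> K" and aK: "Sbound \<alpha> \<beta> \<Lambda> q a K" for a K
    proof -
      have aK': "norm (a l) * w l \<le> K" if "l \<in> \<Lambda>" for l using aK that True by (auto simp: Lbound_def)
      have aK_ball: "\<forall>l\<in>\<Lambda>. norm (a l) * w l \<le> K" by (intro ballI aK')
      obtain f where f: "holo f" "\<forall>z\<in>\<Lambda>. f z = a z"
        and fz: "\<forall>z. z \<noteq> 0 \<longrightarrow> summable (\<lambda>n. ?t a z n) \<and>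
          norm (f z) * w z \<le> D * (\<Sum>n. ?t a z n)"
        using main[OF K aK_ball] by (elim exE conjE)
      note fsum = fz[rule_format, THEN conjunct1] and fle = fz[rule_format, THEN conjunct2]
      have "norm (f z) * w z \<le> (D * S) * K" if z: "z \<noteq> 0" for z
      proof -
        have "(\<Sum>n. ?t a z n)
            \<le> (\<Sum>n. K * ?E eps (lg z) n)"
          by (intro suminf_le fsum z summable_mult S mult_right_mono aK' e) auto
        also have "\<dots> = K * (\<Sum>n. ?E eps (lg z) n)" by (rule suminf_mult[OF S(2)])
        also have "\<dots> \<le> K * S" using K by (intro mult_left_mono S)
        finally have "D * (\<Sum>n. ?t a z n) \<le> D * (K * S)"
          using D(1) by (intro mult_left_mono) auto
        then show ?thesis using fle[OF z] by (simp add: mult_ac)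
      qed
      then show ?thesis using f(1,2) True by (intro exI[of _ f]) (auto simp: Lbound_def)
    qed
    moreover have "0 < D * S" using D S by simp
    ultimately show ?thesis by blast
  next
    case False
    define Q where "Q = enn2real q"
    have Q: "0 < Q" using enn2real_pos[OF q False] by (simp add: Q_def)
    \<comment> \<open>The decay rate is split into halves. Raised to the power \<open>Q\<close>, the
      half attached to the data has rate \<open>c\<close>; the other half serves to sum the
      series.\<close>
    define c where "c = eps * Q / 2"
    have c: "0 < c" using D(2) Q by (simp add: c_def)
    obtain C7 where C7: "0 < C7" "\<And>s. (\<integral>\<^sup>+ z. ennreal (exp (- c * \<bar>lg z - s\<bar>)) \<partial>haar) \<le> ennreal C7"
      using haar_exp_integral[OF c] by blast
    have "\<exists>f. holo f \<and> (\<forall>z\<in>\<Lambda>. f z = a z) \<and> Fbound \<alpha> \<beta> q f ((D * S2 * C7 powr (1/Q)) * K)"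
      if K: "0 \<le> K" and aK: "Sbound \<alpha> \<beta> \<Lambda> q a K" for a K
    proof -
      define u where "u = (\<lambda>l. norm (a l) * w l)"
      have u0: "0 \<le> u l" for l by (simp add: u_def)
      have aK': "norm (a l) * w l \<le> K" if "l \<in> \<Lambda>" for l
        using Dbound_pointwise[OF aK q K that] by simp
      have uK: "(\<integral>\<^sup>+ l. ennreal (u l powr Q) \<partial>count_space \<Lambda>) \<le> ennreal (K powr Q)"
        using aK False by (simp add: Lbound_def u_def Q_def)
      have aK_ball: "\<forall>l\<in>\<Lambda>. norm (a l) * w l \<le> K" by (intro ballI aK')
      obtain f where f: "holo f" "\<forall>z\<in>\<Lambda>. f z = a z"
        and fz: "\<forall>z. z \<noteq> 0 \<longrightarrow> summable (\<lambda>n. ?t a z n) \<and>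
          norm (f z) * w z \<le> D * (\<Sum>n. ?t a z n)"
        using main[OF K aK_ball] by (elim exE conjE)
      note fsum = fz[rule_format, THEN conjunct1] and fle = fz[rule_format, THEN conjunct2]
      define Y where "Y = (\<lambda>z::complex. \<integral>\<^sup>+ l. ennreal (u l powr Q * exp (- c * \<bar>lg z - lg l\<bar>)) \<partial>count_space \<Lambda>)"
      have pt: "ennreal ((norm (f z) * w z) powr Q) \<le> ennreal ((D * S2) powr Q) * Y z" if z: "z \<noteq> 0" for z
      proof -
        have "Y z \<le> (\<integral>\<^sup>+ l. ennreal (u l powr Q) \<partial>count_space \<Lambda>)"
          unfolding Y_def using c by (intro nn_integral_mono ennreal_leI mult_right_le_one_le) auto
        also have "\<dots> < \<infinity>" using uK by (simp add: le_less_trans)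
        finally have Yfin: "Y z < \<infinity>" .
        define y where "y = enn2real (Y z)"
        have y: "0 \<le> y" "Y z = ennreal y" using Yfin by (simp_all add: y_def)
        \<comment> \<open>Instead of Hoelder's inequality, every damped coefficient is bounded by
          the whole \<open>Q\<close>-sum, and the remaining half of the decay is then summed. This
          works equally for \<open>Q < 1\<close> and \<open>Q \<ge> 1\<close>.\<close>
        have single: "u (e n) * ?E (eps/2) (lg z) n \<le> y powr (1/Q)" for n
        proof -
          have "ennreal (u (e n) powr Q * exp (- c * \<bar>lg z - lg (e n)\<bar>)) \<le> ennreal y"
            unfolding y(2)[symmetric] Y_def by (rule nn_integral_ge_point[OF e])
          then have le: "u (e n) powr Q * exp (- c * \<bar>lg z - lg (e n)\<bar>) \<le> y" using y(1) by (simp add: ennreal_le_iff)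
          have "(u (e n) * ?E (eps/2) (lg z) n) powr Q
              = u (e n) powr Q * exp (- c * \<bar>lg z - lg (e n)\<bar>)"
            using u0[of "e n"] by (simp add: powr_mult powr_def[of "exp _"] c_def abs_minus_commute mult_ac)
          then have "(u (e n) * ?E (eps/2) (lg z) n) powr Q \<le> (y powr (1/Q)) powr Q"
            using le y(1) Q by (simp add: powr_powr)
          then show ?thesis
            using powr_less_mono2[OF Q, of "y powr (1/Q)" "u (e n) * ?E (eps/2) (lg z) n"]
            by (meson not_less powr_ge_zero)
        qed
        have "(\<Sum>n. ?t a z n)
            \<le> (\<Sum>n. y powr (1/Q) * ?E (eps/2) (lg z) n)"
        proof (intro suminf_le fsum z summable_mult S2(2))
          fix n
          have "?E eps (lg z) n = ?E (eps/2) (lg z) n * ?E (eps/2) (lg z) n"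
            unfolding exp_add[symmetric] by simp
          then have "?t a z n
             = (u (e n) * ?E (eps/2) (lg z) n) * ?E (eps/2) (lg z) n"
            by (simp add: u_def)
          also have "\<dots> \<le> y powr (1/Q) * ?E (eps/2) (lg z) n"
            by (intro mult_right_mono single) auto
          finally show "?t a z n \<le> \<dots>" .
        qed
        also have "\<dots> = y powr (1/Q) * (\<Sum>n. ?E (eps/2) (lg z) n)" by (rule suminf_mult[OF S2(2)])
        also have "\<dots> \<le> y powr (1/Q) * S2" by (intro mult_left_mono S2) auto
        finally have "norm (f z) * w z \<le> D * (y powr (1/Q) * S2)"
          by (intro order_trans[OF fle[OF z]] mult_left_mono less_imp_le[OF D(1)])
        then have "(norm (f z) * w z) powr Q \<le> (D * (y powr (1/Q) * S2)) powr Q" using Q by (intro powr_mono2) auto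
        also have "\<dots> = (D * S2) powr Q * y" using D(1) S2(1) y(1) Q by (simp add: powr_mult powr_powr)
        finally have "ennreal ((norm (f z) * w z) powr Q) \<le> ennreal ((D * S2) powr Q * y)" by (rule ennreal_leI)
        then show ?thesis using y by (simp add: ennreal_mult')
      qed
      have Ym: "Y \<in> borel_measurable haar"
      proof -
        have "Y = (\<lambda>z. \<Sum>n. ennreal (u (e n) powr Q * exp (- c * \<bar>lg z - lg (e n)\<bar>)))"
          unfolding Y_def nn_integral_bij_count_space[OF bij, symmetric] by (simp add: nn_integral_count_space_nat)
        then show ?thesis by simp
      qed
      have "(\<integral>\<^sup>+ z. Y z \<partial>haar) = (\<integral>\<^sup>+ l. (\<integral>\<^sup>+ z. ennreal (u l powr Q * exp (- c * \<bar>lg z - lg l\<bar>)) \<partial>haar) \<partial>count_space \<Lambda>)"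
        unfolding Y_def by (rule nn_integral_count_space_nn_integral[OF countable]) measurable
      also have "\<dots> \<le> (\<integral>\<^sup>+ l. ennreal C7 * ennreal (u l powr Q) \<partial>count_space \<Lambda>)"
      proof (rule nn_integral_mono)
        fix l
        have "(\<integral>\<^sup>+ z. ennreal (u l powr Q * exp (- c * \<bar>lg z - lg l\<bar>)) \<partial>haar) =
           ennreal (u l powr Q) * (\<integral>\<^sup>+ z. ennreal (exp (- c * \<bar>lg z - lg l\<bar>)) \<partial>haar)"
          by (subst nn_integral_cmult[symmetric]) (auto simp: ennreal_mult')
        also have "\<dots> \<le> ennreal (u l powr Q) * ennreal C7" by (intro mult_left_mono C7) auto
        finally show "(\<integral>\<^sup>+ z. ennreal (u l powr Q * exp (- c * \<bar>lg z - lg l\<bar>)) \<partial>haar) \<le> ennreal C7 * ennreal (u l powr Q)"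
          by (simp only: mult.commute)
      qed
      also have "\<dots> = ennreal C7 * (\<integral>\<^sup>+ l. ennreal (u l powr Q) \<partial>count_space \<Lambda>)" by (rule nn_integral_cmult) simp
      also have "\<dots> \<le> ennreal C7 * ennreal (K powr Q)" by (intro mult_left_mono uK) auto
      finally have YI: "(\<integral>\<^sup>+ z. Y z \<partial>haar) \<le> ennreal C7 * ennreal (K powr Q)" .
      have "(\<integral>\<^sup>+ z. ennreal ((norm (f z) * w z) powr Q) \<partial>haar) \<le> (\<integral>\<^sup>+ z. ennreal ((D * S2) powr Q) * Y z \<partial>haar)"
        by (rule nn_integral_mono_AE, rule AE_mp[OF AE_haar], rule AE_I2) (use pt in auto)
      also have "\<dots> = ennreal ((D * S2) powr Q) * (\<integral>\<^sup>+ z. Y z \<partial>haar)" by (rule nn_integral_cmult[OF Ym])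
      also have "\<dots> \<le> ennreal ((D * S2) powr Q) * (ennreal C7 * ennreal (K powr Q))"
        by (intro mult_left_mono YI) auto
      also have "\<dots> = ennreal ((D * S2 * C7 powr (1/Q) * K) powr Q)"
        using D(1) S2(1) C7(1) K Q by (simp add: powr_mult powr_powr mult.assoc flip: ennreal_mult')
      finally show ?thesis using f(1,2) False by (intro exI[of _ f]) (simp add: Lbound_def Q_def)
    qed
    moreover have "0 < D * S2 * C7 powr (1/Q)" using D S2 C7 by simp
    ultimately show ?thesis by blast
  qed
qed

text \<open>Separation supplies bounded restriction and the kernel series supplies interpolation.
  For uniqueness the bound for exponent \<open>q\<close> is weakened to a sup bound, where
  \<open>unique_bounded\<close> applies.\<close>

lemma weighted_ci_transfer:
  assumes q: "0 < q"
  shows "\<exists>C>0. weighted_ci \<alpha> \<beta> q \<Lambda> C"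
proof -
  obtain r where "separated r \<Lambda>" using separation by blast
  then interpret separated r \<Lambda> .
  obtain Ca where Ca: "0 < Ca" "\<And>f K. holo f \<Longrightarrow> 0 \<le> K \<Longrightarrow>
    Fbound \<alpha> \<beta> q f K \<Longrightarrow> Sbound \<alpha> \<beta> \<Lambda> q f (Ca * K)"
    using restriction_bounded[OF alpha q, of \<beta>] by blast
  obtain Cb where Cb: "0 < Cb" "\<And>a K. 0 \<le> K \<Longrightarrow> Sbound \<alpha> \<beta> \<Lambda> q a K \<Longrightarrow>
    (\<exists>f. holo f \<and> (\<forall>z\<in>\<Lambda>. f z = a z) \<and> Fbound \<alpha> \<beta> q f (Cb * K))"
    using synthesis[OF q] by blast
  obtain C1 where C1: "0 < C1" "\<And>f K. holo f \<Longrightarrow> 0 \<le> K \<Longrightarrow>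
    Fbound \<alpha> \<beta> q f K \<Longrightarrow> (\<forall>z. z \<noteq> 0 \<longrightarrow> norm (f z) * w z \<le> C1 * K)"
    using Cbound_pointwise[OF alpha q, of \<beta>] by blast
  define M where "M = max Ca Cb"
  have M: "0 < M" "Ca \<le> M" "Cb \<le> M" using Ca(1) by (auto simp: M_def)
  have "weighted_ci \<alpha> \<beta> q \<Lambda> M"
    unfolding weighted_ci_def
  proof (intro conjI allI impI)
    fix f K assume f: "holo f" "0 \<le> K" "Fbound \<alpha> \<beta> q f K"
    show "Sbound \<alpha> \<beta> \<Lambda> q f (M * K)"
    proof (rule Lbound_mono[OF AE_count_space_mem _ _ Ca(2)[OF f]])
      show "Ca * K \<le> M * K" using M f(2) by (intro mult_right_mono) auto
      show "0 \<le> Ca * K" using Ca(1) f(2) by simp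
    qed auto
  next
    fix a :: "complex \<Rightarrow> complex" and K assume a: "0 \<le> K" "Sbound \<alpha> \<beta> \<Lambda> q a K"
    obtain f where f: "holo f" "\<forall>z\<in>\<Lambda>. f z = a z" "Fbound \<alpha> \<beta> q f (Cb * K)"
      using Cb(2)[OF a] by (elim exE conjE)
    have "Fbound \<alpha> \<beta> q f (M * K)"
    proof (rule Lbound_mono[OF AE_haar _ _ f(3)])
      show "Cb * K \<le> M * K" using M a(1) by (intro mult_right_mono) auto
      show "0 \<le> Cb * K" using Cb(1) a(1) by simp
    qed auto
    then show "\<exists>f. holo f \<and> (\<forall>z\<in>\<Lambda>. f z = a z) \<and> Fbound \<alpha> \<beta> q f (M * K)"
      using f(1,2) by (intro exI[of _ f] conjI)
  next
    fix f K z assume f: "holo f" "0 \<le> K" "Fbound \<alpha> \<beta> q f K"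
      "\<forall>z\<in>\<Lambda>. f z = 0" and z: "z \<noteq> (0::complex)"
    have bnd: "norm (f z) * w z \<le> C1 * K" if "z \<noteq> 0" for z
      using C1(2)[OF f(1-3)] that by (elim allE[of _ z]) simp
    have f0: "f z = 0" if "z \<in> \<Lambda>" for z using f(4) that by simp
    show "f z = 0" by (rule unique_bounded[OF f(1) bnd f0 z])
  qed
  then show ?thesis using M(1) by (intro exI[of _ M] conjI)
qed

end

section \<open>Return to complete interpolation\<close>

lemma complete_interpolating_transfer:
  assumes "0 < \<alpha>" "0 < p" "0 < q" "two_over p - two_over q \<in> \<int>" and sub: "\<Lambda> \<subseteq> punctured_plane"
    and ci: "complete_interpolating \<alpha> p \<Lambda>"
  shows "complete_interpolating \<alpha> q \<Lambda>"
proof -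
  obtain C where C: "0 < C" "weighted_ci \<alpha> (two_over p) p \<Lambda> C"
    using complete_interpolating_imp_weighted[OF assms(2) sub ci] by blast
  obtain n where "two_over p - two_over q = of_int n" using assms(4) by (auto elim: Ints_cases)
  then have n: "two_over q = two_over p + of_int (- n)" by simp
  \<comment> \<open>The weight is moved first, with the exponent still \<open>p\<close>; the
    resulting mixed statement, weight of \<open>q\<close> with exponent \<open>p\<close>, is the
    reason for keeping the two parameters apart.\<close>
  have "weighted_ci \<alpha> (two_over q) p \<Lambda> C"
    unfolding n by (rule weighted_ci_shift[OF sub C(2)])
  then interpret interpolating \<alpha> "two_over q" p \<Lambda> C
    using assms C by unfold_locales auto
  obtain C' where "0 < C'" "weighted_ci \<alpha> (two_over q) q \<Lambda> C'"
    using weighted_ci_transfer[OF assms(3)] by blast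
  then show ?thesis by (rule weighted_imp_complete_interpolating[OF assms(3) sub])
qed

theorem mainTheorem3:
  fixes \<alpha> :: real
  assumes "\<alpha> > 0"
  shows "(\<forall>p q :: ennreal. 0 < p \<longrightarrow> 0 < q \<longrightarrow> two_over p - two_over q \<in> \<int> \<longrightarrow>
            (\<forall>\<Lambda> \<subseteq> punctured_plane.
               complete_interpolating \<alpha> p \<Lambda> \<longleftrightarrow> complete_interpolating \<alpha> q \<Lambda>))
       \<and> (\<forall>\<Lambda> \<subseteq> punctured_plane.
            (complete_interpolating \<alpha> \<infinity> \<Lambda> \<longleftrightarrow> complete_interpolating \<alpha> 2 \<Lambda>) \<and>
            (complete_interpolating \<alpha> 2 \<Lambda> \<longleftrightarrow> complete_interpolating \<alpha> 1 \<Lambda>))"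
proof -
  have main: "complete_interpolating \<alpha> p \<Lambda> \<longleftrightarrow> complete_interpolating \<alpha> q \<Lambda>"
    if "0 < p" "0 < q" "two_over p - two_over q \<in> \<int>" "\<Lambda> \<subseteq> punctured_plane" for p q \<Lambda>
  proof -
    have "two_over q - two_over p \<in> \<int>" using Ints_minus[OF that(3)] by simp
    then show ?thesis
      using complete_interpolating_transfer[OF assms that(1,2,3,4)]
        complete_interpolating_transfer[OF assms that(2,1) _ that(4)] by blast
  qed
  have t: "two_over top = 0" "two_over 2 = 1" "two_over 1 = 2" by (auto simp: two_over_def)
  have "complete_interpolating \<alpha> \<infinity> \<Lambda> \<longleftrightarrow> complete_interpolating \<alpha> 2 \<Lambda>"
    "complete_interpolating \<alpha> 2 \<Lambda> \<longleftrightarrow> complete_interpolating \<alpha> 1 \<Lambda>" if "\<Lambda> \<subseteq> punctured_plane" for \<Lambda>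
    by (rule main[OF _ _ _ that]; simp add: t)+
  with main show ?thesis by blast
qed

end
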